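(* Let $K\ge1$ be an integer, and let $\nu_k\in\mathbb{R}$, $k=1,\dots,K$, be constants not all zero. Consider the equation $$(\mathrm{E})\qquad \partial_tu-\mathcal{H}_x\partial_x^2u-\mathcal{H}_x\partial_y^2u+\sum_{k=1}^K\nu_ku^k\partial_xu=0,\quad (x,y)\in\mathbb{R}\times\mathbb{T}.$$ (i) Let $\frac14<\theta<\frac12$, $s_1\ge\frac{8\theta+2}{4\theta-1}$, $s_2>\frac{6\theta}{4\theta-1}$. Let $u\in C([0,T];H^{s_1,s_2}(\mathbb{R}\times\mathbb{T}))\cap C([0,T];L^2(|x|^{2\theta}\,dxdy))$ be a solution of $(\mathrm{E})$ such that there exist two different times $t_2>t_1$ in $[0,T]$ with $$u(t_1),\,u(t_2)\in L^2(|x|^{1^+}\,dxdy).$$ Then $$\int_{\mathbb{T}}\int_{\mathbb{R}}e^{-i\eta y}u(x,y,t)\,dxdy=0$$ for all $t\in[t_1,T]$ and all $\eta\in\mathbb{Z}$ such that $|t_2-t_1|\eta^2\neq2\pi l'$ for each $l'\in\mathbb{Z}$ with $l'\ge0$. (ii) Let $1<\theta<\frac32$, $s_1\ge\frac{8\theta+6}{4\theta-3}$, $s_2>\frac{6\theta}{4\theta-3}$. Let $u\in C([0,T];H^{s_1,s_2}(\mathbb{R}\times\mathbb{T}))\cap C([0,T];L^2(|x|^{2\theta}\,dxdy))$ be a solution of $(\mathrm{E})$ such that $$\int_{\mathbb{T}}\int_{\mathbb{R}}e^{-iy\eta}u(x,y,t)\,dxdy=0\quad\text{for all }\eta\in\mathbb{Z},\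 t\in[0,T],$$ and such that there exist two different times $t_2>t_1$ in $[0,T]$ for which $$u(t_1),\,u(t_2)\in L^2(|x|^{3^+}\,dxdy).$$ Then $$\sin((t_2-t_1)\eta^2)\,\frac{\partial}{\partial\xi}\widehat u(0,\eta,t_1)=\int_0^{t_2-t_1}\sin((t_2-t_1-\tau)\eta^2)\Big(\sum_{k=1}^K\frac{i\nu_k}{k+1}\widehat{u^{k+1}}(0,\eta,\tau)\Big)\,d\tau$$ for all $\eta\in\mathbb{Z}$. In particular, if for some $0<T_1\le T$, $u\in L^\infty([0,T_1];L^2(|x|^{3^+}\,dxdy))$ with $u(0)\in L^2(|x|^{3^+}\,dxdy)$, then $$\int_{\mathbb{T}}\int_{\mathbb{R}}e^{-i\eta y}x\,u(x,y,0)\,dxdy=0\quad\text{for all }\eta\in\mathbb{Z}\setminus\{0\}.$$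
   Context: $\mathbb{T}=\mathbb{R}/2\pi\mathbb{Z}$; $\langle x\rangle=(1+|x|^2)^{1/2}$. $L^2(|x|^{2\theta}\,dxdy)$ is the space of functions on $\mathbb{R}\times\mathbb{T}$ that are square integrable with respect to $|x|^{2\theta}\,dxdy$; for a number $a$, $L^2(|x|^{a^+}\,dxdy)$ means $L^2(|x|^{a+\varepsilon}\,dxdy)$ for some $\varepsilon>0$. The Fourier transform is in the space variables, $\widehat f(\xi,\eta)=\int_{\mathbb{T}}\int_{\mathbb{R}}f(x,y)e^{-ix\xi-iy\eta}\,dxdy$, $\xi\in\mathbb{R}$, $\eta\in\mathbb{Z}$, and $\widehat u(\xi,\eta,t)$, $\widehat{u^{k+1}}(\xi,\eta,t)$ denote the Fourier transforms of $u(\cdot,\cdot,t)$, $u^{k+1}(\cdot,\cdot,t)$; thus $\int_{\mathbb{T}}\int_{\mathbb{R}}e^{-i\eta y}u(x,y,t)\,dxdy$ is $\widehat u(0,\eta,t)$. $\mathcal{H}_x$ is the Hilbert transform in $x$: $\widehat{\mathcal{H}_xf}(\xi,\eta)=-i\,\mathrm{sign}(\xi)\widehat f(\xi,\eta)$. The anisotropic Sobolev space $H^{s_1,s_2}(\mathbb{R}\times\mathbb{T})$ is defined by the norm $\|f\|_{H^{s_1,s_2}}=\|J_x^{s_1}f\|_{L^2}+\|J_y^{s_2}f\|_{L^2}$, where $\widehat{J_x^{s}f}=\langle\xi\rangle^{s}\widehat f$ and $\widehat{J_y^{s}f}=\langle\eta\rangle^{s}\widehat f$.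
   Formalization: In (i) the excluded frequencies are those with |t2−t1|η² = πl (l ≥ 0) instead of 2πl', as the printed claim fails at odd multiples of π; in (ii) the transform of u^{k+1} on the right is taken at time t1+τ instead of τ (the same when t1 = 0). *)

theory Defs
  imports "HOL-Analysis.Analysis"
begin

(* R x T, with T = R/2piZ represented by the fundamental domain [0,2pi). A function on R x T is
   a complex-valued function on real * real of which only the values on R x [0,2pi) matter. *)
definition cyl :: "(real \<times> real) measure" where
  "cyl = lborel \<Otimes>\<^sub>M restrict_space lborel {0..<2 * pi}"

(* The measure |x|^a dx dy on R x T. *)
definition wcyl :: "real \<Rightarrow> (real \<times> real) measure" where
  "wcyl a = density cyl (\<lambda>p. ennreal (\<bar>fst p\<bar> powr a))"

(* The frequency space R x Z. *)
definition freq :: "(real \<times> int) measure" where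
  "freq = lborel \<Otimes>\<^sub>M count_space UNIV"

definition L2 :: "'a measure \<Rightarrow> ('a \<Rightarrow> complex) set" where
  "L2 M = {f \<in> borel_measurable M. integrable M (\<lambda>z. (cmod (f z))\<^sup>2)}"

definition l2norm :: "'a measure \<Rightarrow> ('a \<Rightarrow> complex) \<Rightarrow> real" where
  "l2norm M f = sqrt (\<integral>z. (cmod (f z))\<^sup>2 \<partial>M)"

definition L2_tendsto ::
  "'a measure \<Rightarrow> ('t \<Rightarrow> 'a \<Rightarrow> complex) \<Rightarrow> ('a \<Rightarrow> complex) \<Rightarrow> 't filter \<Rightarrow> bool" where
  "L2_tendsto M g f F \<longleftrightarrow>
     f \<in> L2 M \<and> (\<forall>\<^sub>F t in F. g t \<in> L2 M) \<and> ((\<lambda>t. l2norm M (\<lambda>z. g t z - f z)) \<longlongrightarrow> 0) F"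

(* L^2(|x|^{a+} dxdy) *)
definition L2_plus :: "real \<Rightarrow> (real \<times> real \<Rightarrow> complex) set" where
  "L2_plus a = (\<Union>\<epsilon>\<in>{0<..}. L2 (wcyl (a + \<epsilon>)))"

(* C([0,T]; L^2(M)) *)
definition cont_L2 :: "real \<Rightarrow> 'a measure \<Rightarrow> (real \<Rightarrow> 'a \<Rightarrow> complex) set" where
  "cont_L2 T M = {u. (\<forall>t\<in>{0..T}. u t \<in> L2 M) \<and>
     (\<forall>t\<in>{0..T}. ((\<lambda>s. l2norm M (\<lambda>z. u s z - u t z)) \<longlongrightarrow> 0) (at t within {0..T}))}"

(* L^infinity([0,T]; L^2(|x|^{a+} dxdy)), with one epsilon for almost all times. *)
definition Linf_L2_plus :: "real \<Rightarrow> real \<Rightarrow> (real \<Rightarrow> real \<times> real \<Rightarrow> complex) set" where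
  "Linf_L2_plus T a = {u. \<exists>\<epsilon>>0. \<exists>C. AE t in lborel. t \<in> {0..T} \<longrightarrow>
     u t \<in> L2 (wcyl (a + \<epsilon>)) \<and> l2norm (wcyl (a + \<epsilon>)) (u t) \<le> C}"

(* The Fourier integral; it has its meaning for functions that are integrable on R x T. *)
definition fourier :: "(real \<times> real \<Rightarrow> complex) \<Rightarrow> real \<times> int \<Rightarrow> complex" where
  "fourier f = (\<lambda>(\<xi>, \<eta>).
     \<integral>(x, y). f (x, y) * exp (- \<i> * of_real (x * \<xi>) - \<i> * of_real (y * of_int \<eta>)) \<partial>cyl)"

(* The Fourier transform on L^2(R x T), which is determined almost everywhere on R x Z: F is the
   L^2 limit of the Fourier integrals of the truncations of f to |x| <= R. *)
definition is_fourier :: "(real \<times> real \<Rightarrow> complex) \<Rightarrow> (real \<times> int \<Rightarrow> complex) \<Rightarrow> bool" where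
  "is_fourier f F \<longleftrightarrow> f \<in> L2 cyl \<and>
     L2_tendsto freq (\<lambda>R. fourier (\<lambda>p. if \<bar>fst p\<bar> \<le> R then f p else 0)) F at_top"

(* The L^2 Fourier transform of f has the value c at the single point (xi, eta): it has a
   version that is continuous in xi there, with value c. Such a c is unique, and for integrable
   f it is the Fourier integral. This gives f^(0,eta) a meaning for functions in L^2 that are not
   integrable, for which the Bochner integral in fourier would be 0 by convention. *)
definition has_fourier_value ::
  "(real \<times> real \<Rightarrow> complex) \<Rightarrow> real \<Rightarrow> int \<Rightarrow> complex \<Rightarrow> bool" where
  "has_fourier_value f \<xi> \<eta> c \<longleftrightarrow>
     (\<exists>F. is_fourier f F \<and> isCont (\<lambda>\<zeta>. F (\<zeta>, \<eta>)) \<xi> \<and> F (\<xi>, \<eta>) = c)"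

(* g = m(D) f in L^2, where m(D) is the Fourier multiplier operator with symbol m. *)
definition is_mult ::
  "(real \<Rightarrow> int \<Rightarrow> complex) \<Rightarrow> (real \<times> real \<Rightarrow> complex) \<Rightarrow> (real \<times> real \<Rightarrow> complex) \<Rightarrow> bool" where
  "is_mult m f g \<longleftrightarrow> (\<exists>F. is_fourier f F \<and> is_fourier g (\<lambda>(\<xi>, \<eta>). m \<xi> \<eta> * F (\<xi>, \<eta>)))"

(* m(D) f itself, determined almost everywhere when it exists in L^2. *)
definition mult ::
  "(real \<Rightarrow> int \<Rightarrow> complex) \<Rightarrow> (real \<times> real \<Rightarrow> complex) \<Rightarrow> real \<times> real \<Rightarrow> complex" where
  "mult m f = (SOME g. is_mult m f g)"

definition bracket :: "real \<Rightarrow> real" where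
  "bracket x = (1 + \<bar>x\<bar>\<^sup>2) powr (1 / 2)"

definition Jx_symbol :: "real \<Rightarrow> real \<Rightarrow> int \<Rightarrow> complex" where
  "Jx_symbol s \<xi> \<eta> = of_real (bracket \<xi> powr s)"

definition Jy_symbol :: "real \<Rightarrow> real \<Rightarrow> int \<Rightarrow> complex" where
  "Jy_symbol s \<xi> \<eta> = of_real (bracket (of_int \<eta>) powr s)"

definition dx_symbol :: "real \<Rightarrow> int \<Rightarrow> complex" where
  "dx_symbol \<xi> \<eta> = \<i> * of_real \<xi>"

definition dy_symbol :: "real \<Rightarrow> int \<Rightarrow> complex" where
  "dy_symbol \<xi> \<eta> = \<i> * of_int \<eta>"

definition hilbert_symbol :: "real \<Rightarrow> int \<Rightarrow> complex" where
  "hilbert_symbol \<xi> \<eta> = - \<i> * of_real (sgn \<xi>)"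

definition sobolev :: "real \<Rightarrow> real \<Rightarrow> (real \<times> real \<Rightarrow> complex) set" where
  "sobolev s1 s2 = {f. (\<exists>g. is_mult (Jx_symbol s1) f g) \<and> (\<exists>g. is_mult (Jy_symbol s2) f g)}"

definition sobolev_norm :: "real \<Rightarrow> real \<Rightarrow> (real \<times> real \<Rightarrow> complex) \<Rightarrow> real" where
  "sobolev_norm s1 s2 f = l2norm cyl (mult (Jx_symbol s1) f) + l2norm cyl (mult (Jy_symbol s2) f)"

(* C([0,T]; H^{s1,s2}(R x T)) *)
definition cont_sobolev :: "real \<Rightarrow> real \<Rightarrow> real \<Rightarrow> (real \<Rightarrow> real \<times> real \<Rightarrow> complex) set" where
  "cont_sobolev T s1 s2 = {u. (\<forall>t\<in>{0..T}. u t \<in> sobolev s1 s2) \<and>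
     (\<forall>t\<in>{0..T}. ((\<lambda>s. sobolev_norm s1 s2 (\<lambda>p. u s p - u t p)) \<longlongrightarrow> 0) (at t within {0..T}))}"

(* u solves the equation on [0,T] in L^2: the time derivative ut (one-sided at 0 and T) is taken
   in L^2(R x T), and hxx, hyy, ux are the terms H_x d_x^2 u, H_x d_y^2 u, d_x u. *)
definition solves_E ::
  "nat \<Rightarrow> (nat \<Rightarrow> real) \<Rightarrow> real \<Rightarrow> (real \<Rightarrow> real \<times> real \<Rightarrow> complex) \<Rightarrow> bool" where
  "solves_E K \<nu> T u \<longleftrightarrow> (\<forall>t\<in>{0..T}. \<exists>ut hxx hyy ux.
     L2_tendsto cyl (\<lambda>s p. (u s p - u t p) / of_real (s - t)) ut (at t within {0..T}) \<and>
     is_mult (\<lambda>\<xi> \<eta>. hilbert_symbol \<xi> \<eta> * (dx_symbol \<xi> \<eta>)\<^sup>2) (u t) hxx \<and>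
     is_mult (\<lambda>\<xi> \<eta>. hilbert_symbol \<xi> \<eta> * (dy_symbol \<xi> \<eta>)\<^sup>2) (u t) hyy \<and>
     is_mult dx_symbol (u t) ux \<and>
     (AE p in cyl. ut p - hxx p - hyy p + (\<Sum>k=1..K. of_real (\<nu> k) * u t p ^ k * ux p) = 0))"

end

theory Submission imports Defs "HOL-Probability.Probability" begin

text \<open>
For an integer \<eta> let \<open>m(\<xi>) = sgn \<xi> (\<xi>\<^sup>2 + \<eta>\<^sup>2)\<close>. In Fourier variables the equation reads
\<open>\<partial>\<^sub>t u^ = i m u^ - \<xi> P\<close>, where \<open>P(t, \<xi>)\<close> is the sum of the \<open>i \<nu>\<^sub>k / (k+1)\<close> times the Fourier
integrals of the powers \<open>u(t)^(k+1)\<close>. Duhamel's formula says that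
\<open>exp(-i t\<^sub>2 m) u^(t\<^sub>2) = exp(-i t\<^sub>1 m) u^(t\<^sub>1) - \<xi> \<integral> exp(-i t m) P(t, \<xi>) dt\<close>
for almost every \<xi>, the integral running from \<open>t\<^sub>1\<close> to \<open>t\<^sub>2\<close>.

The theorem comes from the jump of the phase \<open>m\<close> at \<open>\<xi> = 0\<close>, from \<open>-\<eta>\<^sup>2\<close> to \<open>\<eta>\<^sup>2\<close>. A weight
\<open>|x|^(1+)\<close> makes \<open>u(t\<^sub>1)\<close> and \<open>u(t\<^sub>2)\<close> integrable, so that their Fourier transforms are continuous at
\<open>\<xi> = 0\<close>. The limits of Duhamel's formula from the right and from the left are then two linear
relations between \<open>u^(0,\<eta>,t\<^sub>1)\<close> and \<open>u^(0,\<eta>,t\<^sub>2)\<close>, and elimination of the latter gives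
\<open>sin((t\<^sub>2 - t\<^sub>1) \<eta>\<^sup>2) u^(0,\<eta>,t\<^sub>1) = 0\<close>. If the sine is nonzero, the mean vanishes at \<open>t\<^sub>1\<close>, and Duhamel's
formula bounds \<open>u^(t)\<close> near \<open>\<xi> = 0\<close> at every later time by functions that vanish at \<open>0\<close>.
If all means vanish and the weight is \<open>|x|^(3+)\<close>, the Fourier transforms are differentiable at
\<open>\<xi> = 0\<close>; the formula is divided by \<xi> before passing to the limits, and the same elimination gives
the identity for the first moment. If the decay persists, its right-hand side is \<open>O((t\<^sub>2 - t\<^sub>1)\<^sup>2)\<close> while
the sine is of order \<open>t\<^sub>2 - t\<^sub>1\<close>, so that the first moment vanishes.

Duhamel's formula has to be derived from a differential equation in \<open>L\<^sup>2\<close> that holds at every time.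
Bessel's inequality (\<open>fourier_bessel\<close>, \<open>sqnorm_is_fourier_le\<close>) carries the \<open>L\<^sup>2\<close> derivative in time over
to the frequency side (\<open>uhat_time_derivative\<close>). The inversion formula (\<open>fourier_inversion\<close>) applies
because Sobolev functions have integrable Fourier transforms (\<open>sobolev_decay\<close>); it makes \<open>u\<close> bounded
and differentiable in \<open>x\<close>, which justifies the chain rule
\<open>u^k \<partial>\<^sub>x u = \<partial>\<^sub>x (u^(k+1)) / (k+1)\<close> on the Fourier side (\<open>fourier_power_times_deriv\<close>). Finally \<open>P\<close> is
jointly continuous in \<open>(t, \<xi>)\<close>, so that integrating the equation over an interval in \<xi> and then in
time, and exchanging the two integrals, yields \<open>duhamel_formula\<close>.
\<close>

section \<open>Functions determined by their integrals\<close>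

lemma integrable_times_bounded:
  fixes f g :: "'a \<Rightarrow> complex"
  assumes "integrable M f" and [measurable]: "g \<in> borel_measurable M" and "\<And>x. cmod (g x) \<le> C"
  shows "integrable M (\<lambda>x. f x * g x)"
proof (rule Bochner_Integration.integrable_bound[where f="\<lambda>x. C * cmod (f x)"])
  have [measurable]: "f \<in> borel_measurable M" using assms(1) by auto
  show "(\<lambda>x. f x * g x) \<in> borel_measurable M" by measurable
  show "AE x in M. norm (f x * g x) \<le> norm (C * cmod (f x))"
  proof (intro AE_I2)
    fix x
    have "C \<ge> 0" using assms(3)[of x] norm_ge_zero order_trans by blast
    thus "norm (f x * g x) \<le> norm (C * cmod (f x))"
      using assms(3)[of x] by (simp add: norm_mult abs_mult mult.commute[of "cmod (f x)"] mult_right_mono)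
  qed
qed (use assms in auto)

lemma integrable_times_cis:
  assumes "integrable M f" and "h \<in> borel_measurable M"
  shows "integrable M (\<lambda>x. f x * cis (h x))"
proof (rule integrable_times_bounded[where C=1])
  have [measurable]: "h \<in> borel_measurable M" by fact
  show "(\<lambda>x. cis (h x)) \<in> borel_measurable M" unfolding cis_conv_exp by measurable
qed (use assms in auto)

lemma borel_measurable_cis [measurable (raw)]:
  "h \<in> borel_measurable M \<Longrightarrow> (\<lambda>x. cis (h x)) \<in> borel_measurable M"
  unfolding cis_conv_exp by measurable

lemma AE_zero_if_integrals_zero:
  fixes g :: "'a \<Rightarrow> complex"
  assumes g: "integrable M g" and z: "\<And>A. A \<in> sets M \<Longrightarrow> (\<integral>x\<in>A. g x \<partial>M) = 0"
  shows "AE x in M. g x = 0"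
proof -
  have gm: "g \<in> borel_measurable M" using g by auto
  have gA: "integrable M (\<lambda>x. indicator A x *\<^sub>R g x)" if "A \<in> sets M" for A
    using integrable_mult_indicator[OF that g] .
  have "AE x in M. Re (g x) = 0"
  proof (rule density_unique_real)
    show "integrable M (\<lambda>x. Re (g x))" using g by auto
    fix A assume A: "A \<in> sets M"
    have "(\<integral>x\<in>A. Re (g x) \<partial>M) = Re (\<integral>x\<in>A. g x \<partial>M)"
      unfolding set_lebesgue_integral_def
      by (subst integral_Re[symmetric, OF gA[OF A]]) (rule Bochner_Integration.integral_cong, auto simp: indicator_def)
    thus "(\<integral>x\<in>A. Re (g x) \<partial>M) = (\<integral>x\<in>A. 0 \<partial>M)" using z[OF A] by simp
  qed auto
  moreover have "AE x in M. Im (g x) = 0"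
  proof (rule density_unique_real)
    show "integrable M (\<lambda>x. Im (g x))" using g by auto
    fix A assume A: "A \<in> sets M"
    have "(\<integral>x\<in>A. Im (g x) \<partial>M) = Im (\<integral>x\<in>A. g x \<partial>M)"
      unfolding set_lebesgue_integral_def
      by (subst integral_Im[symmetric, OF gA[OF A]]) (rule Bochner_Integration.integral_cong, auto simp: indicator_def)
    thus "(\<integral>x\<in>A. Im (g x) \<partial>M) = (\<integral>x\<in>A. 0 \<partial>M)" using z[OF A] by simp
  qed auto
  ultimately show ?thesis by eventually_elim (simp add: complex_eq_iff)
qed

text \<open>Half-open intervals are closed under intersection and generate the Borel sets. The sets on which the
integral of \<open>g\<close> vanishes are closed under disjoint countable unions and, since the total integral is
zero, under complements, so they are all the Borel sets.\<close>

lemma AE_zero_if_Ioc_integrals_zero: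
  fixes g :: "real \<Rightarrow> complex"
  assumes g: "integrable lborel g" and U: "(\<integral>x. g x \<partial>lborel) = 0"
    and z: "\<And>a b. a \<le> b \<Longrightarrow> (LINT x:{a<..b}|lborel. g x) = 0"
  shows "AE x in lborel. g x = 0"
proof (rule AE_zero_if_integrals_zero[OF g])
  have gm[measurable]: "g \<in> borel_measurable borel" using borel_measurable_integrable[OF g] by simp
  fix A :: "real set" assume "A \<in> sets lborel"
  hence "A \<in> sigma_sets UNIV (range (\<lambda>(a, b). {a <.. b::real}))"
    by (metis borel_sigma_sets_Ioc sets_lborel sets_measure_of_conv subset_UNIV Pow_UNIV)
  thus "(\<integral>x\<in>A. g x \<partial>lborel) = 0"
  proof (induction rule: sigma_sets_induct_disjoint[rotated 2, consumes 1, case_names basic empty compl union stable space])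
    show "Int_stable (range (\<lambda>(a, b). {a <.. b::real}))"
      unfolding Int_stable_def by (auto simp: image_iff)
  next
    case (basic A)
    then obtain a b where "A = {a<..b}" by auto
    thus ?case using z[of a b] by (cases "a \<le> b") (auto simp: set_lebesgue_integral_def)
  next
    case empty thus ?case by (simp add: set_lebesgue_integral_def)
  next
    case (compl A)
    have A: "A \<in> sets borel" using compl(1) by (metis borel_sigma_sets_Ioc sets_measure_of_conv subset_UNIV Pow_UNIV)
    have "(\<integral>x\<in>A \<union> (UNIV - A). g x \<partial>lborel) = (\<integral>x\<in>A. g x \<partial>lborel) + (\<integral>x\<in>UNIV - A. g x \<partial>lborel)"
      by (rule set_integral_Un) (use A g in \<open>auto simp: set_integrable_def intro!: integrable_mult_indicator[of _ _ g, simplified]\<close>)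
    thus ?case using compl(2) U by (simp add: set_lebesgue_integral_def)
  next
    case (union A)
    have A: "A i \<in> sets borel" for i using union(2) by (metis borel_sigma_sets_Ioc sets_measure_of_conv subset_UNIV Pow_UNIV range_subsetD)
    have "(\<integral>x\<in>(\<Union>i. A i). g x \<partial>lborel) = (\<Sum>i. (\<integral>x\<in>A i. g x \<partial>lborel))"
    proof (rule lebesgue_integral_countable_add)
      show "set_integrable lborel (\<Union> (range A)) g"
        unfolding set_integrable_def by (rule integrable_mult_indicator[OF _ g]) (use A in auto)
    qed (use A union(1) in \<open>auto simp: disjoint_family_on_def\<close>)
    thus ?case using union(3) by simp
  qed auto
qed

text \<open>The restriction of \<open>g\<close> to \<open>[-n, n]\<close> is integrable, and its integral
over an interval is the integral of \<open>g\<close> over a smaller one.\<close>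

lemma AE_zero_if_interval_integrals_zero:
  fixes g :: "real \<Rightarrow> complex"
  assumes g: "\<And>a b. set_integrable lborel {a..b} g"
    and z: "\<And>a b. a \<le> b \<Longrightarrow> (LINT x:{a..b}|lborel. g x) = 0"
  shows "AE x in lborel. g x = 0"
proof -
  have "AE x in lborel. indicator {- real n..real n} x *\<^sub>R g x = 0" for n
  proof (rule AE_zero_if_Ioc_integrals_zero)
    let ?g = "\<lambda>x. indicator {- real n..real n} x *\<^sub>R g x"
    show i: "integrable lborel ?g" using g[of "- real n" "real n"] unfolding set_integrable_def .
    show "(\<integral>x. ?g x \<partial>lborel) = 0" using z[of "- real n" "real n"] by (simp add: set_lebesgue_integral_def)
    fix a b :: real assume "a \<le> b"
    have "(LINT x:{a<..b}|lborel. ?g x) = (LINT x:{a..b}|lborel. ?g x)"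
    proof (rule set_integral_null_delta[OF i])
      have "({a<..b} - {a..b}) \<union> ({a..b} - {a<..b}) \<subseteq> {a}" by auto
      thus "({a<..b} - {a..b}) \<union> ({a..b} - {a<..b}) \<in> null_sets lborel"
        by (meson countable_imp_null_set_lborel countable_empty countable_insert countable_subset)
    qed auto
    also have "\<dots> = (LINT x:{max a (-real n)..min b (real n)}|lborel. g x)"
      unfolding set_lebesgue_integral_def
      by (rule Bochner_Integration.integral_cong) (auto simp: indicator_def)
    also have "\<dots> = 0"
      using z[of "max a (-real n)" "min b (real n)"]
      by (cases "max a (-real n) \<le> min b (real n)") (auto simp: set_lebesgue_integral_def)
    finally show "(LINT x:{a<..b}|lborel. ?g x) = 0" .
  qed
  hence "AE x in lborel. \<forall>n. indicator {- real n..real n} x *\<^sub>R g x = 0"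
    unfolding AE_all_countable by blast
  thus ?thesis
  proof eventually_elim
    case (elim x)
    obtain n where "\<bar>x\<bar> \<le> real n" using real_arch_simple by blast
    thus ?case using elim[rule_format, of n] by (auto simp: indicator_def)
  qed
qed

lemma (in pair_sigma_finite) integrable_fst_times_snd:
  fixes f :: "'a \<Rightarrow> complex" and g :: "'b \<Rightarrow> complex"
  assumes f: "integrable M1 f" and g: "integrable M2 g"
  shows "integrable (M1 \<Otimes>\<^sub>M M2) (\<lambda>p. f (fst p) * g (snd p))"
proof (rule Fubini_integrable)
  have [measurable]: "f \<in> borel_measurable M1" "g \<in> borel_measurable M2" using f g by auto
  show "(\<lambda>p. f (fst p) * g (snd p)) \<in> borel_measurable (M1 \<Otimes>\<^sub>M M2)" by measurable
  have "integrable M1 (\<lambda>x. cmod (f x) * (\<integral>y. cmod (g y) \<partial>M2))" using f by auto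
  thus "integrable M1 (\<lambda>x. \<integral>y. norm (f (fst (x, y)) * g (snd (x, y))) \<partial>M2)"
    by (simp add: norm_mult)
  show "AE x in M1. integrable M2 (\<lambda>y. f (fst (x, y)) * g (snd (x, y)))" using g by auto
qed

section \<open>Uniqueness for Fourier coefficients\<close>

text \<open>The second factor of the measure \<open>cyl\<close>.\<close>

definition tor :: "real measure" where "tor = restrict_space lborel {0..<2 * pi}"

lemma space_tor [simp]: "space tor = {0..<2*pi}"
  by (simp add: tor_def space_restrict_space)

lemma measurable_tor: "f \<in> measurable borel N \<Longrightarrow> f \<in> measurable tor N"
  unfolding tor_def by (rule measurable_restrict_space1) simp

lemma measurable_tor_id [measurable]: "(\<lambda>y. y) \<in> borel_measurable tor"
  by (rule measurable_tor) simp

lemma finite_measure_tor: "finite_measure tor"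
proof
  have "emeasure tor {0..<2*pi} = ennreal (2*pi)"
    unfolding tor_def by (subst emeasure_restrict_space) auto
  thus "emeasure tor (space tor) \<noteq> \<infinity>" by (simp)
qed

interpretation tor: finite_measure tor by (rule finite_measure_tor)

lemma measure_tor: "measure tor {0..<2*pi} = 2*pi"
proof -
  have "emeasure tor {0..<2*pi} = ennreal (2*pi)"
    unfolding tor_def by (subst emeasure_restrict_space) auto
  thus ?thesis by (simp add: measure_def)
qed

lemma integral_tor:
  fixes f :: "real \<Rightarrow> 'a::{banach, second_countable_topology}"
  shows "(\<integral>y. f y \<partial>tor) = (\<integral>y. indicator {0..<2*pi} y *\<^sub>R f y \<partial>lborel)"
  unfolding tor_def by (subst integral_restrict_space) auto

lemma integrable_tor:
  fixes f :: "real \<Rightarrow> 'a::{banach, second_countable_topology}"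
  shows "integrable tor f \<longleftrightarrow> integrable lborel (\<lambda>y. indicator {0..<2*pi} y *\<^sub>R f y)"
  unfolding tor_def by (subst integrable_restrict_space) auto

lemma integral_cis_tor:
  fixes \<eta> :: int
  shows "(\<integral>y. cis (of_int \<eta> * y) \<partial>tor) = (if \<eta> = 0 then of_real (2 * pi) else 0)"
proof (cases "\<eta> = 0")
  case True
  thus ?thesis by (simp add: measure_tor scaleR_conv_of_real)
next
  case False
  define F where "F = (\<lambda>y. cis (of_int \<eta> * y) / (\<i> * of_int \<eta>))"
  have "(\<integral>y. cis (of_int \<eta> * y) \<partial>tor) = (LINT y:{0..<2*pi}|lborel. cis (of_int \<eta> * y))"
    by (simp add: integral_tor set_lebesgue_integral_def)
  also have "\<dots> = (LINT y:{0..2*pi}|lborel. cis (of_int \<eta> * y))"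
  proof (rule set_integral_cong_set)
    show "AE x in lborel. (x \<in> {0..2 * pi}) = (x \<in> {0..<2 * pi})"
      using AE_lborel_singleton[of "2*pi"] by eventually_elim auto
  qed (auto simp: set_borel_measurable_def)
  also have "\<dots> = F (2*pi) - F 0"
    unfolding set_lebesgue_integral_def
  proof (rule integral_FTC_Icc)
    show "(F has_vector_derivative cis (of_int \<eta> * x)) (at x within {0..2*pi})" for x
    proof -
      have "((\<lambda>z. exp (\<i> * of_int \<eta> * z) / (\<i> * of_int \<eta>)) has_field_derivative exp (\<i> * of_int \<eta> * of_real x)) (at (of_real x))"
        using False by (auto intro!: derivative_eq_intros)
      from has_vector_derivative_real_field[OF this] show ?thesis
        unfolding F_def cis_conv_exp by (simp add: mult.assoc)
    qed
    show "continuous_on {0..2*pi} (\<lambda>x. cis (of_int \<eta> * x))" by (intro continuous_intros)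
  qed auto
  also have "cis (of_int \<eta> * (2*pi)) = 1"
    by (metis cis_multiple_2pi Ints_of_int mult.commute)
  hence "F (2*pi) - F 0 = 0" by (simp add: F_def)
  finally show ?thesis using False by simp
qed

text \<open>The functions \<open>q\<close> for which all Fourier coefficients of \<open>q H\<close> vanish are closed under multiplication
by trigonometric polynomials. They contain \<open>1\<close>, hence every real polynomial in \<open>cis y\<close>, hence by
Stone-Weierstrass (\<open>H\<close> is integrable) the continuous functions on the circle, and by dominated convergence
the indicators of arcs.\<close>

lemma fourier_coefficients_zero_imp_AE_zero:
  fixes H :: "real \<Rightarrow> complex"
  assumes H: "integrable tor H" and z: "\<And>\<eta>::int. (\<integral>y. H y * cis (of_int \<eta> * y) \<partial>tor) = 0"
  shows "AE y in tor. H y = 0"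
proof -
  have Hm[measurable]: "H \<in> borel_measurable tor" using H by auto
  define N where "N = (\<lambda>q::real\<Rightarrow>complex. q \<in> borel_measurable borel \<and> (\<exists>C. \<forall>y. cmod (q y) \<le> C) \<and>
     (\<forall>\<eta>::int. (\<integral>y. H y * q y * cis (of_int \<eta> * y) \<partial>tor) = 0))"
  have Ni: "integrable tor (\<lambda>y. H y * q y)" if q: "q \<in> borel_measurable borel" "\<forall>y. cmod (q y) \<le> C" for q C
    by (rule integrable_times_bounded[OF H measurable_tor[OF q(1)]]) (use q in auto)
  have N_add: "N (\<lambda>y. q y + r y)" if q: "N q" and r: "N r" for q r
  proof -
    obtain C where C: "\<forall>y. cmod (q y) \<le> C" using q unfolding N_def by auto
    obtain D where D: "\<forall>y. cmod (r y) \<le> D" using r unfolding N_def by auto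
    have m: "q \<in> borel_measurable borel" "r \<in> borel_measurable borel" using q r by (auto simp: N_def)
    have "\<forall>y. cmod (q y + r y) \<le> C + D" using C D norm_triangle_le add_mono by meson
    moreover have "(\<integral>y. H y * (q y + r y) * cis (of_int \<eta> * y) \<partial>tor) = 0" for \<eta> :: int
    proof -
      have "(\<integral>y. H y * (q y + r y) * cis (of_int \<eta> * y) \<partial>tor) =
        (\<integral>y. H y * q y * cis (of_int \<eta> * y) + H y * r y * cis (of_int \<eta> * y) \<partial>tor)"
        by (simp add: algebra_simps)
      also have "\<dots> = 0"
        by (subst Bochner_Integration.integral_add)
           (use q r C D m in \<open>auto simp: N_def intro!: integrable_times_cis Ni\<close>)
      finally show ?thesis .
    qed
    ultimately show ?thesis using m unfolding N_def by auto
  qed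
  have N_cis: "N (\<lambda>y. c * cis (of_int k * y) * q y)" if q: "N q" for q c and k :: int
  proof -
    obtain C where C: "\<forall>y. cmod (q y) \<le> C" using q unfolding N_def by auto
    have "\<forall>y. cmod (c * cis (of_int k * y) * q y) \<le> cmod c * C"
      using C by (auto simp: norm_mult intro!: mult_left_mono)
    moreover have "(\<integral>y. H y * (c * cis (of_int k * y) * q y) * cis (of_int \<eta> * y) \<partial>tor) = 0" for \<eta> :: int
    proof -
      have "(\<lambda>y. H y * (c * cis (of_int k * y) * q y) * cis (of_int \<eta> * y)) =
            (\<lambda>y. c * (H y * q y * cis (of_int (k + \<eta>) * y)))"
        by (auto simp: algebra_simps cis_mult[symmetric])
      thus ?thesis using q unfolding N_def by (simp del: of_int_add)
    qed
    moreover have "(\<lambda>y. c * cis (of_int k * y) * q y) \<in> borel_measurable borel"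
    proof -
      have [measurable]: "q \<in> borel_measurable borel" using q unfolding N_def by blast
      show ?thesis by measurable
    qed
    ultimately show ?thesis unfolding N_def by auto
  qed
  have N_poly: "\<forall>q. N q \<longrightarrow> N (\<lambda>y. of_real (p (cis y)) * q y)" if "real_polynomial_function p" for p
    using that
  proof (induction p)
    case (linear f)
    interpret f: bounded_linear f by fact
    have f: "complex_of_real (f (cis y)) = (of_real (f 1) - \<i> * of_real (f \<i>)) / 2 * cis (of_int 1 * y)
      + (of_real (f 1) + \<i> * of_real (f \<i>)) / 2 * cis (of_int (-1) * y)" for y
    proof -
      have "cis y = cos y *\<^sub>R 1 + sin y *\<^sub>R \<i>" by (simp add: complex_eq_iff)
      hence "f (cis y) = cos y * f 1 + sin y * f \<i>" by (simp only: f.add f.scaleR real_scaleR_def)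
      thus ?thesis by (simp add: complex_eq_iff algebra_simps) (simp add: field_simps)
    qed
    show ?case unfolding f distrib_right by (intro allI impI N_add N_cis)
  next
    case (const c)
    show ?case using N_cis[of _ "of_real c" 0] by simp
  next
    case (add f g)
    show ?case
    proof (intro allI impI)
      fix q assume "N q"
      hence "N (\<lambda>y. of_real (f (cis y)) * q y)" "N (\<lambda>y. of_real (g (cis y)) * q y)" using add by blast+
      from N_add[OF this] show "N (\<lambda>y. of_real (f (cis y) + g (cis y)) * q y)" by (simp add: distrib_right)
    qed
  next
    case (mult f g)
    show ?case
    proof (intro allI impI)
      fix q assume "N q"
      hence "N (\<lambda>y. of_real (f (cis y)) * (of_real (g (cis y)) * q y))" using mult by blast
      thus "N (\<lambda>y. of_real (f (cis y) * g (cis y)) * q y)" by (simp add: mult.assoc)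
    qed
  qed
  have N1: "N (\<lambda>_. 1)" unfolding N_def using z by (auto intro!: exI[of _ 1])
  have poly: "(\<integral>y. H y * of_real (p (cis y)) \<partial>tor) = 0" if "real_polynomial_function p" for p
  proof -
    have "N (\<lambda>y. of_real (p (cis y)) * 1)" using N_poly[OF that] N1 by blast
    thus ?thesis unfolding N_def by (auto dest!: spec[of _ "0::int"])
  qed
  have cont: "(\<integral>y. H y * of_real (f (cis y)) \<partial>tor) = 0" if f: "continuous_on UNIV f" for f :: "complex \<Rightarrow> real"
  proof -
    define I where "I = (\<integral>y. cmod (H y) \<partial>tor)"
    have I0: "I \<ge> 0" unfolding I_def by simp
    have "cmod (\<integral>y. H y * of_real (f (cis y)) \<partial>tor) \<le> e * I" if e: "e > 0" for e
    proof -
      obtain p where p: "real_polynomial_function p" "\<And>x. x \<in> sphere 0 1 \<Longrightarrow> \<bar>f x - p x\<bar> < e"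
        using Stone_Weierstrass_real_polynomial_function[of "sphere 0 1" f e] e continuous_on_subset[OF f] by auto
      have pm: "p \<in> borel_measurable borel"
        using p(1) by (intro borel_measurable_continuous_onI) (simp add: continuous_on_polymonial_function real_polynomial_function_eq)
      have fm: "f \<in> borel_measurable borel" using f by (rule borel_measurable_continuous_onI)
      have cm: "cis \<in> borel_measurable borel" by simp
      have d: "(\<lambda>y. of_real (f (cis y)) - of_real (p (cis y)) :: complex) \<in> borel_measurable borel"
        using pm fm by measurable
      have b: "cmod (of_real (f (cis y)) - of_real (p (cis y))) \<le> e" for y
        using p(2)[of "cis y"] by (simp flip: of_real_diff)
      obtain B where B: "\<forall>y. cmod (of_real (p (cis y))) \<le> B"
      proof -
        have "N (\<lambda>y. of_real (p (cis y)) * 1)" using N_poly[OF p(1)] N1 by blast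
        thus thesis unfolding N_def using that by auto
      qed
      have "cmod (of_real (f (cis y))) \<le> e + B" for y
        using b[of y] B[rule_format, of y] norm_triangle_sub[of "complex_of_real (f (cis y))" "of_real (p (cis y))"] by linarith
      hence i1: "integrable tor (\<lambda>y. H y * of_real (f (cis y)))" using fm by (intro Ni) auto
      have i2: "integrable tor (\<lambda>y. H y * of_real (p (cis y)))" using pm B by (intro Ni) auto
      have "(\<integral>y. H y * of_real (f (cis y)) \<partial>tor) = (\<integral>y. H y * of_real (f (cis y)) \<partial>tor) - (\<integral>y. H y * of_real (p (cis y)) \<partial>tor)"
        using poly[OF p(1)] by simp
      also have "\<dots> = (\<integral>y. H y * (of_real (f (cis y)) - of_real (p (cis y))) \<partial>tor)"
        by (subst Bochner_Integration.integral_diff[symmetric, OF i1 i2]) (simp add: algebra_simps)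
      also have "cmod \<dots> \<le> (\<integral>y. cmod (H y * (of_real (f (cis y)) - of_real (p (cis y)))) \<partial>tor)"
        by (rule integral_norm_bound)
      also have "\<dots> \<le> (\<integral>y. cmod (H y) * e \<partial>tor)"
      proof (rule integral_mono)
        show "integrable tor (\<lambda>y. cmod (H y * (of_real (f (cis y)) - of_real (p (cis y)))))"
          using Ni[OF d] b by (intro integrable_norm) blast
        show "integrable tor (\<lambda>y. cmod (H y) * e)" using H by auto
      qed (use b in \<open>auto simp: norm_mult intro!: mult_left_mono\<close>)
      also have "\<dots> = e * I" unfolding I_def by simp
      finally show ?thesis .
    qed
    note le = this
    have "cmod (\<integral>y. H y * of_real (f (cis y)) \<partial>tor) \<le> 0"
    proof (rule field_le_epsilon)
      fix e :: real assume "e > 0"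
      have "cmod (\<integral>y. H y * of_real (f (cis y)) \<partial>tor) \<le> e / (I + 1) * I"
        using le[of "e/(I+1)"] \<open>e > 0\<close> I0 by auto
      also have "\<dots> \<le> e" using I0 \<open>e > 0\<close> by (simp add: field_simps)
      finally show "cmod (\<integral>y. H y * of_real (f (cis y)) \<partial>tor) \<le> 0 + e" by simp
    qed
    thus ?thesis by simp
  qed
  have "AE y in lborel. indicator {0..<2*pi} y *\<^sub>R H y = 0"
  proof (rule AE_zero_if_interval_integrals_zero)
    have HL: "integrable lborel (\<lambda>y. indicator {0..<2*pi} y *\<^sub>R H y)" using H by (simp add: integrable_tor)
    fix a b :: real
    show "set_integrable lborel {a..b} (\<lambda>y. indicator {0..<2*pi} y *\<^sub>R H y)"
      unfolding set_integrable_def by (rule integrable_mult_indicator[OF _ HL]) auto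
    define A where "A = insert 1 (cis ` ({0..2*pi} - {a<..<b}))"
    have "compact ({0..2*pi} - {a<..<b})" by (intro compact_diff) auto
    hence cA: "closed A" unfolding A_def
      by (intro closed_insert compact_imp_closed compact_continuous_image continuous_intros)
    have A0: "A \<noteq> {}" by (auto simp: A_def)
    \<comment> \<open>\<open>A\<close> is the complement of the arc from \<open>a\<close> to \<open>b\<close>, with the point 1 added to make it nonempty; that point corresponds to the null set \<open>y = 0\<close>. The \<open>k n\<close> converge to the indicator of the arc.\<close>
    define k where "k = (\<lambda>n z. min 1 (real n * infdist z A))"
    have kc: "continuous_on UNIV (k n)" for n unfolding k_def by (intro continuous_intros)
    have "(\<lambda>n. \<integral>y. H y * of_real (k n (cis y)) \<partial>tor) \<longlonglongrightarrow> (\<integral>y. H y * indicator {a<..<b} y \<partial>tor)"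
    proof (rule integral_dominated_convergence[where w="\<lambda>y. cmod (H y)"])
      show "AE y in tor. (\<lambda>n. H y * of_real (k n (cis y))) \<longlonglongrightarrow> H y * indicator {a<..<b} y"
      proof -
        have "AE y in lborel. y \<noteq> 0" by (rule AE_lborel_singleton)
        hence "AE y in tor. y \<noteq> 0" unfolding tor_def by (subst AE_restrict_space_iff) auto
        with AE_space show ?thesis
        proof eventually_elim
          case (elim y)
          hence y: "0 < y" "y < 2*pi" by auto
          have mem: "cis y \<in> A \<longleftrightarrow> y \<notin> {a<..<b}"
          proof
            assume "cis y \<in> A"
            hence "cis y = cis 0 \<or> cis y \<in> cis ` ({0..2*pi} - {a<..<b})" unfolding A_def by simp
            then obtain x where x: "0 \<le> x" "x \<le> 2*pi" "cis y = cis x" "x = 0 \<or> x \<notin> {a<..<b}"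
              using that[of 0] that by (smt (verit) DiffE atLeastAtMost_iff imageE pi_gt_zero)
            have "sin y = sin x \<and> cos y = cos x" using x(3) by (simp add: complex_eq_iff)
            then obtain m :: int where m: "y = x + 2*pi * m" using sin_cos_eq_iff by (metis mult.assoc)
            have "\<not> m \<ge> 1"
            proof
              assume "m \<ge> 1"
              hence "2 * pi * 1 \<le> 2 * pi * real_of_int m" by (intro mult_left_mono) auto
              thus False using m x y by linarith
            qed
            moreover have "\<not> m \<le> -1"
            proof
              assume "m \<le> -1"
              hence "2 * pi * real_of_int m \<le> 2 * pi * (-1)" by (intro mult_left_mono) auto
              thus False using m x y by linarith
            qed
            ultimately have "m = 0" by linarith
            thus "y \<notin> {a<..<b}" using m x y by auto
          next
            assume "y \<notin> {a<..<b}" thus "cis y \<in> A" using y unfolding A_def by auto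
          qed
          have "(\<lambda>n. k n (cis y)) \<longlonglongrightarrow> indicator {a<..<b} y"
          proof (cases "y \<in> {a<..<b}")
            case True
            hence pos: "infdist (cis y) A > 0" using mem in_closed_iff_infdist_zero[OF cA A0] infdist_nonneg
              by (metis less_eq_real_def)
            obtain n0 where n0: "1 / infdist (cis y) A \<le> real n0" using real_arch_simple by blast
            have "k n (cis y) = 1" if "n \<ge> n0" for n
            proof -
              have "1 / infdist (cis y) A \<le> real n" using n0 that by (meson of_nat_mono order_trans)
              thus ?thesis using pos by (simp add: k_def field_simps)
            qed
            hence "\<forall>\<^sub>F n in sequentially. k n (cis y) = indicator {a<..<b} y"
              using True by (auto simp: eventually_sequentially)
            thus ?thesis by (rule tendsto_eventually)
          next
            case False
            hence "infdist (cis y) A = 0" using mem in_closed_iff_infdist_zero[OF cA A0] by auto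
            thus ?thesis using False by (simp add: k_def)
          qed
          hence "(\<lambda>n. H y * of_real (k n (cis y))) \<longlonglongrightarrow> H y * of_real (indicator {a<..<b} y)"
            by (intro tendsto_intros)
          thus ?case by (cases "y \<in> {a<..<b}") auto
        qed
      qed
      fix n
      have "k n \<in> borel_measurable borel" using kc by (rule borel_measurable_continuous_onI)
      thus "(\<lambda>y. H y * of_real (k n (cis y))) \<in> borel_measurable tor" by measurable
      have "\<bar>k n z\<bar> \<le> 1" for z unfolding k_def by (auto simp: infdist_nonneg)
      thus "AE y in tor. norm (H y * of_real (k n (cis y))) \<le> cmod (H y)"
        by (auto simp: norm_mult intro!: AE_I2 mult_right_le_one_le)
    next
      have "indicator {a<..<b} \<in> borel_measurable tor" by (rule measurable_tor) simp
      thus "(\<lambda>y. H y * indicator {a<..<b} y) \<in> borel_measurable tor" by measurable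
    qed (use H in auto)
    hence z0: "(\<integral>y. H y * indicator {a<..<b} y \<partial>tor) = 0" using cont[OF kc] by (simp add: LIMSEQ_const_iff)
    have "(LINT y:{a..b}|lborel. indicator {0..<2*pi} y *\<^sub>R H y) = (LINT y:{a<..<b}|lborel. indicator {0..<2*pi} y *\<^sub>R H y)"
    proof (rule set_integral_null_delta[OF HL])
      have "({a..b} - {a<..<b}) \<union> ({a<..<b} - {a..b}) \<subseteq> {a, b}" by auto
      thus "({a..b} - {a<..<b}) \<union> ({a<..<b} - {a..b}) \<in> null_sets lborel"
        by (meson countable_imp_null_set_lborel countable_empty countable_insert countable_subset)
    qed auto
    also have "\<dots> = (\<integral>y. H y * indicator {a<..<b} y \<partial>tor)"
      unfolding integral_tor set_lebesgue_integral_def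
      by (rule Bochner_Integration.integral_cong) (auto simp: indicator_def)
    finally show "(LINT y:{a..b}|lborel. indicator {0..<2*pi} y *\<^sub>R H y) = 0" using z0 by simp
  qed
  thus ?thesis unfolding tor_def by (subst AE_restrict_space_iff) (auto simp: indicator_def)
qed

section \<open>Gaussians and uniqueness on the line\<close>

text \<open>A rescaling of the characteristic function of the standard normal distribution.\<close>

lemma gaussian_fourier:
  assumes c: "c > 0"
  shows "integrable lborel (\<lambda>\<xi>. complex_of_real (exp (- c * \<xi>\<^sup>2)))"
    and "(\<integral>\<xi>. of_real (exp (- c * \<xi>\<^sup>2)) * cis (\<xi> * x) \<partial>lborel) = of_real (sqrt (pi / c) * exp (- x\<^sup>2 / (4 * c)))"
proof -
  define s where "s = 1 / sqrt (2 * c)"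
  have s: "s > 0" and s2: "s\<^sup>2 = 1 / (2 * c)" using c by (auto simp: s_def power_divide)
  have e: "exp (- c * (0 + s * z)\<^sup>2) = sqrt (2 * pi) * std_normal_density z" for z
    using c by (simp add: std_normal_density_def power_mult_distrib s2 field_simps)
  show I: "integrable lborel (\<lambda>\<xi>. complex_of_real (exp (- c * \<xi>\<^sup>2)))"
  proof -
    have "integrable lborel (\<lambda>z. exp (- c * (0 + s * z)\<^sup>2))" unfolding e by simp
    hence "integrable lborel (\<lambda>z. exp (- c * z\<^sup>2))" using s by (subst (asm) lborel_integrable_real_affine_iff) auto
    thus ?thesis by (rule integrable_of_real)
  qed
  have "(\<integral>\<xi>. of_real (exp (- c * \<xi>\<^sup>2)) * cis (\<xi> * x) \<partial>lborel)
     = \<bar>s\<bar> *\<^sub>R (\<integral>z. of_real (exp (- c * (0 + s * z)\<^sup>2)) * cis ((0 + s * z) * x) \<partial>lborel)"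
    using s by (intro lborel_integral_real_affine) auto
  also have "\<dots> = s *\<^sub>R (\<integral>z. of_real (sqrt (2*pi)) * (std_normal_density z *\<^sub>R cis ((s * x) * z)) \<partial>lborel)"
    unfolding e using s by (simp add: scaleR_conv_of_real mult_ac)
  also have "\<dots> = (s * sqrt (2 * pi)) *\<^sub>R (\<integral>z. std_normal_density z *\<^sub>R cis ((s * x) * z) \<partial>lborel)"
    by (simp add: scaleR_conv_of_real)
  also have "(\<integral>z. std_normal_density z *\<^sub>R cis ((s * x) * z) \<partial>lborel) = char std_normal_distribution (s * x)"
    unfolding char_def by (subst integral_density) (auto simp: cis_conv_exp)
  also have "\<dots> = of_real (exp (- x\<^sup>2 / (4 * c)))"
    unfolding char_std_normal_distribution by (simp add: power_mult_distrib s2 mult_ac)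
  also have "s * sqrt (2 * pi) = sqrt (pi / c)" unfolding s_def using c by (simp flip: real_sqrt_divide add: real_sqrt_divide[symmetric] real_sqrt_mult[symmetric])
  finally show "(\<integral>\<xi>. of_real (exp (- c * \<xi>\<^sup>2)) * cis (\<xi> * x) \<partial>lborel) = of_real (sqrt (pi / c) * exp (- x\<^sup>2 / (4 * c)))"
    by (simp add: scaleR_conv_of_real)
qed

lemma gaussian_integral:
  assumes "c > 0"
  shows "integrable lborel (\<lambda>x. exp (- c * (x - a)\<^sup>2))" "(\<integral>x. exp (- c * (x - a)\<^sup>2) \<partial>lborel) = sqrt (pi / c)"
proof -
  have i: "integrable lborel (\<lambda>x. exp (- c * x\<^sup>2))"
    using gaussian_fourier(1)[OF assms] by (simp only: complex_of_real_integrable_eq)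
  have "complex_of_real (\<integral>x. exp (- c * x\<^sup>2) \<partial>lborel) = of_real (sqrt (pi / c))"
    using gaussian_fourier(2)[OF assms, of 0] by (simp flip: integral_complex_of_real)
  hence v: "(\<integral>x. exp (- c * x\<^sup>2) \<partial>lborel) = sqrt (pi / c)" by (simp only: of_real_eq_iff)
  show "integrable lborel (\<lambda>x. exp (- c * (x - a)\<^sup>2))"
    using lborel_integrable_real_affine[OF i, of 1 "-a"] by simp
  show "(\<integral>x. exp (- c * (x - a)\<^sup>2) \<partial>lborel) = sqrt (pi / c)"
    using lborel_integral_real_affine[of 1 "\<lambda>x. exp (- c * x\<^sup>2)" "-a"] v by simp
qed

text \<open>Multiplying \<open>g\<close> by one of the Gaussians gives an
integrable function \<open>G\<close>, and \<open>G\<close> satisfies the same hypothesis because a product of two Gaussians is a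
multiple of a Gaussian. Integrating over the centres \<open>y \<in> [a, b]\<close> turns narrow Gaussians into an
approximation of the indicator of \<open>[a, b]\<close>, so the integrals of \<open>G\<close> over intervals vanish.\<close>

lemma gaussian_pairings_zero_imp_AE_zero:
  fixes g :: "real \<Rightarrow> complex"
  assumes I: "\<And>a c. c > 0 \<Longrightarrow> integrable lborel (\<lambda>x. g x * of_real (exp (- c * (x - a)\<^sup>2)))"
    and Z: "\<And>a c. c > 0 \<Longrightarrow> (\<integral>x. g x * of_real (exp (- c * (x - a)\<^sup>2)) \<partial>lborel) = 0"
  shows "AE x in lborel. g x = 0"
proof -
  define G where "G = (\<lambda>x. g x * of_real (exp (- 1 * (x - 0)\<^sup>2)))"
  have Gi: "integrable lborel G" unfolding G_def by (rule I) simp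
  have Gm[measurable]: "G \<in> borel_measurable borel" using borel_measurable_integrable[OF Gi] by simp
  \<comment> \<open>The normal density with mean \<open>x\<close> and standard deviation \<open>1 / (n + 1)\<close>.\<close>
  define D where "D = (\<lambda>n x a. real (Suc n) * std_normal_density (real (Suc n) * (a - x)))"
  have Dm[measurable]: "(\<lambda>p. D n (fst p) (snd p)) \<in> borel_measurable (borel \<Otimes>\<^sub>M borel)" for n
    unfolding D_def by measurable
  have D0: "D n x a \<ge> 0" for n x a unfolding D_def by simp
  have Db: "D n x a \<le> real (Suc n)" for n x a
  proof -
    have "std_normal_density z \<le> 1" for z
    proof -
      have "exp (- z\<^sup>2 / 2) \<le> 1" by simp
      moreover have "1 / sqrt (2 * pi) \<le> 1" using pi_ge_two by (simp add: real_le_rsqrt)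
      ultimately show ?thesis unfolding std_normal_density_def by (intro mult_le_one) auto
    qed
    thus ?thesis unfolding D_def by (simp only: mult_left_le of_nat_0_le_iff)
  qed
  have GD: "(\<integral>x. G x * of_real (D n x a) \<partial>lborel) = 0" for n a
  proof -
    define m where "m = (real (Suc n))\<^sup>2 / 2"
    have m: "m > 0" unfolding m_def by simp
    define c where "c = 1 + m"
    have c: "c > 0" using m by (simp add: c_def)
    define b where "b = m * a / c"
    have q: "x\<^sup>2 + m * (a - x)\<^sup>2 = c * (x - b)\<^sup>2 + (m * a\<^sup>2 - c * b\<^sup>2)" for x
    proof -
      have "c * b = m * a" using c by (simp add: b_def)
      hence "c * (x - b)\<^sup>2 = c * x\<^sup>2 - 2 * x * (m * a) + c * b\<^sup>2" by (simp add: power2_diff algebra_simps)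
      thus ?thesis by (simp add: c_def power2_diff algebra_simps)
    qed
    define C where "C = real (Suc n) / sqrt (2 * pi) * exp (- (m * a\<^sup>2 - c * b\<^sup>2))"
    have "exp (- x\<^sup>2) * D n x a = C * exp (- c * (x - b)\<^sup>2)" for x
    proof -
      have "exp (- x\<^sup>2) * D n x a = real (Suc n) / sqrt (2 * pi) * exp (- (x\<^sup>2 + m * (a - x)\<^sup>2))"
      proof -
        have "- x\<^sup>2 + - (k * (a - x))\<^sup>2 / 2 = - (x\<^sup>2 + k\<^sup>2 / 2 * (a - x)\<^sup>2)" for k
          by (simp add: power_mult_distrib)
        from this[of "real (Suc n)"] show ?thesis
          unfolding D_def std_normal_density_def m_def
          by (simp add: mult.left_commute[of "exp (- x\<^sup>2)"] del: of_nat_Suc flip: exp_add)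
      qed
      thus ?thesis unfolding q C_def by (simp flip: exp_add)
    qed
    hence "G x * of_real (D n x a) = of_real C * (g x * of_real (exp (- c * (x - b)\<^sup>2)))" for x
      unfolding G_def by (simp add: mult.assoc flip: of_real_mult)
    thus ?thesis using Z[OF c, of b] by simp
  qed
  have "AE x in lborel. G x = 0"
  proof (rule AE_zero_if_interval_integrals_zero)
    fix a b :: real
    show "set_integrable lborel {a..b} G" using Gi unfolding set_integrable_def
      by (intro integrable_mult_indicator) auto
    assume ab: "a \<le> b"
    \<comment> \<open>The indicator of \<open>[a, b]\<close> smoothed at scale \<open>1 / (n + 1)\<close>.\<close>
    define K where "K = (\<lambda>n x. \<integral>y. indicator {a..b} y * D n x y \<partial>lborel)"
    have Keq: "K n x = (\<integral>z. indicator {a..b} (x + (1 / real (Suc n)) * z) * std_normal_density z \<partial>lborel)" for n x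
      unfolding K_def
      by (subst lborel_integral_real_affine[where c="1 / real (Suc n)" and t=x])
         (auto simp: D_def mult_ac simp del: of_nat_Suc)
    have Kb: "0 \<le> K n x \<and> K n x \<le> 1" for n x
    proof
      show "0 \<le> K n x" unfolding K_def by (intro integral_nonneg_AE) (auto simp: D0)
      have "K n x \<le> (\<integral>z. std_normal_density z \<partial>lborel)" unfolding Keq
        by (rule integral_mono') (auto simp: indicator_def)
      thus "K n x \<le> 1" by simp
    qed
    have Km[measurable]: "K n \<in> borel_measurable borel" for n
    proof -
      have "(\<lambda>x. \<integral>y. (\<lambda>(x, y). indicator {a..b} y * D n x y) (x, y) \<partial>lborel) \<in> borel_measurable borel"
        by (rule lborel.borel_measurable_lebesgue_integral[of _ borel]) (simp add: split_def)
      thus ?thesis by (simp add: K_def[abs_def])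
    qed
    have Kz: "(\<integral>x. G x * of_real (K n x) \<partial>lborel) = 0" for n
    proof -
      let ?f = "\<lambda>(x, y). G x * of_real (indicator {a..b} y) * of_real (D n x y)"
      have f: "integrable (lborel \<Otimes>\<^sub>M lborel) ?f"
      proof -
        have "integrable (lborel \<Otimes>\<^sub>M lborel) (\<lambda>p. (G (fst p) * of_real (indicator {a..b} (snd p))) * of_real (D n (fst p) (snd p)))"
        proof (rule integrable_times_bounded)
          have "integrable lborel (\<lambda>y. complex_of_real (indicator {a..b} y))"
            by (intro integrable_of_real integrable_real_indicator) (auto simp: emeasure_lborel_Icc_eq)
          thus "integrable (lborel \<Otimes>\<^sub>M lborel) (\<lambda>p. G (fst p) * complex_of_real (indicator {a..b} (snd p)))"
            by (rule lborel_pair.integrable_fst_times_snd[OF Gi])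
          show "(\<lambda>p. complex_of_real (D n (fst p) (snd p))) \<in> borel_measurable (lborel \<Otimes>\<^sub>M lborel)" by measurable
          show "cmod (complex_of_real (D n (fst p) (snd p))) \<le> real (Suc n)" for p
            using Db[of n "fst p" "snd p"] D0[of n "fst p" "snd p"] by (simp del: of_nat_Suc)
        qed
        thus ?thesis by (simp add: split_def)
      qed
      have "(\<integral>x. G x * of_real (K n x) \<partial>lborel) = (\<integral>x. (\<integral>y. ?f (x, y) \<partial>lborel) \<partial>lborel)"
        unfolding K_def by (simp add: integral_complex_of_real[symmetric] mult.assoc flip: of_real_mult del: integral_complex_of_real)
      also have "\<dots> = (\<integral>y. (\<integral>x. ?f (x, y) \<partial>lborel) \<partial>lborel)"
        using lborel_pair.Fubini_integral[OF f] by simp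
      also have "\<dots> = (\<integral>y. of_real (indicator {a..b} y) * (\<integral>x. G x * of_real (D n x y) \<partial>lborel) \<partial>lborel)"
        by (simp add: mult_ac flip: integral_mult_right_zero)
      finally show ?thesis by (simp add: GD)
    qed
    have "(\<lambda>n. \<integral>x. G x * of_real (K n x) \<partial>lborel) \<longlonglongrightarrow> (\<integral>x. G x * of_real (indicator {a..b} x) \<partial>lborel)"
    proof (rule integral_dominated_convergence[where w="\<lambda>x. cmod (G x)"])
      show "AE x in lborel. (\<lambda>n. G x * of_real (K n x)) \<longlonglongrightarrow> G x * of_real (indicator {a..b} x)"
        using AE_lborel_singleton[of a] AE_lborel_singleton[of b]
      proof eventually_elim
        case (elim x)
        have "(\<lambda>n. K n x) \<longlonglongrightarrow> (\<integral>z. indicator {a..b} x * std_normal_density z \<partial>lborel)"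
          unfolding Keq
        proof (rule integral_dominated_convergence[where w=std_normal_density])
          show "AE z in lborel. (\<lambda>n. indicator {a..b} (x + (1 / real (Suc n)) * z) * std_normal_density z) \<longlonglongrightarrow> indicator {a..b} x * std_normal_density z"
          proof (intro AE_I2 tendsto_mult tendsto_const)
            fix z
            have l: "(\<lambda>n. x + (1 / real (Suc n)) * z) \<longlonglongrightarrow> x + 0 * z"
              by (intro tendsto_intros LIMSEQ_Suc[OF lim_1_over_n])
            have o: "open (if x \<in> {a..b} then {a<..<b} else - {a..b})" "x \<in> (if x \<in> {a..b} then {a<..<b} else - {a..b})"
              using elim by auto
            have "\<forall>\<^sub>F n in sequentially. x + (1 / real (Suc n)) * z \<in> (if x \<in> {a..b} then {a<..<b} else - {a..b})"
              using l o by (intro topological_tendstoD[of _ x]) auto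
            hence "\<forall>\<^sub>F n in sequentially. indicator {a..b} (x + (1 / real (Suc n)) * z) = (indicator {a..b} x :: real)"
              by eventually_elim (auto simp: indicator_def split: if_splits)
            thus "(\<lambda>n. indicator {a..b} (x + (1 / real (Suc n)) * z)) \<longlonglongrightarrow> (indicator {a..b} x :: real)"
              by (rule tendsto_eventually)
          qed
        qed (auto simp: indicator_def)
        hence "(\<lambda>n. K n x) \<longlonglongrightarrow> indicator {a..b} x" by simp
        thus ?case by (intro tendsto_intros)
      qed
      show "AE x in lborel. norm (G x * of_real (K n x)) \<le> cmod (G x)" for n
        using Kb by (auto simp: norm_mult intro!: AE_I2 mult_right_le_one_le)
    qed (use Gi in auto)
    hence "(\<integral>x. G x * of_real (indicator {a..b} x) \<partial>lborel) = 0" unfolding Kz by (simp add: LIMSEQ_const_iff)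
    thus "(LINT x:{a..b}|lborel. G x) = 0" by (simp add: set_lebesgue_integral_def scaleR_conv_of_real mult.commute)
  qed
  thus ?thesis by eventually_elim (simp add: G_def)
qed

text \<open>Both sides are the integral of \<open>g(x) h(\<xi>) cis(s x \<xi>)\<close> over the plane.\<close>

lemma fourier_duality:
  fixes g h :: "real \<Rightarrow> complex"
  assumes g: "integrable lborel g" and h: "integrable lborel h"
  shows "(\<integral>\<xi>. (\<integral>x. g x * cis (s * x * \<xi>) \<partial>lborel) * h \<xi> \<partial>lborel)
       = (\<integral>x. g x * (\<integral>\<xi>. h \<xi> * cis (s * x * \<xi>) \<partial>lborel) \<partial>lborel)"
proof -
  have i: "integrable (lborel \<Otimes>\<^sub>M lborel) (\<lambda>(x, \<xi>). g x * h \<xi> * cis (s * x * \<xi>))"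
    using integrable_times_cis[OF lborel_pair.integrable_fst_times_snd[OF g h], of "\<lambda>p. s * fst p * snd p"]
    by (simp add: split_def)
  have "(\<integral>\<xi>. (\<integral>x. g x * cis (s * x * \<xi>) \<partial>lborel) * h \<xi> \<partial>lborel) = (\<integral>\<xi>. (\<integral>x. g x * h \<xi> * cis (s * x * \<xi>) \<partial>lborel) \<partial>lborel)"
    by (simp add: mult_ac flip: integral_mult_left_zero integral_mult_right_zero)
  also have "\<dots> = (\<integral>x. (\<integral>\<xi>. g x * h \<xi> * cis (s * x * \<xi>) \<partial>lborel) \<partial>lborel)"
    using lborel_pair.Fubini_integral[OF i] by simp
  also have "\<dots> = (\<integral>x. g x * (\<integral>\<xi>. h \<xi> * cis (s * x * \<xi>) \<partial>lborel) \<partial>lborel)"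
    by (simp add: mult_ac flip: integral_mult_left_zero integral_mult_right_zero)
  finally show ?thesis .
qed

section \<open>Bessel inequalities on the line and on the circle\<close>

lemma borel_measurable_cnj [measurable (raw)]:
  "f \<in> borel_measurable M \<Longrightarrow> (\<lambda>x. cnj (f x)) \<in> borel_measurable M"
  by (rule measurable_compose[OF _ borel_measurable_continuous_onI]) (auto intro: continuous_intros)

lemma norm_integral_le_nn_integral:
  fixes f :: "'a \<Rightarrow> 'b::{banach, second_countable_topology}"
  shows "ennreal (norm (\<integral>x. f x \<partial>M)) \<le> (\<integral>\<^sup>+x. ennreal (norm (f x)) \<partial>M)"
proof (cases "integrable M f")
  case True thus ?thesis by (rule integral_norm_bound_ennreal)
next
  case False thus ?thesis by (simp add: not_integrable_integral_eq)
qed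

text \<open>The Gaussian weight makes the left-hand side a double integral of \<open>g(x)\<close> and the conjugate of
\<open>g(x')\<close> against a positive kernel \<open>\<kappa>(x' - x)\<close> of total mass \<open>2 pi\<close>, to which Schur's test applies.\<close>

lemma fourier_weighted_bessel_line:
  fixes g :: "real \<Rightarrow> complex"
  assumes g: "integrable lborel g" and c: "c > 0"
  shows "(\<integral>\<^sup>+\<xi>. ennreal ((cmod (\<integral>x. g x * cis (-1 * x * \<xi>) \<partial>lborel))\<^sup>2 * exp (- c * \<xi>\<^sup>2)) \<partial>lborel)
     \<le> ennreal (2 * pi) * (\<integral>\<^sup>+x. ennreal ((cmod (g x))\<^sup>2) \<partial>lborel)"
proof -
  have gm[measurable]: "g \<in> borel_measurable borel" using borel_measurable_integrable[OF g] by simp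
  define gh where "gh = (\<lambda>\<xi>. \<integral>x. g x * cis (-1 * x * \<xi>) \<partial>lborel)"
  have ghm[measurable]: "gh \<in> borel_measurable borel"
  proof -
    have "(\<lambda>\<xi>. \<integral>x. (\<lambda>(\<xi>, x). g x * cis (-1 * x * \<xi>)) (\<xi>, x) \<partial>lborel) \<in> borel_measurable borel"
      by (rule lborel.borel_measurable_lebesgue_integral[of _ borel]) (simp add: split_def)
    thus ?thesis by (simp add: gh_def[abs_def])
  qed
  have ghb: "cmod (gh \<xi>) \<le> (\<integral>x. cmod (g x) \<partial>lborel)" for \<xi>
    unfolding gh_def by (rule order_trans[OF integral_norm_bound]) (simp add: norm_mult)
  define E where "E = (\<lambda>\<xi>. complex_of_real (exp (- c * \<xi>\<^sup>2)))"
  have Ei: "integrable lborel E" unfolding E_def by (rule gaussian_fourier(1)[OF c])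
  define \<kappa> where "\<kappa> = (\<lambda>d. sqrt (pi / c) * exp (- d\<^sup>2 / (4 * c)))"
  have \<kappa>0: "\<kappa> d \<ge> 0" for d using c by (simp add: \<kappa>_def)
  let ?A = "\<lambda>x x'. ennreal ((cmod (g x))\<^sup>2 / 2 * \<kappa> (x' - x))"
  let ?B = "\<lambda>x x'. ennreal ((cmod (g x'))\<^sup>2 / 2 * \<kappa> (x' - x))"
  let ?C = "\<lambda>x. (\<integral>x'. cnj (g x') * of_real (\<kappa> (x' - x)) \<partial>lborel)"
  have [measurable]: "\<kappa> \<in> borel_measurable borel" unfolding \<kappa>_def by measurable
  define h where "h = (\<lambda>\<xi>. E \<xi> * cnj (gh \<xi>))"
  have hi: "integrable lborel h" unfolding h_def
    by (rule integrable_times_bounded[OF Ei, where C="\<integral>x. cmod (g x) \<partial>lborel"]) (use ghb in auto)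
  have inner: "(\<integral>\<xi>. h \<xi> * cis (-1 * x * \<xi>) \<partial>lborel) = (?C x)" for x
  proof -
    have cg: "cnj (gh \<xi>) = (\<integral>x'. cnj (g x') * cis (1 * x' * \<xi>) \<partial>lborel)" for \<xi>
      unfolding gh_def by (subst Bochner_Integration.integral_cnj[symmetric]) (simp add: cis_cnj)
    have "(\<integral>\<xi>. h \<xi> * cis (-1 * x * \<xi>) \<partial>lborel) = (\<integral>\<xi>. (\<integral>x'. cnj (g x') * cis (1 * x' * \<xi>) \<partial>lborel) * (E \<xi> * cis (-1 * x * \<xi>)) \<partial>lborel)"
      unfolding h_def cg by (simp add: mult_ac)
    also have "\<dots> = (\<integral>x'. cnj (g x') * (\<integral>\<xi>. E \<xi> * cis (-1 * x * \<xi>) * cis (1 * x' * \<xi>) \<partial>lborel) \<partial>lborel)"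
      by (rule fourier_duality) (use g in \<open>auto intro!: integrable_times_cis Ei\<close>)
    also have "\<dots> = (?C x)"
    proof -
      have "E \<xi> * cis (-1 * x * \<xi>) * cis (1 * x' * \<xi>) = of_real (exp (- c * \<xi>\<^sup>2)) * cis (\<xi> * (x' - x))" for \<xi> x'
        by (simp add: E_def mult.assoc cis_mult algebra_simps)
      thus ?thesis unfolding \<kappa>_def by (simp only: gaussian_fourier(2)[OF c])
    qed
    finally show ?thesis .
  qed
  have "(\<integral>\<xi>. of_real ((cmod (gh \<xi>))\<^sup>2 * exp (- c * \<xi>\<^sup>2)) \<partial>lborel) = (\<integral>\<xi>. gh \<xi> * h \<xi> \<partial>lborel)"
  proof (rule Bochner_Integration.integral_cong)
    fix \<xi> show "complex_of_real ((cmod (gh \<xi>))\<^sup>2 * exp (- c * \<xi>\<^sup>2)) = gh \<xi> * h \<xi>"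
      unfolding h_def E_def of_real_mult complex_norm_square by (simp add: mult_ac)
  qed simp
  also have "\<dots> = (\<integral>x. g x * (\<integral>\<xi>. h \<xi> * cis (-1 * x * \<xi>) \<partial>lborel) \<partial>lborel)"
    unfolding gh_def by (rule fourier_duality[OF g hi])
  also have "\<dots> = (\<integral>x. g x * (?C x) \<partial>lborel)"
    by (simp only: inner)
  finally have eq: "complex_of_real (\<integral>\<xi>. (cmod (gh \<xi>))\<^sup>2 * exp (- c * \<xi>\<^sup>2) \<partial>lborel) = \<dots>"
    by (simp only: integral_complex_of_real)
  have ii: "integrable lborel (\<lambda>\<xi>. (cmod (gh \<xi>))\<^sup>2 * exp (- c * \<xi>\<^sup>2))"
  proof -
    have "integrable lborel (\<lambda>\<xi>. h \<xi> * gh \<xi>)" by (rule integrable_times_bounded[OF hi _ ghb]) simp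
    hence "integrable lborel (\<lambda>\<xi>. complex_of_real ((cmod (gh \<xi>))\<^sup>2 * exp (- c * \<xi>\<^sup>2)))"
      unfolding h_def E_def of_real_mult complex_norm_square by (simp add: mult_ac)
    thus ?thesis by (simp only: complex_of_real_integrable_eq)
  qed
  let ?N = "\<integral>\<^sup>+x. ennreal ((cmod (g x))\<^sup>2) \<partial>lborel"
  have \<kappa>int: "(\<integral>\<^sup>+x'. ennreal (\<kappa> (x' - x)) \<partial>lborel) = ennreal (2 * pi)" for x
  proof -
    have k: "\<kappa> (x' - x) = sqrt (pi / c) * exp (- (1 / (4*c)) * (x' - x)\<^sup>2)" for x' by (simp add: \<kappa>_def)
    have p: "1 / (4 * c) > 0" using c by simp
    have "integrable lborel (\<lambda>x'. \<kappa> (x' - x))" "(\<integral>x'. \<kappa> (x' - x) \<partial>lborel) = sqrt (pi / c) * sqrt (pi / (1 / (4 * c)))"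
      unfolding k using gaussian_integral[OF p, of x] by auto
    moreover have "sqrt (pi / c) * sqrt (pi / (1 / (4 * c))) = 2 * pi"
    proof -
      have "sqrt (pi / c) * sqrt (pi / (1 / (4 * c))) = sqrt ((2 * pi)\<^sup>2)"
        using c by (simp add: power2_eq_square flip: real_sqrt_mult)
      thus ?thesis by (simp only: real_sqrt_abs) simp
    qed
    ultimately show ?thesis using \<kappa>0 by (subst nn_integral_eq_integral) auto
  qed
  have \<kappa>sym: "\<kappa> (x - x') = \<kappa> (x' - x)" for x x' by (simp add: \<kappa>_def power2_commute)
  have "(\<integral>\<^sup>+\<xi>. ennreal ((cmod (gh \<xi>))\<^sup>2 * exp (- c * \<xi>\<^sup>2)) \<partial>lborel) = ennreal (\<integral>\<xi>. (cmod (gh \<xi>))\<^sup>2 * exp (- c * \<xi>\<^sup>2) \<partial>lborel)"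
    by (rule nn_integral_eq_integral[OF ii]) auto
  also have "\<dots> \<le> ennreal (cmod (complex_of_real (\<integral>\<xi>. (cmod (gh \<xi>))\<^sup>2 * exp (- c * \<xi>\<^sup>2) \<partial>lborel)))"
    by (intro ennreal_leI) simp
  also have "\<dots> \<le> (\<integral>\<^sup>+x. ennreal (cmod (g x * (?C x))) \<partial>lborel)"
    unfolding eq by (rule norm_integral_le_nn_integral)
  also have "\<dots> \<le> (\<integral>\<^sup>+x. (\<integral>\<^sup>+x'. (?A x x') + (?B x x') \<partial>lborel) \<partial>lborel)"
  proof (intro nn_integral_mono)
    fix x
    have "ennreal (cmod (g x * (?C x)))
        = ennreal (cmod (\<integral>x'. g x * (cnj (g x') * of_real (\<kappa> (x' - x))) \<partial>lborel))" by simp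
    also have "\<dots> \<le> (\<integral>\<^sup>+x'. ennreal (cmod (g x * (cnj (g x') * of_real (\<kappa> (x' - x))))) \<partial>lborel)"
      by (rule norm_integral_le_nn_integral)
    also have "\<dots> \<le> (\<integral>\<^sup>+x'. (?A x x') + (?B x x') \<partial>lborel)"
    proof (intro nn_integral_mono)
      fix x'
      have "2 * (cmod (g x) * cmod (g x')) \<le> (cmod (g x))\<^sup>2 + (cmod (g x'))\<^sup>2"
        using sum_squares_bound[of "cmod (g x)" "cmod (g x')"] by simp
      hence "cmod (g x) * cmod (g x') * \<kappa> (x' - x) \<le> ((cmod (g x))\<^sup>2 / 2 + (cmod (g x'))\<^sup>2 / 2) * \<kappa> (x' - x)"
        using \<kappa>0 by (intro mult_right_mono) auto
      thus "ennreal (cmod (g x * (cnj (g x') * of_real (\<kappa> (x' - x))))) \<le> (?A x x') + (?B x x')"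
        using \<kappa>0 by (subst ennreal_plus[symmetric]) (auto intro!: ennreal_leI simp: norm_mult distrib_right mult.assoc simp del: ennreal_plus)
    qed
    finally show "ennreal (cmod (g x * (?C x))) \<le> \<dots>" .
  qed
  also have "\<dots> = (\<integral>\<^sup>+x. (\<integral>\<^sup>+x'. (?A x x') \<partial>lborel) \<partial>lborel)
      + (\<integral>\<^sup>+x. (\<integral>\<^sup>+x'. (?B x x') \<partial>lborel) \<partial>lborel)"
    by (simp add: nn_integral_add)
  also have "(\<integral>\<^sup>+x. (\<integral>\<^sup>+x'. (?B x x') \<partial>lborel) \<partial>lborel)
      = (\<integral>\<^sup>+x'. (\<integral>\<^sup>+x. (?B x x') \<partial>lborel) \<partial>lborel)"
    by (rule lborel_pair.Fubini') simp
  also have "\<dots> = (\<integral>\<^sup>+x. (\<integral>\<^sup>+x'. (?A x x') \<partial>lborel) \<partial>lborel)"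
    by (subst \<kappa>sym) simp
  also have "(\<integral>\<^sup>+x. (\<integral>\<^sup>+x'. (?A x x') \<partial>lborel) \<partial>lborel) = (\<integral>\<^sup>+x. ennreal ((cmod (g x))\<^sup>2 / 2) * ennreal (2 * pi) \<partial>lborel)"
  proof (rule nn_integral_cong)
    fix x
    have "(\<integral>\<^sup>+x'. (?A x x') \<partial>lborel) = (\<integral>\<^sup>+x'. ennreal ((cmod (g x))\<^sup>2 / 2) * ennreal (\<kappa> (x' - x)) \<partial>lborel)"
      by (subst ennreal_mult) (use \<kappa>0 in auto)
    also have "\<dots> = ennreal ((cmod (g x))\<^sup>2 / 2) * (\<integral>\<^sup>+x'. ennreal (\<kappa> (x' - x)) \<partial>lborel)"
      by (rule nn_integral_cmult) simp
    finally show "(\<integral>\<^sup>+x'. (?A x x') \<partial>lborel) = ennreal ((cmod (g x))\<^sup>2 / 2) * ennreal (2 * pi)"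
      by (simp only: \<kappa>int)
  qed
  also have "\<dots> = (\<integral>\<^sup>+x. ennreal pi * ennreal ((cmod (g x))\<^sup>2) \<partial>lborel)"
    by (simp add: mult.commute flip: ennreal_mult)
  also have "\<dots> = ennreal pi * ?N" by (simp add: nn_integral_cmult)
  also have "ennreal pi * ?N + ennreal pi * ?N = ennreal (2 * pi) * ?N"
    by (simp add: distrib_right[symmetric] flip: ennreal_plus)
  finally show ?thesis unfolding gh_def .
qed

text \<open>Half of Plancherel's theorem, for integrable functions; the right-hand side may be infinite. The Gaussian
weight of the previous lemma is removed by Fatou's lemma.\<close>

lemma fourier_bessel_line:
  fixes g :: "real \<Rightarrow> complex"
  assumes g: "integrable lborel g"
  shows "(\<integral>\<^sup>+\<xi>. ennreal ((cmod (\<integral>x. g x * cis (-1 * x * \<xi>) \<partial>lborel))\<^sup>2) \<partial>lborel)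
     \<le> ennreal (2 * pi) * (\<integral>\<^sup>+x. ennreal ((cmod (g x))\<^sup>2) \<partial>lborel)"
proof -
  have gm[measurable]: "g \<in> borel_measurable borel" using borel_measurable_integrable[OF g] by simp
  define gh where "gh = (\<lambda>\<xi>. \<integral>x. g x * cis (-1 * x * \<xi>) \<partial>lborel)"
  have ghm[measurable]: "gh \<in> borel_measurable borel"
  proof -
    have "(\<lambda>\<xi>. \<integral>x. (\<lambda>(\<xi>, x). g x * cis (-1 * x * \<xi>)) (\<xi>, x) \<partial>lborel) \<in> borel_measurable borel"
      by (rule lborel.borel_measurable_lebesgue_integral[of _ borel]) (simp add: split_def)
    thus ?thesis by (simp add: gh_def[abs_def])
  qed
  define w where "w = (\<lambda>n \<xi>. (cmod (gh \<xi>))\<^sup>2 * exp (- (1 / real (Suc n)) * \<xi>\<^sup>2))"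
  have lim: "(\<lambda>n. ennreal (w n \<xi>)) \<longlonglongrightarrow> ennreal ((cmod (gh \<xi>))\<^sup>2)" for \<xi>
  proof (rule tendsto_ennrealI)
    have "(\<lambda>n. w n \<xi>) \<longlonglongrightarrow> (cmod (gh \<xi>))\<^sup>2 * exp (- 0 * \<xi>\<^sup>2)" unfolding w_def
      by (intro tendsto_intros LIMSEQ_Suc[OF lim_1_over_n])
    thus "(\<lambda>n. w n \<xi>) \<longlonglongrightarrow> (cmod (gh \<xi>))\<^sup>2" by simp
  qed
  have "(\<integral>\<^sup>+\<xi>. ennreal ((cmod (gh \<xi>))\<^sup>2) \<partial>lborel) = (\<integral>\<^sup>+\<xi>. liminf (\<lambda>n. ennreal (w n \<xi>)) \<partial>lborel)"
    by (intro nn_integral_cong) (metis lim lim_imp_Liminf sequentially_bot)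
  also have "\<dots> \<le> liminf (\<lambda>n. \<integral>\<^sup>+\<xi>. ennreal (w n \<xi>) \<partial>lborel)"
    by (rule nn_integral_liminf) (simp add: w_def)
  also have "\<dots> \<le> liminf (\<lambda>n::nat. ennreal (2 * pi) * (\<integral>\<^sup>+x. ennreal ((cmod (g x))\<^sup>2) \<partial>lborel))"
    unfolding w_def gh_def by (intro Liminf_mono always_eventually allI fourier_weighted_bessel_line g) simp
  also have "\<dots> = ennreal (2 * pi) * (\<integral>\<^sup>+x. ennreal ((cmod (g x))\<^sup>2) \<partial>lborel)" by (simp add: Liminf_const)
  finally show ?thesis unfolding gh_def .
qed

text \<open>The squared distance of \<open>q\<close> from its projection onto the span of the characters in \<open>A\<close> is nonnegative.
If \<open>q\<close> is not square integrable the right-hand side is infinite.\<close>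

lemma fourier_bessel_torus:
  fixes q :: "real \<Rightarrow> complex" and A :: "int set"
  assumes q: "integrable tor q" and A: "finite A"
  shows "(\<Sum>\<eta>\<in>A. ennreal ((cmod (\<integral>y. q y * cis (- (of_int \<eta> * y)) \<partial>tor))\<^sup>2))
     \<le> ennreal (2 * pi) * (\<integral>\<^sup>+y. ennreal ((cmod (q y))\<^sup>2) \<partial>tor)"
proof (cases "(\<integral>\<^sup>+y. ennreal ((cmod (q y))\<^sup>2) \<partial>tor) = \<infinity>")
  case True
  thus ?thesis by (simp add: ennreal_mult_top)
next
  case False
  have qm[measurable]: "q \<in> borel_measurable tor" using q by auto
  have q2: "integrable tor (\<lambda>y. (cmod (q y))\<^sup>2)"
    using False by (intro integrableI_bounded) (auto simp: top.not_eq_extremum)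
  define c where "c = (\<lambda>\<eta>::int. \<integral>y. q y * cis (- (of_int \<eta> * y)) \<partial>tor)"
  define S where "S = (\<Sum>\<eta>\<in>A. (cmod (c \<eta>))\<^sup>2)"
  \<comment> \<open>The orthogonal projection of \<open>q\<close> onto the span of the characters in \<open>A\<close>.\<close>
  define P where "P = (\<lambda>y. \<Sum>\<eta>\<in>A. c \<eta> * cis (of_int \<eta> * y) / of_real (2 * pi))"
  have Pm[measurable]: "P \<in> borel_measurable tor" unfolding P_def by measurable
  have cj: "cnj (P y) = (\<Sum>\<eta>\<in>A. cnj (c \<eta>) * cis (- (of_int \<eta> * y)) / of_real (2 * pi))" for y
    unfolding P_def by (simp add: cis_cnj)
  have iqc: "integrable tor (\<lambda>y. q y * cis (- (of_int \<eta> * y)))" for \<eta> :: int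
    by (rule integrable_times_cis[OF q]) simp
  have qP: "(\<lambda>y. q y * cnj (P y)) = (\<lambda>y. \<Sum>\<eta>\<in>A. (cnj (c \<eta>) / of_real (2*pi)) * (q y * cis (- (of_int \<eta> * y))))"
    unfolding cj by (auto simp: sum_distrib_left intro!: sum.cong)
  have iqP: "integrable tor (\<lambda>y. q y * cnj (P y))" unfolding qP
    by (intro Bochner_Integration.integrable_sum integrable_mult_right iqc)
  have "(\<integral>y. q y * cnj (P y) \<partial>tor) = (\<Sum>\<eta>\<in>A. (cnj (c \<eta>) / of_real (2*pi)) * c \<eta>)"
    unfolding qP c_def[symmetric] by (subst Bochner_Integration.integral_sum) (auto intro!: integrable_mult_right iqc simp: c_def)
  also have "\<dots> = of_real (S / (2 * pi))"
    unfolding S_def of_real_divide of_real_sum complex_norm_square sum_divide_distrib by (auto intro!: sum.cong)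
  finally have vqP: "(\<integral>y. q y * cnj (P y) \<partial>tor) = of_real (S / (2 * pi))" .
  have icis: "integrable tor (\<lambda>y. cis (of_int k * y))" for k :: int
    by (rule tor.integrable_const_bound[where B=1]) auto
  have PP: "(\<lambda>y. P y * cnj (P y)) = (\<lambda>y. \<Sum>\<eta>\<in>A. \<Sum>\<eta>'\<in>A. (c \<eta> * cnj (c \<eta>') / of_real ((2*pi)^2)) * cis (of_int (\<eta> - \<eta>') * y))"
  proof
    fix y
    have "P y * cnj (P y) = (\<Sum>\<eta>\<in>A. \<Sum>\<eta>'\<in>A. (c \<eta> * cis (of_int \<eta> * y) / of_real (2 * pi)) * (cnj (c \<eta>') * cis (- (of_int \<eta>' * y)) / of_real (2 * pi)))"
      unfolding cj unfolding P_def by (rule sum_product)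
    also have "\<dots> = (\<Sum>\<eta>\<in>A. \<Sum>\<eta>'\<in>A. (c \<eta> * cnj (c \<eta>') / of_real ((2*pi)^2)) * cis (of_int (\<eta> - \<eta>') * y))"
    proof (intro sum.cong refl)
      fix \<eta> \<eta>'
      have "cis (of_int (\<eta> - \<eta>') * y) = cis (of_int \<eta> * y) * cis (- (of_int \<eta>' * y))"
        by (simp add: cis_mult left_diff_distrib)
      thus "(c \<eta> * cis (of_int \<eta> * y) / of_real (2 * pi)) * (cnj (c \<eta>') * cis (- (of_int \<eta>' * y)) / of_real (2 * pi)) = (c \<eta> * cnj (c \<eta>') / of_real ((2*pi)^2)) * cis (of_int (\<eta> - \<eta>') * y)"
        by (simp add: power2_eq_square)
    qed
    finally show "P y * cnj (P y) = \<dots>" .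
  qed
  have iPP: "integrable tor (\<lambda>y. P y * cnj (P y))" unfolding PP
    by (intro Bochner_Integration.integrable_sum integrable_mult_right icis)
  have "(\<integral>y. P y * cnj (P y) \<partial>tor) = (\<Sum>\<eta>\<in>A. \<Sum>\<eta>'\<in>A. (c \<eta> * cnj (c \<eta>') / of_real ((2*pi)^2)) * (\<integral>y. cis (of_int (\<eta> - \<eta>') * y) \<partial>tor))"
    unfolding PP using icis by (simp del: of_int_diff)
  also have "\<dots> = (\<Sum>\<eta>\<in>A. \<Sum>\<eta>'\<in>A. if \<eta> = \<eta>' then c \<eta> * cnj (c \<eta>') / of_real (2*pi) else 0)"
    unfolding integral_cis_tor by (intro sum.cong refl) (auto simp: power2_eq_square)
  also have "\<dots> = (\<Sum>\<eta>\<in>A. c \<eta> * cnj (c \<eta>) / of_real (2*pi))"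
    using A by (intro sum.cong refl) (simp add: sum.delta)
  also have "\<dots> = of_real (S / (2 * pi))"
    unfolding S_def of_real_divide of_real_sum complex_norm_square sum_divide_distrib by auto
  finally have vPP: "(\<integral>y. P y * cnj (P y) \<partial>tor) = of_real (S / (2 * pi))" .
  have eq: "(cmod (q y - P y))\<^sup>2 = (cmod (q y))\<^sup>2 - 2 * Re (q y * cnj (P y)) + Re (P y * cnj (P y))" for y
    unfolding cmod_power2 by (simp add: power2_eq_square algebra_simps)
  have "0 \<le> (\<integral>y. (cmod (q y - P y))\<^sup>2 \<partial>tor)" by simp
  also have "\<dots> = (\<integral>y. (cmod (q y))\<^sup>2 \<partial>tor) - 2 * Re (\<integral>y. q y * cnj (P y) \<partial>tor) + Re (\<integral>y. P y * cnj (P y) \<partial>tor)"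
  proof -
    have i: "integrable tor (\<lambda>y. 2 * Re (q y * cnj (P y)))" "integrable tor (\<lambda>y. Re (P y * cnj (P y)))"
      by (intro integrable_mult_right integrable_Re iqP iPP)+
    show ?thesis unfolding eq
      by (simp only: Bochner_Integration.integral_add Bochner_Integration.integral_diff Bochner_Integration.integrable_diff
        q2 i integral_mult_right_zero integral_Re iqP iPP)
  qed
  also have "\<dots> = (\<integral>y. (cmod (q y))\<^sup>2 \<partial>tor) - S / (2 * pi)" unfolding vPP vqP by (simp add: field_simps)
  finally have "S \<le> 2 * pi * (\<integral>y. (cmod (q y))\<^sup>2 \<partial>tor)" by (simp add: field_simps)
  hence "ennreal S \<le> ennreal (2 * pi) * (\<integral>\<^sup>+y. ennreal ((cmod (q y))\<^sup>2) \<partial>tor)"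
    using q2 by (subst nn_integral_eq_integral) (auto simp flip: ennreal_mult intro!: ennreal_leI)
  thus ?thesis unfolding S_def c_def by simp
qed

section \<open>The cylinder and its frequency space\<close>

lemma cyl_eq: "cyl = lborel \<Otimes>\<^sub>M tor"
  by (simp add: cyl_def tor_def)

interpretation torus_pair: pair_sigma_finite lborel tor ..

interpretation cyl: sigma_finite_measure cyl
  unfolding cyl_eq by (rule sigma_finite_pair_measure) unfold_locales

interpretation ints: sigma_finite_measure "count_space (UNIV :: int set)"
  by (rule sigma_finite_measure_count_space)

interpretation freq_pair: pair_sigma_finite lborel "count_space (UNIV :: int set)" ..

interpretation freq: sigma_finite_measure freq
  unfolding freq_def by (rule sigma_finite_pair_measure) unfold_locales

interpretation cyl_freq: pair_sigma_finite cyl freq ..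

lemma measurable_fst_cyl [measurable]: "fst \<in> borel_measurable cyl"
  unfolding cyl_eq using measurable_fst[of lborel tor] by simp

lemma measurable_snd_cyl [measurable]: "snd \<in> borel_measurable cyl"
  unfolding cyl_eq by (rule measurable_compose[OF measurable_snd measurable_tor_id])

lemma measurable_fst_freq [measurable]: "fst \<in> borel_measurable freq"
  unfolding freq_def using measurable_fst[of lborel "count_space (UNIV :: int set)"] by simp

lemma measurable_snd_freq [measurable]: "snd \<in> measurable freq (count_space UNIV)"
  unfolding freq_def by simp

lemma measurable_of_int_snd_freq [measurable]: "(\<lambda>p. real_of_int (snd p)) \<in> borel_measurable freq"
  by (rule measurable_compose[OF measurable_snd_freq]) simp

lemma measurable_section_freq:
  assumes "F \<in> measurable freq N"
  shows "(\<lambda>\<xi>. F (\<xi>, \<eta>)) \<in> measurable borel N"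
proof -
  have "(\<lambda>\<xi>. (\<xi>, \<eta>)) \<in> measurable lborel freq" unfolding freq_def by simp
  from measurable_compose[OF this assms] show ?thesis by simp
qed

lemma nn_integral_freq:
  assumes "F \<in> borel_measurable freq"
  shows "(\<integral>\<^sup>+p. F p \<partial>freq) = (\<integral>\<^sup>+\<eta>. (\<integral>\<^sup>+\<xi>. F (\<xi>, \<eta>) \<partial>lborel) \<partial>count_space UNIV)"
  using freq_pair.nn_integral_snd[of F] assms unfolding freq_def by simp

lemma nn_integral_section_le:
  assumes "F \<in> borel_measurable freq"
  shows "(\<integral>\<^sup>+\<xi>. F (\<xi>, \<eta>) \<partial>lborel) \<le> (\<integral>\<^sup>+p. F p \<partial>freq)"
  unfolding nn_integral_freq[OF assms]
  using nn_integral_ge_point[of \<eta> UNIV "\<lambda>\<eta>. \<integral>\<^sup>+\<xi>. F (\<xi>, \<eta>) \<partial>lborel"] by simp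

lemma AE_freq_section:
  assumes "AE p in freq. Q p"
  shows "AE \<xi> in lborel. Q (\<xi>, \<eta>)"
proof -
  have "AE \<xi> in lborel. AE \<eta> in count_space UNIV. Q (\<xi>, \<eta>)"
    using freq_pair.AE_pair assms unfolding freq_def by blast
  thus ?thesis by (simp add: AE_count_space) (erule eventually_mono, simp)
qed

text \<open>The Fourier coefficient in the periodic variable alone; its Fourier transform in \<open>x\<close> is \<open>fourier f\<close>.\<close>

definition ycoeff :: "(real \<times> real \<Rightarrow> complex) \<Rightarrow> int \<Rightarrow> real \<Rightarrow> complex" where
  "ycoeff f \<eta> x = (\<integral>y. f (x, y) * cis (- (of_int \<eta> * y)) \<partial>tor)"

lemma fourier_eq:
  "fourier f (\<xi>, \<eta>) = (\<integral>p. f p * cis (- (fst p * \<xi>) - snd p * of_int \<eta>) \<partial>cyl)"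
  unfolding fourier_def by (simp add: split_def cis_conv_exp algebra_simps)

lemma integrable_ycoeff: "integrable cyl f \<Longrightarrow> integrable lborel (ycoeff f \<eta>)"
proof -
  assume f: "integrable cyl f"
  have "integrable (lborel \<Otimes>\<^sub>M tor) (\<lambda>p. f p * cis (- (of_int \<eta> * snd p)))"
    using integrable_times_cis[OF f, of "\<lambda>p. - (of_int \<eta> * snd p)"] by (simp flip: cyl_eq)
  from torus_pair.integrable_fst'[OF this] show ?thesis unfolding ycoeff_def[abs_def] by simp
qed

lemma fourier_ycoeff:
  assumes f: "integrable cyl f"
  shows "fourier f (\<xi>, \<eta>) = (\<integral>x. ycoeff f \<eta> x * cis (-1 * x * \<xi>) \<partial>lborel)"
proof -
  have "integrable (lborel \<Otimes>\<^sub>M tor) (\<lambda>p. f p * cis (- (fst p * \<xi>) - snd p * of_int \<eta>))"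
    using integrable_times_cis[OF f, of "\<lambda>p. - (fst p * \<xi>) - snd p * of_int \<eta>"] by (simp flip: cyl_eq)
  from torus_pair.integral_fst'[OF this]
  have "fourier f (\<xi>, \<eta>) = (\<integral>x. (\<integral>y. f (x, y) * cis (- (x * \<xi>) - y * of_int \<eta>) \<partial>tor) \<partial>lborel)"
    unfolding fourier_eq cyl_eq by simp
  also have "\<dots> = (\<integral>x. (\<integral>y. (f (x, y) * cis (- (of_int \<eta> * y))) * cis (-1 * x * \<xi>) \<partial>tor) \<partial>lborel)"
    by (simp add: mult.assoc cis_mult algebra_simps)
  also have "\<dots> = (\<integral>x. ycoeff f \<eta> x * cis (-1 * x * \<xi>) \<partial>lborel)"
    unfolding ycoeff_def by simp
  finally show ?thesis .
qed

lemma measurable_fourier: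
  assumes [measurable]: "f \<in> borel_measurable cyl"
  shows "fourier f \<in> borel_measurable freq"
proof -
  note [measurable] = measurable_compose[OF measurable_fst measurable_of_int_snd_freq]
    measurable_compose[OF measurable_fst measurable_fst_freq] measurable_compose[OF measurable_snd measurable_fst_cyl]
    measurable_compose[OF measurable_snd measurable_snd_cyl] measurable_compose[OF measurable_snd assms]
  have eq: "fourier f = (\<lambda>q. \<integral>p. (\<lambda>(q, p). f p * cis (- (fst p * fst q) - snd p * of_int (snd q))) (q, p) \<partial>cyl)"
    by (rule ext) (auto simp: fourier_eq)
  show ?thesis unfolding eq
    by (rule cyl.borel_measurable_lebesgue_integral) (simp add: split_def)
qed

text \<open>Fatou's lemma for the restrictions of \<open>J\<close> to \<open>{-n..n}\<close>.\<close>

lemma nn_integral_int_le: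
  fixes J :: "int \<Rightarrow> ennreal"
  assumes "\<And>n::nat. (\<Sum>\<eta>\<in>{- int n..int n}. J \<eta>) \<le> B"
  shows "(\<integral>\<^sup>+\<eta>. J \<eta> \<partial>count_space UNIV) \<le> B"
proof -
  have "(\<integral>\<^sup>+\<eta>. J \<eta> \<partial>count_space UNIV) = (\<integral>\<^sup>+\<eta>. liminf (\<lambda>n. J \<eta> * indicator {- int n..int n} \<eta>) \<partial>count_space UNIV)"
  proof (intro nn_integral_cong)
    fix \<eta> :: int
    have "\<forall>\<^sub>F n in sequentially. J \<eta> * indicator {- int n..int n} \<eta> = J \<eta>"
      using eventually_ge_at_top[of "nat \<bar>\<eta>\<bar>"]
    proof eventually_elim
      case (elim n)
      hence "\<eta> \<in> {- int n..int n}" by auto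
      thus ?case by simp
    qed
    hence "(\<lambda>n. J \<eta> * indicator {- int n..int n} \<eta>) \<longlonglongrightarrow> J \<eta>" by (rule tendsto_eventually)
    thus "J \<eta> = liminf (\<lambda>n. J \<eta> * indicator {- int n..int n} \<eta>)" by (metis lim_imp_Liminf sequentially_bot)
  qed
  also have "\<dots> \<le> liminf (\<lambda>n. \<integral>\<^sup>+\<eta>. J \<eta> * indicator {- int n..int n} \<eta> \<partial>count_space UNIV)"
    by (rule nn_integral_liminf) simp
  also have "\<dots> \<le> liminf (\<lambda>n::nat. B)"
  proof (intro Liminf_mono always_eventually allI)
    fix n :: nat
    have "(\<integral>\<^sup>+\<eta>. J \<eta> * indicator {- int n..int n} \<eta> \<partial>count_space UNIV) = (\<Sum>\<eta>\<in>{- int n..int n}. J \<eta>)"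
      by (simp add: nn_integral_count_space_indicator[symmetric] nn_integral_count_space_finite)
    also have "\<dots> \<le> B" by (rule assms)
    finally show "(\<integral>\<^sup>+\<eta>. J \<eta> * indicator {- int n..int n} \<eta> \<partial>count_space UNIV) \<le> B" .
  qed
  also have "\<dots> = B" by (simp add: Liminf_const)
  finally show ?thesis .
qed

text \<open>For a finite set of \<eta>, apply Bessel's inequality on the line to each \<open>ycoeff f \<eta>\<close> and then the one on
the circle to \<open>f(x, _)\<close> for almost every \<open>x\<close>.\<close>

lemma fourier_bessel:
  assumes f: "integrable cyl f"
  shows "(\<integral>\<^sup>+p. ennreal ((cmod (fourier f p))\<^sup>2) \<partial>freq) \<le> ennreal (4 * pi\<^sup>2) * (\<integral>\<^sup>+p. ennreal ((cmod (f p))\<^sup>2) \<partial>cyl)"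
proof -
  have fm[measurable]: "f \<in> borel_measurable cyl" using f by auto
  have fm'[measurable]: "f \<in> borel_measurable (lborel \<Otimes>\<^sub>M tor)" using fm by (simp add: cyl_eq)
  have [measurable]: "fourier f \<in> borel_measurable freq" by (rule measurable_fourier) fact
  let ?B = "ennreal (4 * pi\<^sup>2) * (\<integral>\<^sup>+p. ennreal ((cmod (f p))\<^sup>2) \<partial>cyl)"
  define J where "J = (\<lambda>\<eta>. \<integral>\<^sup>+\<xi>. ennreal ((cmod (fourier f (\<xi>, \<eta>)))\<^sup>2) \<partial>lborel)"
  have fin: "(\<Sum>\<eta>\<in>A. J \<eta>) \<le> ?B" if A: "finite A" for A
  proof -
    have [measurable]: "ycoeff f \<eta> \<in> borel_measurable borel" for \<eta>
      using borel_measurable_integrable[OF integrable_ycoeff[OF f]] by simp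
    have "(\<Sum>\<eta>\<in>A. J \<eta>) \<le> (\<Sum>\<eta>\<in>A. ennreal (2 * pi) * (\<integral>\<^sup>+x. ennreal ((cmod (ycoeff f \<eta> x))\<^sup>2) \<partial>lborel))"
      unfolding J_def fourier_ycoeff[OF f] by (intro sum_mono fourier_bessel_line integrable_ycoeff f)
    also have "\<dots> = ennreal (2 * pi) * (\<integral>\<^sup>+x. (\<Sum>\<eta>\<in>A. ennreal ((cmod (ycoeff f \<eta> x))\<^sup>2)) \<partial>lborel)"
      by (simp add: nn_integral_sum sum_distrib_left del: sum_ennreal)
    also have "\<dots> \<le> ennreal (2 * pi) * (\<integral>\<^sup>+x. ennreal (2 * pi) * (\<integral>\<^sup>+y. ennreal ((cmod (f (x, y)))\<^sup>2) \<partial>tor) \<partial>lborel)"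
    proof (intro mult_left_mono nn_integral_mono_AE)
      have "AE x in lborel. integrable tor (\<lambda>y. f (x, y))"
        using torus_pair.AE_integrable_fst' f by (simp add: cyl_eq)
      thus "AE x in lborel. (\<Sum>\<eta>\<in>A. ennreal ((cmod (ycoeff f \<eta> x))\<^sup>2)) \<le> ennreal (2 * pi) * (\<integral>\<^sup>+y. ennreal ((cmod (f (x, y)))\<^sup>2) \<partial>tor)"
        by eventually_elim (unfold ycoeff_def, rule fourier_bessel_torus[OF _ A])
    qed simp
    also have "\<dots> = ennreal (2 * pi) * (ennreal (2 * pi) * (\<integral>\<^sup>+x. (\<integral>\<^sup>+y. ennreal ((cmod (f (x, y)))\<^sup>2) \<partial>tor) \<partial>lborel))"
      by (subst nn_integral_cmult) (auto intro!: tor.borel_measurable_nn_integral)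
    also have "(\<integral>\<^sup>+x. (\<integral>\<^sup>+y. ennreal ((cmod (f (x, y)))\<^sup>2) \<partial>tor) \<partial>lborel) = (\<integral>\<^sup>+p. ennreal ((cmod (f p))\<^sup>2) \<partial>cyl)"
      unfolding cyl_eq by (rule tor.nn_integral_fst[of "\<lambda>p. ennreal ((cmod (f p))\<^sup>2)"]) simp
    also have "ennreal (2 * pi) * (ennreal (2 * pi) * (\<integral>\<^sup>+p. ennreal ((cmod (f p))\<^sup>2) \<partial>cyl)) = ?B"
      by (simp add: mult.assoc[symmetric] power2_eq_square flip: ennreal_mult)
    finally show ?thesis .
  qed
  have "(\<integral>\<^sup>+p. ennreal ((cmod (fourier f p))\<^sup>2) \<partial>freq) = (\<integral>\<^sup>+\<eta>. J \<eta> \<partial>count_space UNIV)"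
    unfolding J_def by (rule nn_integral_freq) simp
  also have "\<dots> \<le> ?B" by (rule nn_integral_int_le) (rule fin, simp)
  finally show ?thesis .
qed

section \<open>Square integrable functions and their Fourier transform\<close>

text \<open>The squared \<open>L\<^sup>2\<close> norm of a measurable function, with the value \<open>\<infinity>\<close> outside \<open>L\<^sup>2\<close>.\<close>

definition sqnorm :: "'a measure \<Rightarrow> ('a \<Rightarrow> complex) \<Rightarrow> ennreal" where
  "sqnorm M f = (\<integral>\<^sup>+z. ennreal ((cmod (f z))\<^sup>2) \<partial>M)"

lemma L2_iff: "f \<in> L2 M \<longleftrightarrow> f \<in> borel_measurable M \<and> sqnorm M f < \<infinity>"
proof -
  have "f \<in> borel_measurable M \<Longrightarrow> (\<lambda>z. (cmod (f z))\<^sup>2) \<in> borel_measurable M" by measurable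
  thus ?thesis unfolding L2_def sqnorm_def by (auto simp: integrable_iff_bounded)
qed

lemma L2_measurable: "f \<in> L2 M \<Longrightarrow> f \<in> borel_measurable M" by (simp add: L2_iff)

lemma L2_integrable: "f \<in> L2 M \<Longrightarrow> integrable M (\<lambda>z. (cmod (f z))\<^sup>2)" by (simp add: L2_def)

lemma sqnorm_l2norm: "f \<in> L2 M \<Longrightarrow> sqnorm M f = ennreal ((l2norm M f)\<^sup>2)"
  unfolding sqnorm_def l2norm_def by (subst nn_integral_eq_integral) (auto simp: L2_def)

lemma l2norm_nonneg: "l2norm M f \<ge> 0" by (simp add: l2norm_def)

text \<open>A substitute for the triangle inequality, up to constants that do not matter for convergence.\<close>

lemma sqnorm_add_le:
  assumes [measurable]: "f \<in> borel_measurable M" "g \<in> borel_measurable M"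
  shows "sqnorm M (\<lambda>z. f z + g z) \<le> 2 * sqnorm M f + 2 * sqnorm M g"
proof -
  have "sqnorm M (\<lambda>z. f z + g z) \<le> (\<integral>\<^sup>+z. ennreal (2 * (cmod (f z))\<^sup>2) + ennreal (2 * (cmod (g z))\<^sup>2) \<partial>M)"
    unfolding sqnorm_def
  proof (intro nn_integral_mono)
    fix z
    have "(cmod (f z + g z))\<^sup>2 \<le> (cmod (f z) + cmod (g z))\<^sup>2" by (intro power_mono norm_triangle_ineq) auto
    also have "\<dots> \<le> 2 * (cmod (f z))\<^sup>2 + 2 * (cmod (g z))\<^sup>2"
      using sum_squares_bound[of "cmod (f z)" "cmod (g z)"] by (simp add: power2_sum)
    finally show "ennreal ((cmod (f z + g z))\<^sup>2) \<le> ennreal (2 * (cmod (f z))\<^sup>2) + ennreal (2 * (cmod (g z))\<^sup>2)"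
      by (subst ennreal_plus[symmetric]) (auto intro: ennreal_leI simp del: ennreal_plus)
  qed
  also have "\<dots> = 2 * sqnorm M f + 2 * sqnorm M g"
    unfolding sqnorm_def by (simp add: nn_integral_add ennreal_mult nn_integral_cmult)
  finally show ?thesis .
qed

lemma sqnorm_cmult:
  assumes [measurable]: "f \<in> borel_measurable M"
  shows "sqnorm M (\<lambda>z. c * f z) = ennreal ((cmod c)\<^sup>2) * sqnorm M f"
  unfolding sqnorm_def by (simp add: norm_mult power_mult_distrib ennreal_mult nn_integral_cmult)

lemma sqnorm_diff_le:
  assumes [measurable]: "f \<in> borel_measurable M" "g \<in> borel_measurable M"
  shows "sqnorm M (\<lambda>z. f z - g z) \<le> 2 * sqnorm M f + 2 * sqnorm M g"
proof -
  have "sqnorm M (\<lambda>z. - g z) = sqnorm M g" by (simp add: sqnorm_def)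
  thus ?thesis using sqnorm_add_le[of f M "\<lambda>z. - g z"] by simp
qed

lemma sqnorm_cong_AE: "AE z in M. f z = g z \<Longrightarrow> sqnorm M f = sqnorm M g"
  unfolding sqnorm_def by (rule nn_integral_cong_AE) auto

lemma sqnorm_zero_iff: "f \<in> borel_measurable M \<Longrightarrow> sqnorm M f = 0 \<longleftrightarrow> (AE z in M. f z = 0)"
  unfolding sqnorm_def by (subst nn_integral_0_iff_AE) (auto simp: ennreal_eq_0_iff)

lemma L2_add: "f \<in> L2 M \<Longrightarrow> g \<in> L2 M \<Longrightarrow> (\<lambda>z. f z + g z) \<in> L2 M"
  using sqnorm_add_le[of f M g] unfolding L2_iff
  by (auto simp: ennreal_mult_less_top ennreal_add_less_top elim: order.strict_trans1 intro: le_less_trans)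

lemma L2_cmult: "f \<in> L2 M \<Longrightarrow> (\<lambda>z. c * f z) \<in> L2 M"
  unfolding L2_iff by (auto simp: sqnorm_cmult ennreal_mult_less_top)

lemma L2_diff: "f \<in> L2 M \<Longrightarrow> g \<in> L2 M \<Longrightarrow> (\<lambda>z. f z - g z) \<in> L2 M"
  using L2_add[of f M "\<lambda>z. -1 * g z"] L2_cmult[of g M "-1"] by simp

lemma L2_mono: "f \<in> L2 M \<Longrightarrow> g \<in> borel_measurable M \<Longrightarrow> (\<And>z. cmod (g z) \<le> cmod (f z)) \<Longrightarrow> g \<in> L2 M"
proof -
  assume f: "f \<in> L2 M" and g: "g \<in> borel_measurable M" and le: "\<And>z. cmod (g z) \<le> cmod (f z)"
  have "sqnorm M g \<le> sqnorm M f" unfolding sqnorm_def by (intro nn_integral_mono ennreal_leI power_mono le) auto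
  thus ?thesis using f g by (auto simp: L2_iff)
qed

lemma L2_cong_AE: "f \<in> L2 M \<Longrightarrow> g \<in> borel_measurable M \<Longrightarrow> AE z in M. f z = g z \<Longrightarrow> g \<in> L2 M"
  using sqnorm_cong_AE[of f g M] by (simp add: L2_iff)

lemma L2_tendsto_iff:
  "L2_tendsto M g f F \<longleftrightarrow> f \<in> L2 M \<and> (\<forall>\<^sub>F t in F. g t \<in> L2 M) \<and> ((\<lambda>t. sqnorm M (\<lambda>z. g t z - f z)) \<longlongrightarrow> 0) F"
proof (cases "f \<in> L2 M \<and> (\<forall>\<^sub>F t in F. g t \<in> L2 M)")
  case True
  hence ev: "\<forall>\<^sub>F t in F. sqnorm M (\<lambda>z. g t z - f z) = ennreal ((l2norm M (\<lambda>z. g t z - f z))\<^sup>2)"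
    by (auto elim!: eventually_mono intro!: sqnorm_l2norm L2_diff)
  have "((\<lambda>t. l2norm M (\<lambda>z. g t z - f z)) \<longlongrightarrow> 0) F \<longleftrightarrow> ((\<lambda>t. (l2norm M (\<lambda>z. g t z - f z))\<^sup>2) \<longlongrightarrow> 0) F"
  proof
    assume "((\<lambda>t. l2norm M (\<lambda>z. g t z - f z)) \<longlongrightarrow> 0) F"
    from tendsto_power[OF this, of 2] show "((\<lambda>t. (l2norm M (\<lambda>z. g t z - f z))\<^sup>2) \<longlongrightarrow> 0) F" by simp
  next
    assume "((\<lambda>t. (l2norm M (\<lambda>z. g t z - f z))\<^sup>2) \<longlongrightarrow> 0) F"
    from tendsto_real_sqrt[OF this] show "((\<lambda>t. l2norm M (\<lambda>z. g t z - f z)) \<longlongrightarrow> 0) F"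
      by (simp add: l2norm_nonneg)
  qed
  also have "\<dots> \<longleftrightarrow> ((\<lambda>t. ennreal ((l2norm M (\<lambda>z. g t z - f z))\<^sup>2)) \<longlongrightarrow> ennreal 0) F"
    by (rule tendsto_ennreal_iff[symmetric]) auto
  also have "\<dots> \<longleftrightarrow> ((\<lambda>t. sqnorm M (\<lambda>z. g t z - f z)) \<longlongrightarrow> 0) F"
    using tendsto_cong[OF ev] by simp
  finally show ?thesis using True by (simp add: L2_tendsto_def)
qed (auto simp: L2_tendsto_def)

lemma L2_tendsto_add:
  assumes a: "L2_tendsto M g f F" and b: "L2_tendsto M g' f' F"
  shows "L2_tendsto M (\<lambda>t z. g t z + g' t z) (\<lambda>z. f z + f' z) F"
proof -
  have ev: "\<forall>\<^sub>F t in F. g t \<in> L2 M \<and> g' t \<in> L2 M" using a b by (auto simp: L2_tendsto_iff eventually_conj_iff)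
  have f: "f \<in> L2 M" "f' \<in> L2 M" using a b by (auto simp: L2_tendsto_iff)
  have "((\<lambda>t. sqnorm M (\<lambda>z. (g t z + g' t z) - (f z + f' z))) \<longlongrightarrow> 0) F"
  proof (rule tendsto_sandwich[OF _ _ tendsto_const])
    have "((\<lambda>t. 2 * sqnorm M (\<lambda>z. g t z - f z) + 2 * sqnorm M (\<lambda>z. g' t z - f' z)) \<longlongrightarrow> 2 * 0 + 2 * 0) F"
      using a b by (intro tendsto_add ennreal_tendsto_cmult) (auto simp: L2_tendsto_iff)
    thus "((\<lambda>t. 2 * sqnorm M (\<lambda>z. g t z - f z) + 2 * sqnorm M (\<lambda>z. g' t z - f' z)) \<longlongrightarrow> 0) F" by simp
    show "\<forall>\<^sub>F t in F. sqnorm M (\<lambda>z. (g t z + g' t z) - (f z + f' z)) \<le> 2 * sqnorm M (\<lambda>z. g t z - f z) + 2 * sqnorm M (\<lambda>z. g' t z - f' z)"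
      using ev
    proof eventually_elim
      case (elim t)
      have "(\<lambda>z. (g t z + g' t z) - (f z + f' z)) = (\<lambda>z. (g t z - f z) + (g' t z - f' z))" by auto
      thus ?case using sqnorm_add_le[of "\<lambda>z. g t z - f z" M "\<lambda>z. g' t z - f' z"] elim f
        by (auto dest!: L2_measurable)
    qed
  qed auto
  thus ?thesis unfolding L2_tendsto_iff using f ev by (auto intro: L2_add elim!: eventually_mono)
qed

lemma L2_tendsto_cmult:
  assumes a: "L2_tendsto M g f F"
  shows "L2_tendsto M (\<lambda>t z. c * g t z) (\<lambda>z. c * f z) F"
proof -
  have ev: "\<forall>\<^sub>F t in F. g t \<in> L2 M" and f: "f \<in> L2 M" using a by (auto simp: L2_tendsto_iff)
  have "((\<lambda>t. ennreal ((cmod c)\<^sup>2) * sqnorm M (\<lambda>z. g t z - f z)) \<longlongrightarrow> ennreal ((cmod c)\<^sup>2) * 0) F"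
    using a by (intro ennreal_tendsto_cmult) (auto simp: L2_tendsto_iff)
  moreover have "\<forall>\<^sub>F t in F. ennreal ((cmod c)\<^sup>2) * sqnorm M (\<lambda>z. g t z - f z) = sqnorm M (\<lambda>z. c * g t z - c * f z)"
    using ev
  proof eventually_elim
    case (elim t)
    show ?case using sqnorm_cmult[of "\<lambda>z. g t z - f z" M c] elim f by (auto dest!: L2_measurable simp: right_diff_distrib)
  qed
  ultimately have "((\<lambda>t. sqnorm M (\<lambda>z. c * g t z - c * f z)) \<longlongrightarrow> 0) F" by (simp add: tendsto_cong)
  thus ?thesis unfolding L2_tendsto_iff using f ev by (auto intro: L2_cmult elim!: eventually_mono)
qed

lemma L2_integrable_mult:
  assumes f: "f \<in> L2 M" and g: "g \<in> L2 M"
  shows "integrable M (\<lambda>z. f z * g z)"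
proof (rule Bochner_Integration.integrable_bound)
  show "integrable M (\<lambda>z. (cmod (f z))\<^sup>2 + (cmod (g z))\<^sup>2)" using f g by (auto simp: L2_def)
  show "(\<lambda>z. f z * g z) \<in> borel_measurable M" using f g by (auto simp: L2_iff)
  show "AE z in M. norm (f z * g z) \<le> norm ((cmod (f z))\<^sup>2 + (cmod (g z))\<^sup>2)"
  proof (intro AE_I2)
    fix z
    have "cmod (f z) * cmod (g z) \<le> 2 * cmod (f z) * cmod (g z)" by simp
    also have "\<dots> \<le> (cmod (f z))\<^sup>2 + (cmod (g z))\<^sup>2" by (rule sum_squares_bound)
    finally show "norm (f z * g z) \<le> norm ((cmod (f z))\<^sup>2 + (cmod (g z))\<^sup>2)" by (simp add: norm_mult)
  qed
qed

text \<open>For every \<open>l > 0\<close>, \<open>2 |f g| \<le> l |f|\<^sup>2 + |g|\<^sup>2 / l\<close>; the best \<open>l\<close> is the quotient of the norms.\<close>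

lemma L2_Cauchy_Schwarz:
  assumes f: "f \<in> L2 M" and g: "g \<in> L2 M"
  shows "(\<integral>z. cmod (f z * g z) \<partial>M) \<le> l2norm M f * l2norm M g"
proof -
  define a where "a = (\<integral>z. (cmod (f z))\<^sup>2 \<partial>M)"
  define b where "b = (\<integral>z. (cmod (g z))\<^sup>2 \<partial>M)"
  have ab: "a \<ge> 0" "b \<ge> 0" by (auto simp: a_def b_def)
  have fi: "integrable M (\<lambda>z. (cmod (f z))\<^sup>2)" "integrable M (\<lambda>z. (cmod (g z))\<^sup>2)" using f g by (auto simp: L2_def)
  define I where "I = (\<integral>z. cmod (f z * g z) \<partial>M)"
  \<comment> \<open>The bound for perturbed norms; the claim follows as \<open>e\<close> tends to 0.\<close>
  have le: "I \<le> sqrt ((a + e) * (b + e))" if e: "e > 0" for e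
  proof -
    \<comment> \<open>The optimal weight; \<open>e > 0\<close> keeps it positive and finite when a norm vanishes.\<close>
    define l where "l = sqrt ((b + e) / (a + e))"
    have l: "l > 0" using ab e by (simp add: l_def)
    have "I \<le> (\<integral>z. (l * (cmod (f z))\<^sup>2 + (cmod (g z))\<^sup>2 / l) / 2 \<partial>M)"
      unfolding I_def
    proof (rule integral_mono)
      show "integrable M (\<lambda>z. cmod (f z * g z))" using L2_integrable_mult[OF f g] by (rule integrable_norm)
      show "integrable M (\<lambda>z. (l * (cmod (f z))\<^sup>2 + (cmod (g z))\<^sup>2 / l) / 2)" using fi by auto
      fix z
      have "2 * (sqrt l * cmod (f z)) * (cmod (g z) / sqrt l) \<le> (sqrt l * cmod (f z))\<^sup>2 + (cmod (g z) / sqrt l)\<^sup>2"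
        by (rule sum_squares_bound)
      thus "cmod (f z * g z) \<le> (l * (cmod (f z))\<^sup>2 + (cmod (g z))\<^sup>2 / l) / 2"
        using l by (simp add: norm_mult power_mult_distrib power_divide)
    qed
    also have "\<dots> = (l * a + b / l) / 2" unfolding a_def b_def using fi by simp
    also have "\<dots> \<le> (l * (a + e) + (b + e) / l) / 2"
      using l e by (intro divide_right_mono add_mono mult_left_mono) auto
    also have "\<dots> = (sqrt ((a + e) * (b + e)) + sqrt ((a + e) * (b + e))) / 2"
    proof -
      have "l * (a + e) = sqrt ((a + e) * (b + e))" "(b + e) / l = sqrt ((a + e) * (b + e))"
      proof -
      define A where "A = sqrt (a + e)"
      define B where "B = sqrt (b + e)"
      have "a + e = A * A" "b + e = B * B" "A > 0" "B > 0" "l = B / A" "sqrt ((a + e) * (b + e)) = A * B"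
        using ab e by (auto simp: A_def B_def l_def real_sqrt_divide real_sqrt_mult)
      thus "l * (a + e) = sqrt ((a + e) * (b + e))" "(b + e) / l = sqrt ((a + e) * (b + e))" by auto
      qed
      thus ?thesis by simp
    qed
    finally show ?thesis by simp
  qed
  have "((\<lambda>e. sqrt ((a + e) * (b + e))) \<longlongrightarrow> sqrt ((a + 0) * (b + 0))) (at_right 0)"
    by (intro tendsto_intros)
  hence "I \<le> sqrt ((a + 0) * (b + 0))"
    by (rule tendsto_lowerbound) (auto simp: eventually_at_right_less intro: eventually_mono[OF eventually_at_right_less le])
  thus ?thesis unfolding I_def l2norm_def a_def b_def by (simp add: real_sqrt_mult)
qed

text \<open>The truncations in the definition of \<open>is_fourier\<close>.\<close>

definition trunc :: "real \<Rightarrow> (real \<times> real \<Rightarrow> complex) \<Rightarrow> real \<times> real \<Rightarrow> complex" where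
  "trunc R f p = (if \<bar>fst p\<bar> \<le> R then f p else 0)"

lemma is_fourier_iff:
  "is_fourier f F \<longleftrightarrow> f \<in> L2 cyl \<and> L2_tendsto freq (\<lambda>R. fourier (trunc R f)) F at_top"
  unfolding is_fourier_def trunc_def[abs_def] ..

lemma measurable_trunc: "f \<in> borel_measurable cyl \<Longrightarrow> trunc R f \<in> borel_measurable cyl"
proof -
  assume [measurable]: "f \<in> borel_measurable cyl"
  have [measurable]: "(\<lambda>p. indicator {-R..R} (fst p) :: complex) \<in> borel_measurable cyl"
    by (rule measurable_compose[OF measurable_fst_cyl]) simp
  have "trunc R f = (\<lambda>p. indicator {-R..R} (fst p) * f p)" by (rule ext) (auto simp: trunc_def abs_le_iff)
  thus ?thesis by simp
qed

lemma sqnorm_trunc_le: "sqnorm cyl (trunc R f) \<le> sqnorm cyl f"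
  unfolding sqnorm_def trunc_def by (intro nn_integral_mono) auto

lemma L2_trunc: "f \<in> L2 cyl \<Longrightarrow> trunc R f \<in> L2 cyl"
  by (rule L2_mono) (auto simp: trunc_def measurable_trunc L2_measurable)

lemma integrable_strip: "integrable cyl (\<lambda>p. complex_of_real (indicator {-R..R} (fst p)))"
proof -
  have "integrable lborel (\<lambda>x. complex_of_real (indicator {-R..R} x))"
    by (intro integrable_of_real integrable_real_indicator) (auto simp: emeasure_lborel_Icc_eq)
  from torus_pair.integrable_fst_times_snd[OF this, of "\<lambda>_. 1"] show ?thesis by (simp add: cyl_eq)
qed

lemma integrable_trunc:
  assumes f: "f \<in> L2 cyl"
  shows "integrable cyl (trunc R f)"
proof -
  have "(\<lambda>p. complex_of_real (indicator {-R..R} (fst p))) \<in> L2 cyl"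
  proof -
    have eq: "(\<lambda>p. (cmod (complex_of_real (indicator {-R..R} (fst p))))\<^sup>2) = (\<lambda>p. cmod (complex_of_real (indicator {-R..R} (fst p))))"
      by (rule ext) (simp add: indicator_def)
    have "integrable cyl (\<lambda>p. (cmod (complex_of_real (indicator {-R..R} (fst p))))\<^sup>2)"
      unfolding eq by (rule integrable_norm[OF integrable_strip])
    moreover have "(\<lambda>p. complex_of_real (indicator {-R..R} (fst p))) \<in> borel_measurable cyl"
      using integrable_strip by (rule borel_measurable_integrable)
    ultimately show ?thesis unfolding L2_def by blast
  qed
  from L2_integrable_mult[OF f this] show ?thesis
    by (rule Bochner_Integration.integrable_cong[THEN iffD1, rotated 2]) (auto simp: trunc_def indicator_def)
qed

lemma fourier_add:
  assumes "integrable cyl f" "integrable cyl g"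
  shows "fourier (\<lambda>p. f p + g p) q = fourier f q + fourier g q"
proof -
  obtain \<xi> \<eta> where q: "q = (\<xi>, \<eta>)" by (cases q)
  have "integrable cyl (\<lambda>p. f p * cis (- (fst p * \<xi>) - snd p * of_int \<eta>))" "integrable cyl (\<lambda>p. g p * cis (- (fst p * \<xi>) - snd p * of_int \<eta>))"
    using assms by (auto intro!: integrable_times_cis)
  thus ?thesis unfolding q fourier_eq by (simp add: distrib_right)
qed

lemma fourier_cmult: "fourier (\<lambda>p. c * f p) q = c * fourier f q"
  by (cases q) (simp add: fourier_eq mult.assoc)

lemma fourier_diff:
  assumes "integrable cyl f" "integrable cyl g"
  shows "fourier (\<lambda>p. f p - g p) q = fourier f q - fourier g q"
  using fourier_add[OF assms(1), of "\<lambda>p. -1 * g p"] fourier_cmult[of "-1" g] assms by simp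

lemma fourier_cong_AE:
  assumes "AE p in cyl. f p = g p" "f \<in> borel_measurable cyl" "g \<in> borel_measurable cyl"
  shows "fourier f = fourier g"
proof
  fix q :: "real \<times> int"
  show "fourier f q = fourier g q"
    using assms by (cases q) (auto simp: fourier_eq intro!: integral_cong_AE)
qed

lemma cmod_fourier_le:
  assumes "integrable cyl f"
  shows "cmod (fourier f q) \<le> (\<integral>p. cmod (f p) \<partial>cyl)"
  by (cases q) (auto simp: fourier_eq norm_mult intro!: order_trans[OF integral_norm_bound])

lemma sqnorm_fourier_le: "integrable cyl f \<Longrightarrow> sqnorm freq (fourier f) \<le> ennreal (4 * pi\<^sup>2) * sqnorm cyl f"
  unfolding sqnorm_def by (rule fourier_bessel)

lemma L2_fourier: "integrable cyl f \<Longrightarrow> f \<in> L2 cyl \<Longrightarrow> fourier f \<in> L2 freq"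
  using sqnorm_fourier_le[of f] unfolding L2_iff
  by (auto simp: measurable_fourier ennreal_mult_less_top intro: le_less_trans)

lemma is_fourier_add:
  assumes a: "is_fourier f F" and b: "is_fourier g G"
  shows "is_fourier (\<lambda>p. f p + g p) (\<lambda>q. F q + G q)"
proof -
  have L: "f \<in> L2 cyl" "g \<in> L2 cyl" using a b by (auto simp: is_fourier_iff)
  have "fourier (trunc R (\<lambda>p. f p + g p)) = (\<lambda>q. fourier (trunc R f) q + fourier (trunc R g) q)" for R
  proof -
    have eq: "trunc R (\<lambda>p. f p + g p) = (\<lambda>p. trunc R f p + trunc R g p)" by (auto simp: trunc_def)
    show ?thesis unfolding eq using L by (intro ext fourier_add integrable_trunc)
  qed
  thus ?thesis using a b L2_add[OF L] unfolding is_fourier_iff by (auto intro: L2_tendsto_add)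
qed

lemma is_fourier_cmult:
  assumes a: "is_fourier f F"
  shows "is_fourier (\<lambda>p. c * f p) (\<lambda>q. c * F q)"
proof -
  have "fourier (trunc R (\<lambda>p. c * f p)) = (\<lambda>q. c * fourier (trunc R f) q)" for R
  proof -
    have eq: "trunc R (\<lambda>p. c * f p) = (\<lambda>p. c * trunc R f p)" by (auto simp: trunc_def)
    show ?thesis unfolding eq by (intro ext fourier_cmult)
  qed
  thus ?thesis using a unfolding is_fourier_iff by (auto intro: L2_tendsto_cmult L2_cmult)
qed

lemma is_fourier_diff:
  assumes a: "is_fourier f F" and b: "is_fourier g G"
  shows "is_fourier (\<lambda>p. f p - g p) (\<lambda>q. F q - G q)"
  using is_fourier_add[OF a is_fourier_cmult[OF b, of "-1"]] by simp

lemma is_fourier_L2: "is_fourier f F \<Longrightarrow> f \<in> L2 cyl" "is_fourier f F \<Longrightarrow> F \<in> L2 freq"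
  by (auto simp: is_fourier_iff L2_tendsto_def)

lemma is_fourier_cong_AE:
  assumes a: "is_fourier f F" and g: "AE p in cyl. f p = g p" "g \<in> borel_measurable cyl"
    and G: "AE q in freq. F q = G q" "G \<in> borel_measurable freq"
  shows "is_fourier g G"
proof -
  have L: "f \<in> L2 cyl" "F \<in> L2 freq" using is_fourier_L2[OF a] by auto
  have "fourier (trunc R f) = fourier (trunc R g)" for R
    by (rule fourier_cong_AE) (use g L in \<open>auto simp: trunc_def measurable_trunc L2_measurable\<close>)
  moreover have "sqnorm freq (\<lambda>z. h z - F z) = sqnorm freq (\<lambda>z. h z - G z)" for h
    by (rule sqnorm_cong_AE) (use G in auto)
  ultimately show ?thesis
    using a L2_cong_AE[OF L(1) g(2,1)] L2_cong_AE[OF L(2) G(2,1)] by (simp add: is_fourier_iff L2_tendsto_iff)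
qed

text \<open>Bessel's inequality for the truncations, in the limit. The factor 2 lost against \<open>4 pi\<^sup>2\<close> comes from the
crude form of the triangle inequality.\<close>

lemma sqnorm_is_fourier_le:
  assumes a: "is_fourier f F"
  shows "sqnorm freq F \<le> ennreal (8 * pi\<^sup>2) * sqnorm cyl f"
proof -
  have L: "f \<in> L2 cyl" "F \<in> L2 freq" using is_fourier_L2[OF a] by auto
  have lim: "((\<lambda>R. sqnorm freq (\<lambda>z. fourier (trunc R f) z - F z)) \<longlongrightarrow> 0) at_top"
    using a by (auto simp: is_fourier_iff L2_tendsto_iff)
  have le: "sqnorm freq F \<le> 2 * sqnorm freq (\<lambda>z. fourier (trunc R f) z - F z) + ennreal (8 * pi\<^sup>2) * sqnorm cyl f" for R
  proof -
    have m: "fourier (trunc R f) \<in> borel_measurable freq" using L by (intro measurable_fourier measurable_trunc L2_measurable)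
    have "F = (\<lambda>z. fourier (trunc R f) z - (fourier (trunc R f) z - F z))" by auto
    hence "sqnorm freq F \<le> 2 * sqnorm freq (fourier (trunc R f)) + 2 * sqnorm freq (\<lambda>z. fourier (trunc R f) z - F z)"
      using sqnorm_diff_le[of "fourier (trunc R f)" freq "\<lambda>z. fourier (trunc R f) z - F z"] m L2_measurable[OF L(2)] by simp
    also have "sqnorm freq (fourier (trunc R f)) \<le> ennreal (4 * pi\<^sup>2) * sqnorm cyl f"
      by (rule order_trans[OF sqnorm_fourier_le[OF integrable_trunc[OF L(1)]]]) (intro mult_left_mono sqnorm_trunc_le, simp)
    also have "2 * (ennreal (4 * pi\<^sup>2) * sqnorm cyl f) = ennreal (8 * pi\<^sup>2) * sqnorm cyl f"
    proof -
      have "2 * ennreal (4 * pi\<^sup>2) = ennreal 2 * ennreal (4 * pi\<^sup>2)" by simp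
      also have "\<dots> = ennreal (8 * pi\<^sup>2)" by (subst ennreal_mult[symmetric]) auto
      finally show ?thesis by (simp add: mult.assoc[symmetric])
    qed
    finally show ?thesis by (simp add: add.commute mult_left_mono)
  qed
  have "((\<lambda>R. 2 * sqnorm freq (\<lambda>z. fourier (trunc R f) z - F z) + ennreal (8 * pi\<^sup>2) * sqnorm cyl f) \<longlongrightarrow> 2 * 0 + ennreal (8 * pi\<^sup>2) * sqnorm cyl f) at_top"
    by (intro tendsto_add ennreal_tendsto_cmult tendsto_const lim) simp
  hence "sqnorm freq F \<le> 2 * 0 + ennreal (8 * pi\<^sup>2) * sqnorm cyl f"
    by (rule tendsto_lowerbound) (auto intro!: always_eventually le)
  thus ?thesis by simp
qed

lemma is_fourier_unique:
  assumes "is_fourier f F" "is_fourier f G"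
  shows "AE q in freq. F q = G q"
proof -
  have "is_fourier (\<lambda>p. f p - f p) (\<lambda>q. F q - G q)" by (rule is_fourier_diff[OF assms])
  from sqnorm_is_fourier_le[OF this] have "sqnorm freq (\<lambda>q. F q - G q) = 0" by (simp add: sqnorm_def)
  moreover have "(\<lambda>q. F q - G q) \<in> borel_measurable freq"
    using assms by (auto dest!: is_fourier_L2(2) L2_measurable)
  ultimately show ?thesis by (simp add: sqnorm_zero_iff)
qed

text \<open>On \<open>L\<^sup>1 \<inter> L\<^sup>2\<close> the \<open>L\<^sup>2\<close> Fourier transform is the Fourier integral, since by Bessel's inequality the Fourier
integrals of the truncations converge to it in \<open>L\<^sup>2\<close>.\<close>

lemma is_fourier_integrable:
  assumes f: "f \<in> L2 cyl" and i: "integrable cyl f"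
  shows "is_fourier f (fourier f)"
proof -
  have fm[measurable]: "f \<in> borel_measurable cyl" using f by (rule L2_measurable)
  have lim0: "((\<lambda>R. sqnorm cyl (\<lambda>p. trunc R f p - f p)) \<longlongrightarrow> 0) at_top"
  proof -
    have "((\<lambda>R. \<integral>p. (cmod (trunc R f p - f p))\<^sup>2 \<partial>cyl) \<longlongrightarrow> (\<integral>p. 0 \<partial>cyl)) at_top"
    proof (rule integral_dominated_convergence_at_top[where w="\<lambda>p. (cmod (f p))\<^sup>2"])
      show "AE p in cyl. ((\<lambda>R. (cmod (trunc R f p - f p))\<^sup>2) \<longlongrightarrow> 0) at_top"
      proof (intro AE_I2 tendsto_eventually)
        fix p show "\<forall>\<^sub>F R in at_top. (cmod (trunc R f p - f p))\<^sup>2 = 0"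
          using eventually_ge_at_top[of "\<bar>fst p\<bar>"] by eventually_elim (simp add: trunc_def)
      qed
      show "\<forall>\<^sub>F R in at_top. AE p in cyl. norm ((cmod (trunc R f p - f p))\<^sup>2) \<le> (cmod (f p))\<^sup>2"
        by (intro always_eventually allI AE_I2) (simp add: trunc_def)
    qed (use L2_integrable[OF f] measurable_trunc[OF fm] in auto)
    hence "((\<lambda>R. ennreal (\<integral>p. (cmod (trunc R f p - f p))\<^sup>2 \<partial>cyl)) \<longlongrightarrow> ennreal 0) at_top" by (intro tendsto_ennrealI) simp
    moreover have "ennreal (\<integral>p. (cmod (trunc R f p - f p))\<^sup>2 \<partial>cyl) = sqnorm cyl (\<lambda>p. trunc R f p - f p)" for R
      unfolding sqnorm_def by (rule nn_integral_eq_integral[symmetric]) (use L2_diff[OF L2_trunc[OF f] f] in \<open>auto simp: L2_def\<close>)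
    ultimately show ?thesis by simp
  qed
  have "((\<lambda>R. sqnorm freq (\<lambda>q. fourier (trunc R f) q - fourier f q)) \<longlongrightarrow> 0) at_top"
  proof (rule tendsto_sandwich[OF _ _ tendsto_const])
    have "((\<lambda>R. ennreal (4 * pi\<^sup>2) * sqnorm cyl (\<lambda>p. trunc R f p - f p)) \<longlongrightarrow> ennreal (4 * pi\<^sup>2) * 0) at_top"
      by (intro ennreal_tendsto_cmult lim0) simp
    thus "((\<lambda>R. ennreal (4 * pi\<^sup>2) * sqnorm cyl (\<lambda>p. trunc R f p - f p)) \<longlongrightarrow> 0) at_top" by simp
    show "\<forall>\<^sub>F R in at_top. sqnorm freq (\<lambda>q. fourier (trunc R f) q - fourier f q) \<le> ennreal (4 * pi\<^sup>2) * sqnorm cyl (\<lambda>p. trunc R f p - f p)"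
    proof (intro always_eventually allI)
      fix R
      have "(\<lambda>q. fourier (trunc R f) q - fourier f q) = fourier (\<lambda>p. trunc R f p - f p)"
        using fourier_diff[OF integrable_trunc[OF f] i] by auto
      thus "sqnorm freq (\<lambda>q. fourier (trunc R f) q - fourier f q) \<le> ennreal (4 * pi\<^sup>2) * sqnorm cyl (\<lambda>p. trunc R f p - f p)"
        using sqnorm_fourier_le[of "\<lambda>p. trunc R f p - f p"] integrable_trunc[OF f] i by simp
    qed
  qed auto
  thus ?thesis unfolding is_fourier_iff L2_tendsto_iff
    using f L2_fourier[OF i f] by (auto intro!: always_eventually L2_fourier integrable_trunc L2_trunc)
qed

section \<open>Fourier inversion\<close>

lemma L2_section:
  assumes G: "G \<in> L2 freq"
  shows "(\<lambda>\<xi>. G (\<xi>, \<eta>)) \<in> L2 lborel" "l2norm lborel (\<lambda>\<xi>. G (\<xi>, \<eta>)) \<le> l2norm freq G"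
proof -
  have Gm: "G \<in> borel_measurable freq" using G by (rule L2_measurable)
  hence m: "(\<lambda>q. ennreal ((cmod (G q))\<^sup>2)) \<in> borel_measurable freq" by simp
  have le: "sqnorm lborel (\<lambda>\<xi>. G (\<xi>, \<eta>)) \<le> sqnorm freq G"
    unfolding sqnorm_def using nn_integral_section_le[OF m, of \<eta>] by simp
  show L: "(\<lambda>\<xi>. G (\<xi>, \<eta>)) \<in> L2 lborel"
    using le_less_trans[OF le] G measurable_section_freq[of G borel \<eta>] by (simp add: L2_iff)
  from le have "(l2norm lborel (\<lambda>\<xi>. G (\<xi>, \<eta>)))\<^sup>2 \<le> (l2norm freq G)\<^sup>2"
    unfolding sqnorm_l2norm[OF L] sqnorm_l2norm[OF G] by simp
  thus "l2norm lborel (\<lambda>\<xi>. G (\<xi>, \<eta>)) \<le> l2norm freq G"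
    using l2norm_nonneg power2_le_imp_le by blast
qed

text \<open>The inverse Fourier integral on \<open>\<real> \<times> \<int>\<close>.\<close>

definition inv_fourier :: "(real \<times> int \<Rightarrow> complex) \<Rightarrow> real \<times> real \<Rightarrow> complex" where
  "inv_fourier F p = (\<integral>q. F q * cis (fst p * fst q + snd p * of_int (snd q)) \<partial>freq) / of_real (4 * pi\<^sup>2)"

lemma measurable_phase_cyl_freq:
  "(\<lambda>z. fst (fst z) * fst (snd z) + snd (fst z) * of_int (snd (snd z))) \<in> borel_measurable (cyl \<Otimes>\<^sub>M freq)"
proof -
  note [measurable] = measurable_compose[OF measurable_snd measurable_of_int_snd_freq]
    measurable_compose[OF measurable_snd measurable_fst_freq] measurable_compose[OF measurable_fst measurable_fst_cyl]
    measurable_compose[OF measurable_fst measurable_snd_cyl]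
  show ?thesis by measurable
qed

lemma measurable_inv_fourier:
  assumes [measurable]: "F \<in> borel_measurable freq"
  shows "inv_fourier F \<in> borel_measurable cyl"
proof -
  note [measurable] = measurable_phase_cyl_freq measurable_compose[OF measurable_snd assms]
  have "(\<lambda>p. \<integral>q. (\<lambda>(p, q). F q * cis (fst p * fst q + snd p * of_int (snd q))) (p, q) \<partial>freq) \<in> borel_measurable cyl"
    by (rule freq.borel_measurable_lebesgue_integral) (simp add: split_def)
  hence [measurable]: "(\<lambda>p. \<integral>q. F q * cis (fst p * fst q + snd p * of_int (snd q)) \<partial>freq) \<in> borel_measurable cyl" by (simp only: prod.case)
  show ?thesis unfolding inv_fourier_def[abs_def] by measurable
qed

lemma cmod_inv_fourier_le: "cmod (inv_fourier F p) \<le> (\<integral>q. cmod (F q) \<partial>freq) / (4 * pi\<^sup>2)"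
proof -
  have "cmod (\<integral>q. F q * cis (fst p * fst q + snd p * of_int (snd q)) \<partial>freq) \<le> (\<integral>q. cmod (F q) \<partial>freq)"
    by (rule order_trans[OF integral_norm_bound]) (simp add: norm_mult)
  thus ?thesis unfolding inv_fourier_def by (simp add: norm_divide norm_mult norm_power divide_right_mono)
qed

lemma cyl_integral_ycoeff:
  assumes g: "integrable cyl g" and \<phi>[measurable]: "\<phi> \<in> borel_measurable borel" and b: "\<And>x. cmod (\<phi> x) \<le> C"
  shows "(\<integral>x. ycoeff g \<eta> x * \<phi> x \<partial>lborel) = (\<integral>p. g p * \<phi> (fst p) * cis (- (of_int \<eta> * snd p)) \<partial>cyl)"
proof -
  have "(\<lambda>p. \<phi> (fst p)) \<in> borel_measurable cyl" by measurable
  hence "integrable cyl (\<lambda>p. g p * \<phi> (fst p))" by (rule integrable_times_bounded[OF g]) (rule b)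
  hence "integrable cyl (\<lambda>p. g p * \<phi> (fst p) * cis (- (of_int \<eta> * snd p)))" by (rule integrable_times_cis) measurable
  from torus_pair.integral_fst'[OF this[unfolded cyl_eq]]
  have "(\<integral>p. g p * \<phi> (fst p) * cis (- (of_int \<eta> * snd p)) \<partial>cyl) = (\<integral>x. (\<integral>y. g (x, y) * \<phi> x * cis (- (of_int \<eta> * y)) \<partial>tor) \<partial>lborel)"
    by (simp add: cyl_eq)
  also have "\<dots> = (\<integral>x. (\<integral>y. (g (x, y) * cis (- (of_int \<eta> * y))) * \<phi> x \<partial>tor) \<partial>lborel)"
    by (simp add: mult_ac)
  also have "\<dots> = (\<integral>x. ycoeff g \<eta> x * \<phi> x \<partial>lborel)" by (simp add: ycoeff_def)
  finally show ?thesis ..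
qed

lemma integral_count_space_single:
  fixes g :: "'a \<Rightarrow> complex"
  assumes "\<And>k. k \<noteq> a \<Longrightarrow> g k = 0"
  shows "(\<integral>k. g k \<partial>count_space UNIV) = g a"
proof -
  have s: "{k. g k \<noteq> 0} \<subseteq> {a}" using assms by auto
  have "(\<integral>k. g k \<partial>count_space UNIV) = (\<Sum>k | g k \<noteq> 0. g k)"
    by (subst lebesgue_integral_count_space_finite_support) (use finite_subset[OF s] in simp_all)
  also have "\<dots> = (\<Sum>k\<in>{a}. g k)" by (rule sum.mono_neutral_left) (use s in auto)
  finally show ?thesis by simp
qed

lemma gaussian_cyl:
  assumes c: "c > 0"
  shows "(\<lambda>p. complex_of_real (exp (- c * (fst p - a)\<^sup>2))) \<in> L2 cyl" "integrable cyl (\<lambda>p. complex_of_real (exp (- c * (fst p - a)\<^sup>2)))"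
proof -
  have i: "integrable cyl (\<lambda>p. complex_of_real (exp (- c * (fst p - a)\<^sup>2)))" if "c > 0" for c
  proof -
    have "integrable lborel (\<lambda>x. complex_of_real (exp (- c * (x - a)\<^sup>2)))"
      by (rule integrable_of_real[OF gaussian_integral(1)[OF that]])
    from torus_pair.integrable_fst_times_snd[OF this, of "\<lambda>_. 1"] show ?thesis by (simp add: cyl_eq)
  qed
  show "integrable cyl (\<lambda>p. complex_of_real (exp (- c * (fst p - a)\<^sup>2)))" by (rule i[OF c])
  have "(cmod (complex_of_real (exp (- c * (fst p - a)\<^sup>2))))\<^sup>2 = cmod (complex_of_real (exp (- (2 * c) * (fst p - a)\<^sup>2)))" for p :: "real \<times> real"
    by (simp add: power2_eq_square flip: exp_add)
  moreover have "integrable cyl (\<lambda>p. cmod (complex_of_real (exp (- (2 * c) * (fst p - a)\<^sup>2))))"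
    by (rule integrable_norm[OF i]) (use c in simp)
  ultimately show "(\<lambda>p. complex_of_real (exp (- c * (fst p - a)\<^sup>2))) \<in> L2 cyl"
    unfolding L2_def using borel_measurable_integrable[OF i[OF c]] by (simp only: mem_Collect_eq)
qed

text \<open>Parseval's identity for \<open>f\<close> and a Gaussian: exchange the integrals for the truncations of \<open>f\<close>, which are
integrable, and pass to the limit, on the left by dominated convergence and on the right by the
Cauchy-Schwarz inequality.\<close>

lemma gaussian_pairing_is_fourier:
  assumes F: "is_fourier f F" and c: "c > 0"
  shows "of_real (sqrt (4 * pi * c)) * (\<integral>p. f p * of_real (exp (- c * (fst p - a)\<^sup>2)) * cis (- (of_int \<eta> * snd p)) \<partial>cyl)
     = (\<integral>\<xi>. F (\<xi>, \<eta>) * (of_real (exp (- (1 / (4 * c)) * \<xi>\<^sup>2)) * cis (\<xi> * a)) \<partial>lborel)"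
proof -
  have f: "f \<in> L2 cyl" and FL: "F \<in> L2 freq" using is_fourier_L2[OF F] by auto
  have fm[measurable]: "f \<in> borel_measurable cyl" using f by (rule L2_measurable)
  have c': "1 / (4 * c) > 0" using c by simp
  define \<psi> where "\<psi> = (\<lambda>\<xi>. complex_of_real (exp (- (1 / (4 * c)) * \<xi>\<^sup>2)) * cis (\<xi> * a))"
  have \<psi>i: "integrable lborel \<psi>" unfolding \<psi>_def by (rule integrable_times_cis[OF gaussian_fourier(1)[OF c']]) simp
  have \<psi>L: "\<psi> \<in> L2 lborel"
  proof -
    have "(cmod (\<psi> \<xi>))\<^sup>2 = exp (- (1 / (2 * c)) * (\<xi> - 0)\<^sup>2)" for \<xi>
      unfolding \<psi>_def by (simp add: norm_mult power2_eq_square flip: exp_add)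
    thus ?thesis unfolding L2_def using borel_measurable_integrable[OF \<psi>i] gaussian_integral(1)[of "1 / (2 * c)" 0] c by simp
  qed
  define \<phi> where "\<phi> = (\<lambda>x. complex_of_real (exp (- c * (x - a)\<^sup>2)))"
  have [measurable]: "\<phi> \<in> borel_measurable borel" unfolding \<phi>_def by measurable
  have \<phi>b: "cmod (\<phi> x) \<le> 1" for x using c by (simp add: \<phi>_def)
  have \<psi>t: "(\<integral>\<xi>. \<psi> \<xi> * cis (-1 * x * \<xi>) \<partial>lborel) = of_real (sqrt (4 * pi * c)) * \<phi> x" for x
  proof -
    have "\<psi> \<xi> * cis (-1 * x * \<xi>) = of_real (exp (- (1 / (4 * c)) * \<xi>\<^sup>2)) * cis (\<xi> * (a - x))" for \<xi>
      unfolding \<psi>_def by (simp add: mult.assoc cis_mult algebra_simps)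
    hence "(\<integral>\<xi>. \<psi> \<xi> * cis (-1 * x * \<xi>) \<partial>lborel) = of_real (sqrt (pi / (1 / (4 * c))) * exp (- (a - x)\<^sup>2 / (4 * (1 / (4 * c)))))"
      by (simp only: gaussian_fourier(2)[OF c'])
    also have "sqrt (pi / (1 / (4 * c))) = sqrt (4 * pi * c)" by (simp add: mult_ac)
    also have "- (a - x)\<^sup>2 / (4 * (1 / (4 * c))) = - c * (x - a)\<^sup>2" using c by (simp add: power2_commute)
    finally show ?thesis by (simp add: \<phi>_def)
  qed
  have RR: "(\<integral>\<xi>. fourier (trunc R f) (\<xi>, \<eta>) * \<psi> \<xi> \<partial>lborel)
     = of_real (sqrt (4 * pi * c)) * (\<integral>p. trunc R f p * \<phi> (fst p) * cis (- (of_int \<eta> * snd p)) \<partial>cyl)" for R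
  proof -
    have i: "integrable cyl (trunc R f)" by (rule integrable_trunc[OF f])
    have "(\<integral>\<xi>. fourier (trunc R f) (\<xi>, \<eta>) * \<psi> \<xi> \<partial>lborel) = (\<integral>x. ycoeff (trunc R f) \<eta> x * (of_real (sqrt (4 * pi * c)) * \<phi> x) \<partial>lborel)"
      unfolding fourier_ycoeff[OF i] \<psi>t[symmetric] by (rule fourier_duality[OF integrable_ycoeff[OF i] \<psi>i])
    also have "\<dots> = of_real (sqrt (4 * pi * c)) * (\<integral>x. ycoeff (trunc R f) \<eta> x * \<phi> x \<partial>lborel)"
      by (simp only: mult.left_commute[of "ycoeff _ _ _"] integral_mult_right_zero)
    also have "(\<integral>x. ycoeff (trunc R f) \<eta> x * \<phi> x \<partial>lborel) = (\<integral>p. trunc R f p * \<phi> (fst p) * cis (- (of_int \<eta> * snd p)) \<partial>cyl)"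
      by (rule cyl_integral_ycoeff[OF i _ \<phi>b]) simp
    finally show ?thesis .
  qed
  have lim1: "((\<lambda>R. \<integral>p. trunc R f p * \<phi> (fst p) * cis (- (of_int \<eta> * snd p)) \<partial>cyl) \<longlongrightarrow> (\<integral>p. f p * \<phi> (fst p) * cis (- (of_int \<eta> * snd p)) \<partial>cyl)) at_top"
  proof (rule integral_dominated_convergence_at_top[where w="\<lambda>p. cmod (f p * \<phi> (fst p))"])
    have i: "integrable cyl (\<lambda>p. f p * \<phi> (fst p))" unfolding \<phi>_def
      by (rule L2_integrable_mult[OF f gaussian_cyl(1)[OF c]])
    thus "integrable cyl (\<lambda>p. cmod (f p * \<phi> (fst p)))" by (rule integrable_norm)
    have [measurable]: "(\<lambda>p. \<phi> (fst p)) \<in> borel_measurable cyl" "(\<lambda>p. cis (- (of_int \<eta> * snd p))) \<in> borel_measurable cyl" by measurable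
    show "(\<lambda>p. trunc R f p * \<phi> (fst p) * cis (- (of_int \<eta> * snd p))) \<in> borel_measurable cyl" for R
      using measurable_trunc[OF fm, of R] by measurable
    show "(\<lambda>p. f p * \<phi> (fst p) * cis (- (of_int \<eta> * snd p))) \<in> borel_measurable cyl" by measurable
    show "AE p in cyl. ((\<lambda>R. trunc R f p * \<phi> (fst p) * cis (- (of_int \<eta> * snd p))) \<longlongrightarrow> f p * \<phi> (fst p) * cis (- (of_int \<eta> * snd p))) at_top"
    proof (intro AE_I2 tendsto_eventually)
      fix p show "\<forall>\<^sub>F R in at_top. trunc R f p * \<phi> (fst p) * cis (- (of_int \<eta> * snd p)) = f p * \<phi> (fst p) * cis (- (of_int \<eta> * snd p))"
        using eventually_ge_at_top[of "\<bar>fst p\<bar>"] by eventually_elim (simp add: trunc_def)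
    qed
    show "\<forall>\<^sub>F R in at_top. AE p in cyl. norm (trunc R f p * \<phi> (fst p) * cis (- (of_int \<eta> * snd p))) \<le> cmod (f p * \<phi> (fst p))"
      by (intro always_eventually allI AE_I2) (simp add: trunc_def norm_mult)
  qed
  have lim2: "((\<lambda>R. \<integral>\<xi>. fourier (trunc R f) (\<xi>, \<eta>) * \<psi> \<xi> \<partial>lborel) \<longlongrightarrow> (\<integral>\<xi>. F (\<xi>, \<eta>) * \<psi> \<xi> \<partial>lborel)) at_top"
  proof (rule Lim_null_comparison[THEN Lim_null[THEN iffD2]])
    show "((\<lambda>R. l2norm freq (\<lambda>q. fourier (trunc R f) q - F q) * l2norm lborel \<psi>) \<longlongrightarrow> 0) at_top"
      using F by (intro tendsto_mult_left_zero) (auto simp: is_fourier_iff L2_tendsto_def)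
    show "\<forall>\<^sub>F R in at_top. norm ((\<integral>\<xi>. fourier (trunc R f) (\<xi>, \<eta>) * \<psi> \<xi> \<partial>lborel) - (\<integral>\<xi>. F (\<xi>, \<eta>) * \<psi> \<xi> \<partial>lborel))
        \<le> l2norm freq (\<lambda>q. fourier (trunc R f) q - F q) * l2norm lborel \<psi>"
    proof (intro always_eventually allI)
      fix R
      have TL: "fourier (trunc R f) \<in> L2 freq" by (intro L2_fourier integrable_trunc L2_trunc f)
      have "(\<integral>\<xi>. fourier (trunc R f) (\<xi>, \<eta>) * \<psi> \<xi> \<partial>lborel) - (\<integral>\<xi>. F (\<xi>, \<eta>) * \<psi> \<xi> \<partial>lborel)
          = (\<integral>\<xi>. (fourier (trunc R f) (\<xi>, \<eta>) - F (\<xi>, \<eta>)) * \<psi> \<xi> \<partial>lborel)"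
        by (subst Bochner_Integration.integral_diff[symmetric])
           (auto intro!: L2_integrable_mult[OF L2_section(1) \<psi>L] TL FL simp: left_diff_distrib)
      also have "norm \<dots> \<le> (\<integral>\<xi>. cmod ((fourier (trunc R f) (\<xi>, \<eta>) - F (\<xi>, \<eta>)) * \<psi> \<xi>) \<partial>lborel)"
        by (rule integral_norm_bound)
      also have "\<dots> \<le> l2norm lborel (\<lambda>\<xi>. fourier (trunc R f) (\<xi>, \<eta>) - F (\<xi>, \<eta>)) * l2norm lborel \<psi>"
        by (rule L2_Cauchy_Schwarz[OF L2_section(1)[OF L2_diff[OF TL FL]] \<psi>L])
      also have "\<dots> \<le> l2norm freq (\<lambda>q. fourier (trunc R f) q - F q) * l2norm lborel \<psi>"
        by (intro mult_right_mono L2_section(2)[OF L2_diff[OF TL FL]] l2norm_nonneg)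
      finally show "norm ((\<integral>\<xi>. fourier (trunc R f) (\<xi>, \<eta>) * \<psi> \<xi> \<partial>lborel) - (\<integral>\<xi>. F (\<xi>, \<eta>) * \<psi> \<xi> \<partial>lborel))
        \<le> l2norm freq (\<lambda>q. fourier (trunc R f) q - F q) * l2norm lborel \<psi>" .
    qed
  qed
  have "(\<integral>\<xi>. F (\<xi>, \<eta>) * \<psi> \<xi> \<partial>lborel) = of_real (sqrt (4 * pi * c)) * (\<integral>p. f p * \<phi> (fst p) * cis (- (of_int \<eta> * snd p)) \<partial>cyl)"
    by (rule tendsto_unique[OF _ lim2]) (use lim1 in \<open>auto simp: RR intro!: tendsto_mult_left\<close>)
  thus ?thesis by (simp add: \<phi>_def \<psi>_def)
qed

text \<open>The same pairing for the inverse Fourier integral, by Fubini's theorem and the orthogonality of the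
characters of the circle.\<close>

lemma gaussian_pairing_inv_fourier:
  assumes F: "integrable freq F" and c: "c > 0"
  shows "of_real (sqrt (4 * pi * c)) * (\<integral>p. inv_fourier F p * of_real (exp (- c * (fst p - a)\<^sup>2)) * cis (- (of_int \<eta> * snd p)) \<partial>cyl)
     = (\<integral>\<xi>. F (\<xi>, \<eta>) * (of_real (exp (- (1 / (4 * c)) * \<xi>\<^sup>2)) * cis (\<xi> * a)) \<partial>lborel)"
proof -
  have Fm[measurable]: "F \<in> borel_measurable freq" using F by auto
  define \<phi> where "\<phi> = (\<lambda>x. complex_of_real (exp (- c * (x - a)\<^sup>2)))"
  define \<psi> where "\<psi> = (\<lambda>\<xi>. complex_of_real (exp (- (1 / (4 * c)) * \<xi>\<^sup>2)) * cis (\<xi> * a))"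
  have \<phi>i: "integrable lborel \<phi>" unfolding \<phi>_def by (rule integrable_of_real[OF gaussian_integral(1)[OF c]])
  have \<phi>c: "integrable cyl (\<lambda>p. \<phi> (fst p))" unfolding \<phi>_def by (rule gaussian_cyl(2)[OF c])
  have \<phi>t: "(\<integral>x. \<phi> x * cis (x * \<xi>) \<partial>lborel) = of_real (sqrt (pi / c)) * \<psi> \<xi>" for \<xi>
  proof -
    have "(\<integral>x. \<phi> x * cis (x * \<xi>) \<partial>lborel) = (\<integral>x. \<phi> (a + 1 * x) * cis ((a + 1 * x) * \<xi>) \<partial>lborel)"
      using lborel_integral_real_affine[of 1 "\<lambda>x. \<phi> x * cis (x * \<xi>)" a] by simp
    also have "\<dots> = (\<integral>x. cis (\<xi> * a) * (of_real (exp (- c * x\<^sup>2)) * cis (x * \<xi>)) \<partial>lborel)"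
    proof (rule Bochner_Integration.integral_cong[OF refl])
      fix x
      have "cis ((a + 1 * x) * \<xi>) = cis (\<xi> * a) * cis (x * \<xi>)" by (simp add: cis_mult algebra_simps)
      thus "\<phi> (a + 1 * x) * cis ((a + 1 * x) * \<xi>) = cis (\<xi> * a) * (of_real (exp (- c * x\<^sup>2)) * cis (x * \<xi>))"
        by (simp add: \<phi>_def)
    qed
    also have "\<dots> = cis (\<xi> * a) * of_real (sqrt (pi / c) * exp (- \<xi>\<^sup>2 / (4 * c)))"
      by (simp only: integral_mult_right_zero gaussian_fourier(2)[OF c])
    also have "\<dots> = of_real (sqrt (pi / c)) * \<psi> \<xi>" by (simp add: \<psi>_def mult_ac)
    finally show ?thesis .
  qed
  let ?f = "\<lambda>z. (\<phi> (fst (fst z)) * F (snd z)) * cis (fst (fst z) * fst (snd z) + snd (fst z) * of_int (snd (snd z)) - of_int \<eta> * snd (fst z))"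
  have fi: "integrable (cyl \<Otimes>\<^sub>M freq) ?f"
  proof (rule integrable_times_cis[OF cyl_freq.integrable_fst_times_snd[OF \<phi>c F]])
    have "(\<lambda>z. of_int \<eta> * snd (fst z)) \<in> borel_measurable (cyl \<Otimes>\<^sub>M freq)"
      by (intro borel_measurable_times measurable_compose[OF measurable_fst measurable_snd_cyl] borel_measurable_const)
    thus "(\<lambda>z. fst (fst z) * fst (snd z) + snd (fst z) * of_int (snd (snd z)) - of_int \<eta> * snd (fst z)) \<in> borel_measurable (cyl \<Otimes>\<^sub>M freq)"
      by (intro borel_measurable_diff measurable_phase_cyl_freq)
  qed
  have e1: "(\<integral>p. inv_fourier F p * \<phi> (fst p) * cis (- (of_int \<eta> * snd p)) \<partial>cyl) = (\<integral>p. (\<integral>q. ?f (p, q) \<partial>freq) \<partial>cyl) / of_real (4 * pi\<^sup>2)"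
  proof -
    have "inv_fourier F p * \<phi> (fst p) * cis (- (of_int \<eta> * snd p)) = (\<integral>q. ?f (p, q) \<partial>freq) / of_real (4 * pi\<^sup>2)" for p
    proof -
      have "(\<integral>q. ?f (p, q) \<partial>freq) = (\<integral>q. (F q * cis (fst p * fst q + snd p * of_int (snd q))) * (\<phi> (fst p) * cis (- (of_int \<eta> * snd p))) \<partial>freq)"
      proof (rule Bochner_Integration.integral_cong[OF refl])
        fix q :: "real \<times> int"
        have "cis (fst p * fst q + snd p * of_int (snd q) - of_int \<eta> * snd p) = cis (fst p * fst q + snd p * of_int (snd q)) * cis (- (of_int \<eta> * snd p))"
          by (simp add: cis_mult)
        thus "?f (p, q) = (F q * cis (fst p * fst q + snd p * of_int (snd q))) * (\<phi> (fst p) * cis (- (of_int \<eta> * snd p)))"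
          by (simp only: fst_conv snd_conv mult_ac)
      qed
      also have "\<dots> = (\<integral>q. F q * cis (fst p * fst q + snd p * of_int (snd q)) \<partial>freq) * (\<phi> (fst p) * cis (- (of_int \<eta> * snd p)))"
        by (rule integral_mult_left_zero)
      finally show ?thesis unfolding inv_fourier_def by simp
    qed
    thus ?thesis by simp
  qed
  define \<omega> where "\<omega> = (\<lambda>q. of_real (sqrt (pi / c)) * \<psi> (fst q) * (if snd q = \<eta> then complex_of_real (2 * pi) else 0))"
  have inner: "(\<integral>p. ?f (p, q) \<partial>cyl) = F q * \<omega> q" for q
  proof -
    have "(\<integral>p. ?f (p, q) \<partial>cyl) = (\<integral>p. F q * ((\<phi> (fst p) * cis (fst p * fst q)) * cis (of_int (snd q - \<eta>) * snd p)) \<partial>cyl)"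
    proof (rule Bochner_Integration.integral_cong[OF refl])
      fix p :: "real \<times> real"
      have "cis (fst p * fst q + snd p * of_int (snd q) - of_int \<eta> * snd p) = cis (fst p * fst q) * cis (of_int (snd q - \<eta>) * snd p)"
        by (simp add: cis_mult algebra_simps)
      thus "?f (p, q) = F q * ((\<phi> (fst p) * cis (fst p * fst q)) * cis (of_int (snd q - \<eta>) * snd p))"
        by (simp only: fst_conv snd_conv mult_ac)
    qed
    also have "\<dots> = F q * (\<integral>p. (\<phi> (fst p) * cis (fst p * fst q)) * cis (of_int (snd q - \<eta>) * snd p) \<partial>cyl)"
      by (rule integral_mult_right_zero)
    also have "(\<integral>p. (\<phi> (fst p) * cis (fst p * fst q)) * cis (of_int (snd q - \<eta>) * snd p) \<partial>cyl)
        = (\<integral>x. (\<integral>y. (\<phi> x * cis (x * fst q)) * cis (of_int (snd q - \<eta>) * y) \<partial>tor) \<partial>lborel)"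
    proof -
      have a: "integrable lborel (\<lambda>x. \<phi> x * cis (x * fst q))" by (rule integrable_times_cis[OF \<phi>i]) simp
      have b: "integrable tor (\<lambda>y. cis (of_int (snd q - \<eta>) * y))" by (rule tor.integrable_const_bound[where B=1]) auto
      from torus_pair.integral_fst'[OF torus_pair.integrable_fst_times_snd[OF a b]] show ?thesis by (simp add: cyl_eq)
    qed
    also have "\<dots> = (of_real (sqrt (pi / c)) * \<psi> (fst q)) * (if snd q = \<eta> then of_real (2 * pi) else 0)"
      by (simp only: integral_mult_right_zero integral_mult_left_zero integral_cis_tor \<phi>t right_minus_eq)
    finally show ?thesis by (simp add: \<omega>_def)
  qed
  have fi': "integrable (cyl \<Otimes>\<^sub>M freq) (case_prod (\<lambda>p q. ?f (p, q)))"
    using fi by (simp add: split_def)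
  have gi: "integrable freq (\<lambda>q. F q * \<omega> q)"
    using cyl_freq.integrable_snd[OF fi'] by (simp only: inner)
  have "(\<integral>p. (\<integral>q. ?f (p, q) \<partial>freq) \<partial>cyl) = (\<integral>q. (\<integral>p. ?f (p, q) \<partial>cyl) \<partial>freq)"
    by (rule cyl_freq.Fubini_integral[OF fi', symmetric])
  also have "\<dots> = (\<integral>q. F q * \<omega> q \<partial>freq)"
    by (simp only: inner)
  also have "\<dots> = (\<integral>\<xi>. (\<integral>k. F (\<xi>, k) * \<omega> (\<xi>, k) \<partial>count_space UNIV) \<partial>lborel)"
    using freq_pair.integral_fst'[OF gi[unfolded freq_def]] by (simp only: freq_def fst_conv snd_conv)
  also have "\<dots> = (\<integral>\<xi>. of_real (2 * pi * sqrt (pi / c)) * (F (\<xi>, \<eta>) * \<psi> \<xi>) \<partial>lborel)"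
  proof (rule Bochner_Integration.integral_cong[OF refl])
    fix \<xi>
    have "(\<integral>k. F (\<xi>, k) * \<omega> (\<xi>, k) \<partial>count_space UNIV)
       = F (\<xi>, \<eta>) * \<omega> (\<xi>, \<eta>)"
      by (rule integral_count_space_single) (simp add: \<omega>_def)
    thus "(\<integral>k. F (\<xi>, k) * \<omega> (\<xi>, k) \<partial>count_space UNIV) = of_real (2 * pi * sqrt (pi / c)) * (F (\<xi>, \<eta>) * \<psi> \<xi>)"
      by (simp add: \<omega>_def mult_ac)
  qed
  also have "\<dots> = of_real (2 * pi * sqrt (pi / c)) * (\<integral>\<xi>. F (\<xi>, \<eta>) * \<psi> \<xi> \<partial>lborel)" by (rule integral_mult_right_zero)
  finally have e2: "(\<integral>p. (\<integral>q. ?f (p, q) \<partial>freq) \<partial>cyl) = \<dots>" .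
  have e3: "sqrt (4 * pi * c) * (2 * pi * sqrt (pi / c)) = 4 * pi\<^sup>2"
  proof -
    have "sqrt (4 * pi * c) * sqrt (pi / c) = sqrt ((2 * pi)\<^sup>2)"
      using c by (simp add: power2_eq_square flip: real_sqrt_mult)
    hence "sqrt (4 * pi * c) * sqrt (pi / c) = 2 * pi" by (simp only: real_sqrt_abs) simp
    thus ?thesis by (simp add: power2_eq_square mult_ac)
  qed
  have "of_real (sqrt (4 * pi * c)) * (\<integral>p. inv_fourier F p * \<phi> (fst p) * cis (- (of_int \<eta> * snd p)) \<partial>cyl)
     = of_real (sqrt (4 * pi * c) * (2 * pi * sqrt (pi / c))) / of_real (4 * pi\<^sup>2) * (\<integral>\<xi>. F (\<xi>, \<eta>) * \<psi> \<xi> \<partial>lborel)"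
    unfolding e1 e2 by (simp add: mult_ac)
  thus ?thesis unfolding e3 by (simp add: \<phi>_def \<psi>_def)
qed

text \<open>By the two preceding lemmas \<open>f\<close> and \<open>inv_fourier F\<close> have the same pairings with every Gaussian in \<open>x\<close>
times a character in \<open>y\<close>. Uniqueness on the line shows that, for each of the countably many \<eta>, the
difference has \<open>ycoeff\<close> zero at almost every \<open>x\<close>; uniqueness on the circle finishes the proof.\<close>

theorem fourier_inversion:
  assumes fF: "is_fourier f F" and F: "integrable freq F"
  shows "AE p in cyl. f p = inv_fourier F p"
proof -
  have f: "f \<in> L2 cyl" using is_fourier_L2[OF fF] by auto
  have fm[measurable]: "f \<in> borel_measurable cyl" using f by (rule L2_measurable)
  have Fm[measurable]: "F \<in> borel_measurable freq" using F by auto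
  define h where "h = (\<lambda>p. f p - inv_fourier F p)"
  have hm[measurable]: "h \<in> borel_measurable cyl" unfolding h_def using measurable_inv_fourier[OF Fm] by measurable
  define \<phi> where "\<phi> = (\<lambda>c a x. complex_of_real (exp (- c * (x - a)\<^sup>2)))"
  have i1: "integrable cyl (\<lambda>p. f p * \<phi> c a (fst p))" if "c > 0" for c a
    unfolding \<phi>_def by (rule L2_integrable_mult[OF f gaussian_cyl(1)[OF that]])
  have i2: "integrable cyl (\<lambda>p. inv_fourier F p * \<phi> c a (fst p))" if "c > 0" for c a
    using integrable_times_bounded[OF gaussian_cyl(2)[OF that] measurable_inv_fourier[OF Fm] cmod_inv_fourier_le, of a]
    by (simp add: \<phi>_def mult.commute)
  have ih: "integrable cyl (\<lambda>p. h p * \<phi> c a (fst p))" if "c > 0" for c a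
    using Bochner_Integration.integrable_diff[OF i1[OF that] i2[OF that]] by (simp add: h_def left_diff_distrib)
  have zero: "(\<integral>p. h p * \<phi> c a (fst p) * cis (- (of_int \<eta> * snd p)) \<partial>cyl) = 0" if c: "c > 0" for c a and \<eta> :: int
  proof -
    have "(\<integral>p. h p * \<phi> c a (fst p) * cis (- (of_int \<eta> * snd p)) \<partial>cyl)
        = (\<integral>p. f p * \<phi> c a (fst p) * cis (- (of_int \<eta> * snd p)) \<partial>cyl) - (\<integral>p. inv_fourier F p * \<phi> c a (fst p) * cis (- (of_int \<eta> * snd p)) \<partial>cyl)"
      unfolding h_def left_diff_distrib
      by (rule Bochner_Integration.integral_diff; rule integrable_times_cis; (rule i1[OF c] i2[OF c] | measurable))
    moreover have "of_real (sqrt (4 * pi * c)) * (\<integral>p. f p * \<phi> c a (fst p) * cis (- (of_int \<eta> * snd p)) \<partial>cyl)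
       = of_real (sqrt (4 * pi * c)) * (\<integral>p. inv_fourier F p * \<phi> c a (fst p) * cis (- (of_int \<eta> * snd p)) \<partial>cyl)"
      unfolding \<phi>_def gaussian_pairing_is_fourier[OF fF c] gaussian_pairing_inv_fourier[OF F c] ..
    moreover have "complex_of_real (sqrt (4 * pi * c)) \<noteq> 0" using c by simp
    ultimately show ?thesis by simp
  qed
  have yc: "ycoeff (\<lambda>p. h p * \<phi> c a (fst p)) \<eta> x = ycoeff h \<eta> x * \<phi> c a x" for c a \<eta> x
  proof -
    have "(\<lambda>y. h (x, y) * \<phi> c a x * cis (- (of_int \<eta> * y))) = (\<lambda>y. h (x, y) * cis (- (of_int \<eta> * y)) * \<phi> c a x)"
      by (simp add: mult_ac)
    thus ?thesis unfolding ycoeff_def by simp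
  qed
  have "AE x in lborel. ycoeff h \<eta> x = 0" for \<eta>
  proof (rule gaussian_pairings_zero_imp_AE_zero)
    fix a c :: real assume c: "c > 0"
    show "integrable lborel (\<lambda>x. ycoeff h \<eta> x * of_real (exp (- c * (x - a)\<^sup>2)))"
      using integrable_ycoeff[OF ih[OF c, of a], of \<eta>] unfolding yc[abs_def] by (simp add: \<phi>_def)
    have "(\<integral>x. ycoeff h \<eta> x * \<phi> c a x \<partial>lborel) = 0"
      using cyl_integral_ycoeff[OF ih[OF c, of a], of "\<lambda>_. 1" 1 \<eta>] zero[OF c, of a \<eta>] by (simp add: yc)
    thus "(\<integral>x. ycoeff h \<eta> x * of_real (exp (- c * (x - a)\<^sup>2)) \<partial>lborel) = 0" by (simp add: \<phi>_def)
  qed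
  hence "AE x in lborel. \<forall>\<eta>. ycoeff h \<eta> x = 0" by (simp add: AE_all_countable)
  moreover have "AE x in lborel. integrable tor (\<lambda>y. h (x, y))"
  proof -
    have "AE x in lborel. integrable tor (\<lambda>y. h (x, y) * \<phi> 1 0 x)"
      using torus_pair.AE_integrable_fst'[OF ih[of 1 0, unfolded cyl_eq]] by simp
    thus ?thesis
    proof eventually_elim
      case (elim x)
      have "integrable tor (\<lambda>y. (h (x, y) * \<phi> 1 0 x) * inverse (\<phi> 1 0 x))"
        by (rule integrable_mult_left[OF elim])
      moreover have "(\<lambda>y. (h (x, y) * \<phi> 1 0 x) * inverse (\<phi> 1 0 x)) = (\<lambda>y. h (x, y))" by (simp add: \<phi>_def mult.assoc)
      ultimately show ?case by (simp only:)
    qed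
  qed
  ultimately have "AE x in lborel. AE y in tor. h (x, y) = 0"
  proof eventually_elim
    case (elim x)
    have "(\<integral>y. h (x, y) * cis (of_int \<eta> * y) \<partial>tor) = 0" for \<eta> :: int
      using elim(1)[rule_format, of "- \<eta>"] by (simp add: ycoeff_def)
    thus ?case by (rule fourier_coefficients_zero_imp_AE_zero[OF elim(2)])
  qed
  hence "AE p in lborel \<Otimes>\<^sub>M tor. h p = 0"
  proof (rule torus_pair.AE_pair_measure[rotated])
    show "{p \<in> space (lborel \<Otimes>\<^sub>M tor). h p = 0} \<in> sets (lborel \<Otimes>\<^sub>M tor)"
      using hm unfolding cyl_eq by measurable
  qed
  thus ?thesis unfolding cyl_eq[symmetric] h_def by eventually_elim simp
qed

section \<open>Differentiation under the integral sign\<close>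

lemma cmod_cis_approx:
  "cmod (cis t - 1) \<le> \<bar>t\<bar>" "cmod (cis t - 1 - \<i> * of_real t) \<le> t\<^sup>2 / 2"
  using iexp_approx1[of t 0] iexp_approx1[of t 1]
  by (simp_all add: cis_conv_exp numeral_2_eq_2 diff_diff_eq)

text \<open>Dominated convergence: the remainder of the difference quotient is at most \<open>2 |h F|\<close> and tends to zero
pointwise. It serves for the derivative in \<open>x\<close> of an inverse Fourier integral and for the derivative in
\<xi> of a Fourier integral.\<close>

lemma has_vector_derivative_integral_cis:
  fixes F :: "'a \<Rightarrow> complex" and h k :: "'a \<Rightarrow> real"
  assumes F: "integrable M F" and Fh: "integrable M (\<lambda>q. F q * of_real (h q))"
    and h[measurable]: "h \<in> borel_measurable M" and k[measurable]: "k \<in> borel_measurable M"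
  shows "((\<lambda>x. \<integral>q. F q * cis (x * h q + k q) \<partial>M) has_vector_derivative
          (\<integral>q. (F q * of_real (h q)) * (\<i> * cis (x * h q + k q)) \<partial>M)) (at x)"
proof -
  have [measurable]: "F \<in> borel_measurable M" using F by auto
  let ?e = "\<lambda>z q. (cis (z * h q) - 1 - \<i> * of_real (z * h q))"
  define I where "I = (\<lambda>x. \<integral>q. F q * cis (x * h q + k q) \<partial>M)"
  define D where "D = (\<integral>q. (F q * of_real (h q)) * (\<i> * cis (x * h q + k q)) \<partial>M)"
  have iF: "integrable M (\<lambda>q. F q * cis (x * h q + k q))" for x by (rule integrable_times_cis[OF F]) simp
  have iD: "integrable M (\<lambda>q. (F q * of_real (h q)) * (\<i> * cis (x * h q + k q)))"
    by (rule integrable_times_bounded[OF Fh, where C=1]) (auto simp: norm_mult)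
  define r where "r = (\<lambda>z q. cmod (F q * (?e z q)) / \<bar>z\<bar>)"
  have r0: "r z q \<ge> 0" for z q by (simp add: r_def)
  have rb1: "r z q \<le> 2 * cmod (F q * of_real (h q))" for z q
  proof (cases "z = 0")
    case False
    have "cmod (?e z q) \<le> cmod (cis (z * h q) - 1) + cmod (\<i> * of_real (z * h q))"
      by (rule norm_triangle_ineq4)
    also have "\<dots> \<le> \<bar>z * h q\<bar> + \<bar>z * h q\<bar>" by (intro add_mono cmod_cis_approx) (simp add: norm_mult)
    finally have "cmod (?e z q) \<le> 2 * (\<bar>z\<bar> * \<bar>h q\<bar>)" by (simp add: abs_mult)
    hence "cmod (F q) * cmod (?e z q) \<le> cmod (F q) * (2 * (\<bar>z\<bar> * \<bar>h q\<bar>))"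
      by (intro mult_left_mono) auto
    thus ?thesis using False by (simp add: r_def norm_mult divide_le_eq mult_ac)
  qed (simp add: r_def)
  have rb2: "r z q \<le> \<bar>z\<bar> * (cmod (F q) * (h q)\<^sup>2 / 2)" for z q
  proof (cases "z = 0")
    case False
    have "cmod (F q) * cmod (?e z q) \<le> cmod (F q) * ((z * h q)\<^sup>2 / 2)"
      by (intro mult_left_mono cmod_cis_approx) auto
    also have "\<dots> = (\<bar>z\<bar> * (cmod (F q) * (h q)\<^sup>2 / 2)) * \<bar>z\<bar>"
      by (simp add: power_mult_distrib power2_eq_square mult_ac)
    finally have "cmod (F q) * cmod (?e z q) \<le> (\<bar>z\<bar> * (cmod (F q) * (h q)\<^sup>2 / 2)) * \<bar>z\<bar>" .
    moreover have "\<bar>z\<bar> > 0" using False by simp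
    ultimately show ?thesis unfolding r_def norm_mult by (simp only: pos_divide_le_eq)
  qed (simp add: r_def)
  have key: "norm (I (x + z) - I x - z *\<^sub>R D) / norm z \<le> (\<integral>q. r z q \<partial>M)" for z
  proof -
    have "I (x + z) - I x - z *\<^sub>R D = (\<integral>q. F q * cis ((x + z) * h q + k q) - F q * cis (x * h q + k q)
            - z *\<^sub>R ((F q * of_real (h q)) * (\<i> * cis (x * h q + k q))) \<partial>M)"
      unfolding I_def D_def using iF iD by simp
    also have "\<dots> = (\<integral>q. F q * (?e z q) * cis (x * h q + k q) \<partial>M)"
    proof (rule Bochner_Integration.integral_cong[OF refl])
      fix q
      have "cis ((x + z) * h q + k q) = cis (z * h q) * cis (x * h q + k q)" by (simp add: cis_mult algebra_simps)
      thus "F q * cis ((x + z) * h q + k q) - F q * cis (x * h q + k q) - z *\<^sub>R ((F q * of_real (h q)) * (\<i> * cis (x * h q + k q)))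
        = F q * (?e z q) * cis (x * h q + k q)"
        by (simp only: scaleR_conv_of_real of_real_mult) (simp add: algebra_simps)
    qed
    finally have e: "I (x + z) - I x - z *\<^sub>R D = (\<integral>q. F q * (?e z q) * cis (x * h q + k q) \<partial>M)" .
    have "norm (I (x + z) - I x - z *\<^sub>R D) \<le> (\<integral>q. cmod (F q * (?e z q) * cis (x * h q + k q)) \<partial>M)"
      unfolding e by (rule integral_norm_bound)
    also have "\<dots> = (\<integral>q. cmod (F q * (?e z q)) \<partial>M)" by (simp add: norm_mult)
    finally have "norm (I (x + z) - I x - z *\<^sub>R D) / \<bar>z\<bar> \<le> (\<integral>q. cmod (F q * (?e z q)) \<partial>M) / \<bar>z\<bar>"
      by (rule divide_right_mono) simp
    thus ?thesis unfolding r_def by simp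
  qed
  have "((\<lambda>z. norm (I (x + z) - I x - z *\<^sub>R D) / norm z) \<longlongrightarrow> 0) (at 0)"
  proof (rule tendsto_sandwich[OF _ _ tendsto_const])
    show "((\<lambda>z. \<integral>q. r z q \<partial>M) \<longlongrightarrow> 0) (at 0)"
      unfolding tendsto_at_iff_sequentially
    proof (intro allI impI, unfold comp_def)
      fix X :: "nat \<Rightarrow> real" assume X: "\<forall>i. X i \<in> UNIV - {0}" "X \<longlonglongrightarrow> 0"
      have "(\<lambda>i. \<integral>q. r (X i) q \<partial>M) \<longlonglongrightarrow> (\<integral>q. 0 \<partial>M)"
      proof (rule integral_dominated_convergence[where w="\<lambda>q. 2 * cmod (F q * of_real (h q))"])
        show "AE q in M. (\<lambda>i. r (X i) q) \<longlonglongrightarrow> 0"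
        proof (rule AE_I2, rule tendsto_sandwich[OF _ _ tendsto_const])
          fix q
          have "(\<lambda>i. \<bar>X i\<bar> * (cmod (F q) * (h q)\<^sup>2 / 2)) \<longlonglongrightarrow> \<bar>0\<bar> * (cmod (F q) * (h q)\<^sup>2 / 2)"
            by (intro tendsto_mult tendsto_const tendsto_rabs X(2))
          thus "(\<lambda>i. \<bar>X i\<bar> * (cmod (F q) * (h q)\<^sup>2 / 2)) \<longlonglongrightarrow> 0" by simp
          show "\<forall>\<^sub>F i in sequentially. 0 \<le> r (X i) q" by (rule always_eventually) (rule allI, rule r0)
          show "\<forall>\<^sub>F i in sequentially. r (X i) q \<le> \<bar>X i\<bar> * (cmod (F q) * (h q)\<^sup>2 / 2)"
            by (rule always_eventually) (rule allI, rule rb2)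
        qed
        show "AE q in M. norm (r (X i) q) \<le> 2 * cmod (F q * of_real (h q))" for i
          by (rule AE_I2) (simp only: real_norm_def abs_of_nonneg[OF r0] rb1)
        show "integrable M (\<lambda>q. 2 * cmod (F q * of_real (h q)))" by (intro integrable_mult_right integrable_norm Fh)
        show "(\<lambda>q. r (X i) q) \<in> borel_measurable M" for i unfolding r_def by measurable
      qed simp
      thus "(\<lambda>i. \<integral>q. r (X i) q \<partial>M) \<longlonglongrightarrow> 0" by simp
    qed
    show "\<forall>\<^sub>F z in at 0. 0 \<le> norm (I (x + z) - I x - z *\<^sub>R D) / norm z" by (rule always_eventually) simp
    show "\<forall>\<^sub>F z in at 0. norm (I (x + z) - I x - z *\<^sub>R D) / norm z \<le> (\<integral>q. r z q \<partial>M)"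
      by (rule always_eventually) (rule allI, rule key)
  qed
  hence "(I has_derivative (\<lambda>z. z *\<^sub>R D)) (at x)"
    unfolding has_derivative_at by (simp add: bounded_linear_scaleR_left)
  thus ?thesis unfolding has_vector_derivative_def I_def D_def .
qed

text \<open>The integral of \<open>G'\<close> is the integral over \<open>x\<close> of \<open>G (x + 1) - G x\<close>, and the two terms cancel by translation invariance.\<close>

lemma integral_derivative_zero:
  fixes G G' :: "real \<Rightarrow> complex"
  assumes G: "integrable lborel G" and G': "integrable lborel G'"
    and d: "\<And>x. (G has_vector_derivative G' x) (at x)"
  shows "(\<integral>x. G' x \<partial>lborel) = 0"
proof -
  have G'm[measurable]: "G' \<in> borel_measurable borel" using borel_measurable_integrable[OF G'] by simp
  \<comment> \<open>Averaging the translates of \<open>G'\<close> over \<open>r \<in> [0, 1]\<close> does not change the integral, and for fixed \<open>x\<close> the average is \<open>G (x + 1) - G x\<close>.\<close>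
  define f where "f = (\<lambda>(r, x). indicator {0..1} r *\<^sub>R G' (x + r))"
  have fm: "f \<in> borel_measurable (lborel \<Otimes>\<^sub>M lborel)" unfolding f_def split_def by measurable
  have shift: "integrable lborel (\<lambda>x. G' (x + r))" "(\<integral>x. G' (x + r) \<partial>lborel) = (\<integral>x. G' x \<partial>lborel)"
      "(\<integral>x. cmod (G' (x + r)) \<partial>lborel) = (\<integral>x. cmod (G' x) \<partial>lborel)" for r
    using lborel_integrable_real_affine[OF G', of 1 r] lborel_integral_real_affine[of 1 G' r]
      lborel_integral_real_affine[of 1 "\<lambda>x. cmod (G' x)" r] by (simp_all add: add.commute)
  have fi: "integrable (lborel \<Otimes>\<^sub>M lborel) f"
  proof (rule lborel_pair.Fubini_integrable[OF fm])
    have "(\<integral>x. norm (f (r, x)) \<partial>lborel) = indicator {0..1} r * (\<integral>x. cmod (G' x) \<partial>lborel)" for r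
      by (simp add: f_def shift)
    moreover have "integrable lborel (\<lambda>r. indicator {0..1::real} r * (\<integral>x. cmod (G' x) \<partial>lborel))"
      by (intro integrable_mult_left integrable_real_indicator) auto
    ultimately show "integrable lborel (\<lambda>r. \<integral>x. norm (f (r, x)) \<partial>lborel)" by simp
    show "AE r in lborel. integrable lborel (\<lambda>x. f (r, x))" using shift(1) by (simp add: f_def)
  qed
  have inner: "(\<integral>r. f (r, x) \<partial>lborel) = G (x + 1) - G x" for x
  proof -
    have "integrable lborel (\<lambda>r. G' (x + r))" using lborel_integrable_real_affine[OF G', of 1 x] by simp
    hence s: "set_integrable lborel {0..1} (\<lambda>r. G' (x + r))"
      unfolding set_integrable_def by (intro integrable_mult_indicator) auto
    have "((\<lambda>r. G' (x + r)) has_integral G (x + 1) - G (x + 0)) {0..1}"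
    proof (rule fundamental_theorem_of_calculus)
      fix r :: real
      have "((G \<circ> (\<lambda>r. x + r)) has_vector_derivative 1 *\<^sub>R G' (x + r)) (at r)"
        by (rule vector_diff_chain_at) (auto intro!: derivative_eq_intros d)
      thus "((\<lambda>r. G (x + r)) has_vector_derivative G' (x + r)) (at r within {0..1})"
        by (simp add: comp_def has_vector_derivative_at_within)
    qed simp
    thus ?thesis using set_borel_integral_eq_integral(2)[OF s]
      by (simp add: f_def set_lebesgue_integral_def integral_unique)
  qed
  have "(\<integral>x. (\<integral>r. f (r, x) \<partial>lborel) \<partial>lborel) = (\<integral>r. (\<integral>x. f (r, x) \<partial>lborel) \<partial>lborel)"
    using lborel_pair.Fubini_integral[of "\<lambda>r x. f (r, x)"] fi by simp
  also have "\<dots> = (\<integral>r. indicator {0..1::real} r *\<^sub>R (\<integral>x. G' x \<partial>lborel) \<partial>lborel)"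
    by (simp only: f_def prod.case integral_scaleR_right shift)
  also have "\<dots> = (\<integral>r. (indicator {0..1::real} r :: real) \<partial>lborel) *\<^sub>R (\<integral>x. G' x \<partial>lborel)"
    by (rule integral_scaleR_left) simp
  also have "\<dots> = (\<integral>x. G' x \<partial>lborel)" by simp
  finally have "(\<integral>x. G' x \<partial>lborel) = (\<integral>x. G (x + 1) - G x \<partial>lborel)" unfolding inner ..
  also have "\<dots> = 0"
    using G lborel_integrable_real_affine[OF G, of 1 1] lborel_integral_real_affine[of 1 G 1] by (simp add: add.commute)
  finally show ?thesis .
qed

section \<open>Anisotropic Sobolev functions\<close>

text \<open>By \<open>1 / (1 + m\<^sup>2) \<le> 2 / (m (m + 1))\<close> the sum is dominated by a telescoping one.\<close>

lemma sum_int_inverse_square_le: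
  "(\<Sum>\<eta>\<in>{- int n..int n}. 1 / (1 + (real_of_int \<eta>)\<^sup>2)) \<le> 5 - 4 / real (n + 1)"
proof (induction n)
  case (Suc n)
  have "{- int (Suc n)..int (Suc n)} = insert (- int (Suc n)) (insert (int (Suc n)) {- int n..int n})" by auto
  hence "(\<Sum>\<eta>\<in>{- int (Suc n)..int (Suc n)}. 1 / (1 + (real_of_int \<eta>)\<^sup>2))
     = 2 * (1 / (1 + (real (n + 1))\<^sup>2)) + (\<Sum>\<eta>\<in>{- int n..int n}. 1 / (1 + (real_of_int \<eta>)\<^sup>2))"
  proof -
    assume e: "{- int (Suc n)..int (Suc n)} = insert (- int (Suc n)) (insert (int (Suc n)) {- int n..int n})"
    have "(- 1 - real n)\<^sup>2 = (1 + real n)\<^sup>2" by (simp add: power2_eq_square algebra_simps)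
    thus ?thesis unfolding e by simp
  qed
  also have "2 * (1 / (1 + (real (n + 1))\<^sup>2)) \<le> 4 / (real (n + 1) * real (n + 2))"
  proof -
    define m where "m = real n + 1"
    have m: "m \<ge> 1" by (simp add: m_def)
    have "m * (m + 1) \<le> 2 * (1 + m\<^sup>2)" using m sum_squares_bound[of m 1] by (simp add: power2_eq_square algebra_simps)
    hence "2 * (1 / (1 + m\<^sup>2)) \<le> 4 / (m * (m + 1))" using m by (simp add: field_simps add_pos_nonneg)
    thus ?thesis by (simp add: m_def add.commute)
  qed
  also have "4 / (real (n + 1) * real (n + 2)) = 4 / real (n + 1) - 4 / real (n + 2)"
    by (simp add: field_simps)
  finally show ?case using Suc.IH by simp
qed simp

definition freq_weight :: "real \<times> int \<Rightarrow> real" where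
  "freq_weight q = 1 / ((1 + (fst q)\<^sup>2) * (1 + (real_of_int (snd q))\<^sup>2))"

lemma nn_integral_freq_weight: "(\<integral>\<^sup>+q. ennreal (freq_weight q) \<partial>freq) < \<infinity>"
proof -
  have m: "(\<lambda>q. ennreal (freq_weight q)) \<in> borel_measurable freq" unfolding freq_weight_def by measurable
  have "integrable lborel (\<lambda>x::real. inverse (1 + x\<^sup>2))"
    using integrable_inverse_1_plus_square by (simp add: set_integrable_def)
  hence fin: "(\<integral>\<^sup>+x. ennreal (1 / (1 + x\<^sup>2)) \<partial>lborel) < \<infinity>"
    by (simp add: integrable_iff_bounded divide_inverse)
  have "(\<integral>\<^sup>+q. ennreal (freq_weight q) \<partial>freq) = (\<integral>\<^sup>+\<eta>. (\<integral>\<^sup>+\<xi>. ennreal (1 / (1 + (real_of_int \<eta>)\<^sup>2)) * ennreal (1 / (1 + \<xi>\<^sup>2)) \<partial>lborel) \<partial>count_space UNIV)"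
  proof -
    have "ennreal (freq_weight (\<xi>, \<eta>)) = ennreal (1 / (1 + (real_of_int \<eta>)\<^sup>2)) * ennreal (1 / (1 + \<xi>\<^sup>2))" for \<xi> \<eta>
      by (simp add: freq_weight_def mult.commute flip: ennreal_mult)
    thus ?thesis unfolding nn_integral_freq[OF m] by (simp only:)
  qed
  also have "\<dots> = (\<integral>\<^sup>+\<eta>. ennreal (1 / (1 + (real_of_int \<eta>)\<^sup>2)) \<partial>count_space UNIV) * (\<integral>\<^sup>+x. ennreal (1 / (1 + x\<^sup>2)) \<partial>lborel)"
    by (simp add: nn_integral_cmult nn_integral_multc)
  also have "\<dots> < \<infinity>"
  proof -
    have "(\<integral>\<^sup>+\<eta>. ennreal (1 / (1 + (real_of_int \<eta>)\<^sup>2)) \<partial>count_space UNIV) \<le> ennreal 5"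
    proof (rule nn_integral_int_le)
      fix n :: nat
      have "(\<Sum>\<eta>\<in>{- int n..int n}. 1 / (1 + (real_of_int \<eta>)\<^sup>2)) \<le> 5"
        by (rule order_trans[OF sum_int_inverse_square_le]) simp
      thus "(\<Sum>\<eta>\<in>{- int n..int n}. ennreal (1 / (1 + (real_of_int \<eta>)\<^sup>2))) \<le> ennreal 5"
        by (subst sum_ennreal) (auto intro: ennreal_leI simp del: ennreal_numeral)
    qed
    hence "(\<integral>\<^sup>+\<eta>. ennreal (1 / (1 + (real_of_int \<eta>)\<^sup>2)) \<partial>count_space UNIV) < \<infinity>" by (rule le_less_trans) simp
    thus ?thesis using fin by (simp add: ennreal_mult_less_top)
  qed
  finally show ?thesis .
qed

lemma bracket_ge_1: "bracket x \<ge> 1" and bracket_square: "(bracket x)\<^sup>2 = 1 + x\<^sup>2"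
  unfolding bracket_def by (auto simp: powr_half_sqrt)

lemma sobolev_mult:
  assumes "f \<in> sobolev s1 s2"
  shows "is_mult (Jx_symbol s1) f (mult (Jx_symbol s1) f)" "is_mult (Jy_symbol s2) f (mult (Jy_symbol s2) f)"
  using assms unfolding sobolev_def mult_def by (auto intro: someI[of "is_mult (Jx_symbol s1) f"] someI[of "is_mult (Jy_symbol s2) f"])

text \<open>With \<open>a = \<langle>\<xi>\<rangle>\<close> and \<open>b = \<langle>\<eta>\<rangle>\<close> write \<open>a |F| = (1 / (a b)) (a\<^sup>2 b |F|)\<close>. The first factor is square integrable
on \<open>\<real> \<times> \<int>\<close>, and \<open>a^4 b\<^sup>2 \<le> a^(2 s1) + b^(2 s2)\<close> bounds the second, through Bessel's
inequality, by the Sobolev norm.\<close>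

lemma sobolev_decay:
  assumes f: "f \<in> sobolev s1 s2" and fF: "is_fourier f F" and s: "s1 \<ge> 6" "s2 \<ge> 3"
  shows "(\<integral>\<^sup>+q. ennreal (bracket (fst q) * cmod (F q)) \<partial>freq)
    \<le> (\<integral>\<^sup>+q. ennreal (freq_weight q) \<partial>freq) + ennreal (8 * pi\<^sup>2 * (sobolev_norm s1 s2 f)\<^sup>2)"
proof -
  have Fm[measurable]: "F \<in> borel_measurable freq" using is_fourier_L2(2)[OF fF] by (rule L2_measurable)
  define g1 where "g1 = mult (Jx_symbol s1) f"
  define g2 where "g2 = mult (Jy_symbol s2) f"
  obtain F1 where F1: "is_fourier f F1" "is_fourier g1 (\<lambda>(\<xi>, \<eta>). Jx_symbol s1 \<xi> \<eta> * F1 (\<xi>, \<eta>))"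
    using sobolev_mult(1)[OF f] unfolding is_mult_def g1_def by auto
  obtain F2 where F2: "is_fourier f F2" "is_fourier g2 (\<lambda>(\<xi>, \<eta>). Jy_symbol s2 \<xi> \<eta> * F2 (\<xi>, \<eta>))"
    using sobolev_mult(2)[OF f] unfolding is_mult_def g2_def by auto
  have AE1: "AE q in freq. F q = F1 q" by (rule is_fourier_unique[OF fF F1(1)])
  have AE2: "AE q in freq. F q = F2 q" by (rule is_fourier_unique[OF fF F2(1)])
  have Fm1[measurable]: "F1 \<in> borel_measurable freq" using is_fourier_L2(2)[OF F1(1)] by (rule L2_measurable)
  have Fm2[measurable]: "F2 \<in> borel_measurable freq" using is_fourier_L2(2)[OF F2(1)] by (rule L2_measurable)
  define W1 where "W1 = (\<lambda>q. case q of (\<xi>, \<eta>) \<Rightarrow> Jx_symbol s1 \<xi> \<eta> * F1 (\<xi>, \<eta>))"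
  define W2 where "W2 = (\<lambda>q. case q of (\<xi>, \<eta>) \<Rightarrow> Jy_symbol s2 \<xi> \<eta> * F2 (\<xi>, \<eta>))"
  have W1m[measurable]: "W1 \<in> borel_measurable freq" and W2m[measurable]: "W2 \<in> borel_measurable freq"
    using is_fourier_L2(2)[OF F1(2)] is_fourier_L2(2)[OF F2(2)] unfolding W1_def W2_def by (auto dest: L2_measurable)
  have wm[measurable]: "freq_weight \<in> borel_measurable freq" unfolding freq_weight_def[abs_def] by measurable
  have pt: "AE q in freq. ennreal (bracket (fst q) * cmod (F q)) \<le> ennreal (freq_weight q) + (ennreal ((cmod (W1 q))\<^sup>2) + ennreal ((cmod (W2 q))\<^sup>2))"
    using AE1 AE2
  proof eventually_elim
    case (elim q)
    define a where "a = bracket (fst q)"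
    define b where "b = bracket (of_int (snd q))"
    have ab: "a \<ge> 1" "b \<ge> 1" by (auto simp: a_def b_def bracket_ge_1)
    have w1: "(cmod (W1 q))\<^sup>2 = (a powr s1)\<^sup>2 * (cmod (F q))\<^sup>2"
      using elim by (cases q) (simp add: W1_def Jx_symbol_def a_def norm_mult power_mult_distrib)
    have w2: "(cmod (W2 q))\<^sup>2 = (b powr s2)\<^sup>2 * (cmod (F q))\<^sup>2"
      using elim by (cases q) (simp add: W2_def Jy_symbol_def b_def norm_mult power_mult_distrib)
    have "a powr 6 \<le> a powr s1" "b powr 3 \<le> b powr s2" by (rule powr_mono; use ab s in simp)+
    moreover have "a ^ 6 = a powr 6" "b ^ 3 = b powr 3" using ab by (simp_all add: powr_numeral)
    ultimately have p1: "a ^ 6 \<le> a powr s1" "b ^ 3 \<le> b powr s2" by (simp_all only:)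
    have "a ^ 4 * b\<^sup>2 \<le> a ^ 6 * b ^ 3" using ab by (intro mult_mono power_increasing) auto
    also have "\<dots> \<le> (a powr s1) * (b powr s2)" using ab p1 by (intro mult_mono) auto
    also have "\<dots> \<le> (a powr s1)\<^sup>2 + (b powr s2)\<^sup>2"
    proof -
      have "(a powr s1) * (b powr s2) \<le> 2 * (a powr s1) * (b powr s2)" by simp
      also have "\<dots> \<le> (a powr s1)\<^sup>2 + (b powr s2)\<^sup>2" by (rule sum_squares_bound)
      finally show ?thesis .
    qed
    finally have le: "a ^ 4 * b\<^sup>2 * (cmod (F q))\<^sup>2 \<le> (cmod (W1 q))\<^sup>2 + (cmod (W2 q))\<^sup>2"
      unfolding w1 w2 distrib_right[symmetric] by (intro mult_right_mono) auto
    have w: "freq_weight q = (1 / (a * b))\<^sup>2"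
      unfolding freq_weight_def a_def b_def power_divide power_mult_distrib bracket_square by simp
    have "a * cmod (F q) = (1 / (a * b)) * (a\<^sup>2 * b * cmod (F q))" using ab by (simp add: power2_eq_square)
    also have "\<dots> \<le> 2 * (1 / (a * b)) * (a\<^sup>2 * b * cmod (F q))"
    proof -
      have "0 \<le> (1 / (a * b)) * (a\<^sup>2 * b * cmod (F q))" using ab by (intro mult_nonneg_nonneg) auto
      from mult_right_mono[of 1 2, OF _ this] show ?thesis by (simp only: mult.assoc mult_1 one_le_numeral simp_thms)
    qed
    also have "\<dots> \<le> (1 / (a * b))\<^sup>2 + (a\<^sup>2 * b * cmod (F q))\<^sup>2" by (rule sum_squares_bound)
    also have "(a\<^sup>2 * b * cmod (F q))\<^sup>2 = a ^ 4 * b\<^sup>2 * (cmod (F q))\<^sup>2" by (simp add: power_mult_distrib)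
    also note le
    finally have "a * cmod (F q) \<le> freq_weight q + ((cmod (W1 q))\<^sup>2 + (cmod (W2 q))\<^sup>2)" unfolding w by simp
    moreover have "freq_weight q \<ge> 0" unfolding w by simp
    ultimately show ?case unfolding a_def[symmetric]
      by (subst ennreal_plus[symmetric], simp, simp)+ (rule ennreal_leI)
  qed
  have n1: "sqnorm freq W1 \<le> ennreal (8 * pi\<^sup>2 * (l2norm cyl g1)\<^sup>2)"
    using sqnorm_is_fourier_le[OF F1(2)] sqnorm_l2norm[OF is_fourier_L2(1)[OF F1(2)]] unfolding W1_def by (simp add: ennreal_mult)
  have n2': "sqnorm freq W2 \<le> ennreal (8 * pi\<^sup>2 * (l2norm cyl g2)\<^sup>2)"
    using sqnorm_is_fourier_le[OF F2(2)] sqnorm_l2norm[OF is_fourier_L2(1)[OF F2(2)]] unfolding W2_def by (simp add: ennreal_mult)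
  have "(\<integral>\<^sup>+q. ennreal (bracket (fst q) * cmod (F q)) \<partial>freq)
     \<le> (\<integral>\<^sup>+q. ennreal (freq_weight q) + (ennreal ((cmod (W1 q))\<^sup>2) + ennreal ((cmod (W2 q))\<^sup>2)) \<partial>freq)"
    by (rule nn_integral_mono_AE[OF pt])
  also have "\<dots> = (\<integral>\<^sup>+q. ennreal (freq_weight q) \<partial>freq) + (sqnorm freq W1 + sqnorm freq W2)"
    unfolding sqnorm_def by (simp add: nn_integral_add)
  also have "sqnorm freq W1 + sqnorm freq W2 \<le> ennreal (8 * pi\<^sup>2 * (l2norm cyl g1)\<^sup>2) + ennreal (8 * pi\<^sup>2 * (l2norm cyl g2)\<^sup>2)"
    by (intro add_mono n1 n2')
  also have "\<dots> = ennreal (8 * pi\<^sup>2 * ((l2norm cyl g1)\<^sup>2 + (l2norm cyl g2)\<^sup>2))"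
    by (subst ennreal_plus[symmetric]) (auto simp: distrib_left)
  also have "\<dots> \<le> ennreal (8 * pi\<^sup>2 * (sobolev_norm s1 s2 f)\<^sup>2)"
    unfolding sobolev_norm_def g1_def[symmetric] g2_def[symmetric]
    using l2norm_nonneg[of cyl g1] l2norm_nonneg[of cyl g2]
    by (intro ennreal_leI mult_left_mono) (auto simp: power2_sum)
  finally show ?thesis by (simp add: add_left_mono)
qed

lemma sobolev_integrable:
  assumes f: "f \<in> sobolev s1 s2" and fF: "is_fourier f F" and s: "s1 \<ge> 6" "s2 \<ge> 3"
  shows "integrable freq F" "integrable freq (\<lambda>q. F q * of_real (fst q))"
proof -
  have Fm[measurable]: "F \<in> borel_measurable freq" using is_fourier_L2(2)[OF fF] by (rule L2_measurable)
  have fin: "(\<integral>\<^sup>+q. ennreal (bracket (fst q) * cmod (F q)) \<partial>freq) < \<infinity>"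
    by (rule le_less_trans[OF sobolev_decay[OF f fF s]]) (use nn_integral_freq_weight in simp)
  have ge: "cmod (F q) \<le> bracket (fst q) * cmod (F q)" "cmod (F q * of_real (fst q)) \<le> bracket (fst q) * cmod (F q)" for q
  proof -
    show "cmod (F q) \<le> bracket (fst q) * cmod (F q)" using mult_right_mono[OF bracket_ge_1[of "fst q"], of "cmod (F q)"] by simp
    have "\<bar>fst q\<bar> \<le> bracket (fst q)"
      by (rule power2_le_imp_le) (use bracket_ge_1[of "fst q"] in \<open>auto simp: bracket_square\<close>)
    from mult_left_mono[OF this, of "cmod (F q)"] show "cmod (F q * of_real (fst q)) \<le> bracket (fst q) * cmod (F q)"
      by (simp add: norm_mult mult.commute)
  qed
  show "integrable freq F"
  proof (rule integrableI_bounded[OF Fm])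
    show "(\<integral>\<^sup>+q. ennreal (norm (F q)) \<partial>freq) < \<infinity>"
      by (rule le_less_trans[OF nn_integral_mono fin]) (rule ennreal_leI[OF ge(1)])
  qed
  show "integrable freq (\<lambda>q. F q * of_real (fst q))"
  proof (rule integrableI_bounded)
    show "(\<integral>\<^sup>+q. ennreal (norm (F q * of_real (fst q))) \<partial>freq) < \<infinity>"
      by (rule le_less_trans[OF nn_integral_mono fin]) (rule ennreal_leI[OF ge(2)])
  qed measurable
qed

text \<open>Sobolev embedding into bounded functions, from the decay of the Fourier transform and the inversion
formula. The bound is quadratic in the norm; it is used to see that functions near a given one stay bounded.\<close>

lemma sobolev_bounded:
  obtains C :: real where "C \<ge> 0" "\<And>f s1 s2. f \<in> sobolev s1 s2 \<Longrightarrow> s1 \<ge> 6 \<Longrightarrow> s2 \<ge> 3 \<Longrightarrow>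
    AE p in cyl. cmod (f p) \<le> C + 2 * (sobolev_norm s1 s2 f)\<^sup>2"
proof -
  define K where "K = enn2real (\<integral>\<^sup>+q. ennreal (freq_weight q) \<partial>freq)"
  have K: "(\<integral>\<^sup>+q. ennreal (freq_weight q) \<partial>freq) = ennreal K" "K \<ge> 0"
    using nn_integral_freq_weight by (auto simp: K_def)
  show thesis
  proof (rule that[of "K / (4 * pi\<^sup>2)"])
    show "K / (4 * pi\<^sup>2) \<ge> 0" using K by simp
    fix f s1 s2 assume f: "f \<in> sobolev s1 s2" and s: "s1 \<ge> 6" "s2 \<ge> 3"
    obtain F where fF: "is_fourier f F" using sobolev_mult(1)[OF f] unfolding is_mult_def by auto
    have Fi: "integrable freq F" by (rule sobolev_integrable(1)[OF f fF s])
    have "ennreal (\<integral>q. cmod (F q) \<partial>freq) = (\<integral>\<^sup>+q. ennreal (cmod (F q)) \<partial>freq)"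
      by (rule nn_integral_eq_integral[symmetric]) (use Fi in auto)
    also have "\<dots> \<le> (\<integral>\<^sup>+q. ennreal (bracket (fst q) * cmod (F q)) \<partial>freq)"
      by (intro nn_integral_mono ennreal_leI mult_right_mono[OF bracket_ge_1, of "cmod _", simplified])
    also have "\<dots> \<le> ennreal K + ennreal (8 * pi\<^sup>2 * (sobolev_norm s1 s2 f)\<^sup>2)"
      using sobolev_decay[OF f fF s] K by simp
    also have "\<dots> = ennreal (K + 8 * pi\<^sup>2 * (sobolev_norm s1 s2 f)\<^sup>2)"
      using K by (subst ennreal_plus) auto
    finally have le: "(\<integral>q. cmod (F q) \<partial>freq) \<le> K + 8 * pi\<^sup>2 * (sobolev_norm s1 s2 f)\<^sup>2"
      using K by (subst (asm) ennreal_le_iff) auto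
    have "cmod (inv_fourier F p) \<le> K / (4 * pi\<^sup>2) + 2 * (sobolev_norm s1 s2 f)\<^sup>2" for p
    proof -
      have "cmod (inv_fourier F p) \<le> (K + 8 * pi\<^sup>2 * (sobolev_norm s1 s2 f)\<^sup>2) / (4 * pi\<^sup>2)"
        by (rule order_trans[OF cmod_inv_fourier_le]) (intro divide_right_mono le, simp)
      also have "\<dots> = K / (4 * pi\<^sup>2) + 2 * (sobolev_norm s1 s2 f)\<^sup>2" by (simp add: field_simps)
      finally show ?thesis .
    qed
    thus "AE p in cyl. cmod (f p) \<le> K / (4 * pi\<^sup>2) + 2 * (sobolev_norm s1 s2 f)\<^sup>2"
      using fourier_inversion[OF fF Fi] by (auto elim!: eventually_mono)
  qed
qed

section \<open>The nonlinearity\<close>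

lemma inv_fourier_has_vector_derivative:
  assumes F: "integrable freq F" and F': "integrable freq (\<lambda>q. F q * of_real (fst q))"
  shows "((\<lambda>x. inv_fourier F (x, y)) has_vector_derivative inv_fourier (\<lambda>q. \<i> * of_real (fst q) * F q) (x, y)) (at x)"
proof -
  have "((\<lambda>x. \<integral>q. F q * cis (x * fst q + y * of_int (snd q)) \<partial>freq) has_vector_derivative
      (\<integral>q. (F q * of_real (fst q)) * (\<i> * cis (x * fst q + y * of_int (snd q))) \<partial>freq)) (at x)"
    by (rule has_vector_derivative_integral_cis[OF F F']) measurable
  from has_vector_derivative_divide[OF this, of "of_real (4 * pi\<^sup>2)"]
  show ?thesis unfolding inv_fourier_def by (simp add: mult_ac)
qed

text \<open>By inversion \<open>u\<close> agrees almost everywhere with a bounded function that is differentiable in \<open>x\<close>, with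
derivative \<open>ux\<close>. For almost every \<open>y\<close> the integral over \<open>x\<close> of the derivative of
\<open>u^(k+1) cis(-x \<xi> - y \<eta>)\<close> is zero, which is the identity.\<close>

lemma fourier_power_times_deriv:
  assumes u: "is_fourier u F" and ux: "is_fourier ux (\<lambda>q. \<i> * of_real (fst q) * F q)"
    and F: "integrable freq F" and F': "integrable freq (\<lambda>q. F q * of_real (fst q))" and k: "k \<ge> 1"
  shows "integrable cyl (\<lambda>p. u p ^ (k + 1))" "integrable cyl (\<lambda>p. u p ^ k * ux p)"
    "fourier (\<lambda>p. u p ^ k * ux p) (\<xi>, \<eta>) = \<i> * of_real \<xi> / of_nat (k + 1) * fourier (\<lambda>p. u p ^ (k + 1)) (\<xi>, \<eta>)"
proof -
  obtain j where j: "k = Suc j" using k by (cases k) auto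
  have uL: "u \<in> L2 cyl" "ux \<in> L2 cyl" using is_fourier_L2(1)[OF u] is_fourier_L2(1)[OF ux] by auto
  have um[measurable]: "u \<in> borel_measurable cyl" "ux \<in> borel_measurable cyl" using uL by (auto dest: L2_measurable)
  have F'': "integrable freq (\<lambda>q. \<i> * of_real (fst q) * F q)"
    using integrable_mult_right[OF F', of \<i>] by (simp add: mult_ac)
  define v where "v = inv_fourier F"
  define vx where "vx = inv_fourier (\<lambda>q. \<i> * of_real (fst q) * F q)"
  have vm[measurable]: "v \<in> borel_measurable cyl" "vx \<in> borel_measurable cyl"
    unfolding v_def vx_def using F F'' by (auto intro!: measurable_inv_fourier)
  have av: "AE p in cyl. u p = v p" unfolding v_def by (rule fourier_inversion[OF u F])
  have avx: "AE p in cyl. ux p = vx p" unfolding vx_def by (rule fourier_inversion[OF ux F''])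
  have vL: "v \<in> L2 cyl" "vx \<in> L2 cyl" using L2_cong_AE[OF uL(1) vm(1) av] L2_cong_AE[OF uL(2) vm(2) avx] by auto
  define B where "B = (\<integral>q. cmod (F q) \<partial>freq) / (4 * pi\<^sup>2)"
  have vb: "cmod (v p) \<le> B" for p unfolding v_def B_def by (rule cmod_inv_fourier_le)
  have pb: "cmod (v p ^ j) \<le> B ^ j" for p using vb[of p] by (simp add: norm_power power_mono)
  have iw: "integrable cyl (\<lambda>p. v p ^ (k + 1))"
    using integrable_times_bounded[OF L2_integrable_mult[OF vL(1) vL(1)] _ pb] by (simp add: j mult_ac)
  have iN: "integrable cyl (\<lambda>p. v p ^ k * vx p)"
    using integrable_times_bounded[OF L2_integrable_mult[OF vL(1) vL(2)] _ pb] by (simp add: j mult_ac)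
  have aw: "AE p in cyl. v p ^ (k + 1) = u p ^ (k + 1)" using av by eventually_elim simp
  have aN: "AE p in cyl. v p ^ k * vx p = u p ^ k * ux p" using av avx by eventually_elim simp
  show "integrable cyl (\<lambda>p. u p ^ (k + 1))"
    by (rule Bochner_Integration.integrable_cong_AE_imp[OF iw]) (use aw in \<open>auto elim: eventually_mono\<close>)
  show "integrable cyl (\<lambda>p. u p ^ k * ux p)"
    by (rule Bochner_Integration.integrable_cong_AE_imp[OF iN]) (use aN in \<open>auto elim: eventually_mono\<close>)
  define G where "G = (\<lambda>p. v p ^ (k + 1) * cis (- (fst p * \<xi>) - snd p * of_int \<eta>))"
  \<comment> \<open>\<open>G'\<close> is the derivative of \<open>G\<close> in \<open>x\<close>; its integral is \<open>k + 1\<close> times the difference of the two sides of the identity.\<close>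
  define G' where "G' = (\<lambda>p. of_nat (k + 1) * (v p ^ k * vx p * cis (- (fst p * \<xi>) - snd p * of_int \<eta>)) - \<i> * of_real \<xi> * G p)"
  have iG: "integrable cyl G" unfolding G_def by (rule integrable_times_cis[OF iw]) measurable
  have iNc: "integrable cyl (\<lambda>p. v p ^ k * vx p * cis (- (fst p * \<xi>) - snd p * of_int \<eta>))"
    by (rule integrable_times_cis[OF iN]) measurable
  have iG': "integrable cyl G'" unfolding G'_def using iG iNc by auto
  have der: "((\<lambda>x. G (x, y)) has_vector_derivative G' (x, y)) (at x)" for x y
  proof -
    have dv: "((\<lambda>x. v (x, y)) has_vector_derivative vx (x, y)) (at x)"
      unfolding v_def vx_def by (rule inv_fourier_has_vector_derivative[OF F F'])
    have dw: "((\<lambda>x. v (x, y) ^ (k + 1)) has_vector_derivative of_nat (k + 1) * v (x, y) ^ k * vx (x, y)) (at x)"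
    proof -
      have "((\<lambda>z. z ^ (k + 1)) has_field_derivative of_nat (k + 1) * v (x, y) ^ k) (at (v (x, y)))"
        by (rule derivative_eq_intros | simp)+
      from field_vector_diff_chain_at[OF dv this] show ?thesis by (simp add: comp_def mult_ac)
    qed
    have dc: "((\<lambda>x. cis (- (x * \<xi>) - y * of_int \<eta>)) has_vector_derivative - \<i> * of_real \<xi> * cis (- (x * \<xi>) - y * of_int \<eta>)) (at x)"
    proof -
      have "((\<lambda>z. exp (\<i> * (- (z * of_real \<xi>) - of_real (y * of_int \<eta>)))) has_field_derivative
          - \<i> * of_real \<xi> * exp (\<i> * (- (of_real x * of_real \<xi>) - of_real (y * of_int \<eta>)))) (at (of_real x))"
        by (auto intro!: derivative_eq_intros)
      from has_vector_derivative_real_field[OF this] show ?thesis by (simp add: cis_conv_exp)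
    qed
    show ?thesis using has_vector_derivative_mult[OF dw dc] unfolding G_def G'_def by (simp add: algebra_simps)
  qed
  have "(\<integral>p. G' p \<partial>cyl) = (\<integral>y. (\<integral>x. G' (x, y) \<partial>lborel) \<partial>tor)"
    using torus_pair.integral_snd[of "\<lambda>x y. G' (x, y)"] iG' by (simp add: cyl_eq)
  also have "\<dots> = (\<integral>y. 0 \<partial>tor)"
  proof (rule integral_cong_AE)
    have "AE y in tor. integrable lborel (\<lambda>x. G (x, y))"
      using torus_pair.AE_integrable_snd[of "\<lambda>x y. G (x, y)"] iG by (simp add: cyl_eq)
    moreover have "AE y in tor. integrable lborel (\<lambda>x. G' (x, y))"
      using torus_pair.AE_integrable_snd[of "\<lambda>x y. G' (x, y)"] iG' by (simp add: cyl_eq)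
    ultimately show "AE y in tor. (\<integral>x. G' (x, y) \<partial>lborel) = 0"
      by eventually_elim (rule integral_derivative_zero[OF _ _ der])
    have "integrable tor (\<lambda>y. \<integral>x. G' (x, y) \<partial>lborel)"
      using torus_pair.integrable_snd[of "\<lambda>x y. G' (x, y)"] iG' by (simp add: cyl_eq)
    thus "(\<lambda>y. \<integral>x. G' (x, y) \<partial>lborel) \<in> borel_measurable tor" by (rule borel_measurable_integrable)
  qed simp
  finally have z: "(\<integral>p. G' p \<partial>cyl) = 0" by simp
  have "(\<integral>p. G' p \<partial>cyl) = of_nat (k + 1) * fourier (\<lambda>p. v p ^ k * vx p) (\<xi>, \<eta>) - \<i> * of_real \<xi> * fourier (\<lambda>p. v p ^ (k + 1)) (\<xi>, \<eta>)"
    unfolding G'_def fourier_eq using iG iNc unfolding G_def by simp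
  with z have eq: "of_nat (k + 1) * fourier (\<lambda>p. v p ^ k * vx p) (\<xi>, \<eta>) = \<i> * of_real \<xi> * fourier (\<lambda>p. v p ^ (k + 1)) (\<xi>, \<eta>)"
    by simp
  have "fourier (\<lambda>p. v p ^ k * vx p) = fourier (\<lambda>p. u p ^ k * ux p)" by (rule fourier_cong_AE[OF aN]) measurable
  moreover have "fourier (\<lambda>p. v p ^ (k + 1)) = fourier (\<lambda>p. u p ^ (k + 1))" by (rule fourier_cong_AE[OF aw]) measurable
  moreover have "(of_nat (k + 1) :: complex) \<noteq> 0" by (simp only: of_nat_eq_0_iff)
  ultimately show "fourier (\<lambda>p. u p ^ k * ux p) (\<xi>, \<eta>) = \<i> * of_real \<xi> / of_nat (k + 1) * fourier (\<lambda>p. u p ^ (k + 1)) (\<xi>, \<eta>)"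
    using eq by (simp add: field_simps del: of_nat_Suc of_nat_add)
qed

lemma continuous_on_fourier:
  assumes f: "integrable cyl f"
  shows "continuous_on UNIV (\<lambda>\<xi>. fourier f (\<xi>, \<eta>))"
proof -
  have [measurable]: "f \<in> borel_measurable cyl" using f by auto
  have "isCont (\<lambda>\<xi>. \<integral>p. f p * cis (- (fst p * \<xi>) - snd p * of_int \<eta>) \<partial>cyl) \<xi>" for \<xi>
    unfolding continuous_at_sequentially comp_def
  proof (intro allI impI)
    fix X :: "nat \<Rightarrow> real" assume X: "X \<longlonglongrightarrow> \<xi>"
    show "(\<lambda>n. \<integral>p. f p * cis (- (fst p * X n) - snd p * of_int \<eta>) \<partial>cyl) \<longlonglongrightarrow> (\<integral>p. f p * cis (- (fst p * \<xi>) - snd p * of_int \<eta>) \<partial>cyl)"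
    proof (rule integral_dominated_convergence[where w="\<lambda>p. cmod (f p)"])
      show "AE p in cyl. (\<lambda>n. f p * cis (- (fst p * X n) - snd p * of_int \<eta>)) \<longlonglongrightarrow> f p * cis (- (fst p * \<xi>) - snd p * of_int \<eta>)"
        unfolding cis_conv_exp by (intro AE_I2 tendsto_intros X)
    qed (use f in \<open>auto simp: norm_mult\<close>)
  qed
  thus ?thesis by (simp add: continuous_on_eq_continuous_at fourier_eq)
qed

section \<open>Differentiating Fourier coefficients in time\<close>

lemma l2norm_add_square_le:
  assumes "f \<in> L2 M" "g \<in> L2 M"
  shows "(l2norm M (\<lambda>z. f z + g z))\<^sup>2 \<le> 2 * (l2norm M f)\<^sup>2 + 2 * (l2norm M g)\<^sup>2"
proof -
  have "ennreal ((l2norm M (\<lambda>z. f z + g z))\<^sup>2) \<le> 2 * ennreal ((l2norm M f)\<^sup>2) + 2 * ennreal ((l2norm M g)\<^sup>2)"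
    using sqnorm_add_le[of f M g] assms by (simp add: sqnorm_l2norm L2_add L2_measurable)
  also have "\<dots> = ennreal (2 * (l2norm M f)\<^sup>2 + 2 * (l2norm M g)\<^sup>2)"
    by (subst ennreal_plus) (auto simp: ennreal_mult)
  finally show ?thesis by (subst (asm) ennreal_le_iff) auto
qed

lemma l2norm_cmult: "l2norm M (\<lambda>z. c * f z) = cmod c * l2norm M f"
  by (simp add: l2norm_def norm_mult power_mult_distrib real_sqrt_mult)

lemma indicator_Icc_L2:
  "(\<lambda>x. complex_of_real (indicator {a..b} x)) \<in> L2 lborel"
  "a \<le> b \<Longrightarrow> l2norm lborel (\<lambda>x. complex_of_real (indicator {a..b} x)) = sqrt (b - a)"
proof -
  have i: "integrable lborel (\<lambda>x. indicator {a..b} x :: real)" by (intro integrable_real_indicator) (auto simp: emeasure_lborel_Icc_eq)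
  have e: "(cmod (complex_of_real (indicator {a..b} x)))\<^sup>2 = indicator {a..b} x" for x :: real by (simp add: indicator_def)
  show "(\<lambda>x. complex_of_real (indicator {a..b} x)) \<in> L2 lborel"
    unfolding L2_def e mem_Collect_eq using i borel_measurable_integrable[OF integrable_of_real[OF i]] by blast
  show "l2norm lborel (\<lambda>x. complex_of_real (indicator {a..b} x)) = sqrt (b - a)" if "a \<le> b"
    unfolding l2norm_def e using that by simp
qed

lemma set_integral_cmod_le_l2norm:
  assumes f: "f \<in> L2 lborel" and ab: "a \<le> b"
  shows "(LINT x:{a..b}|lborel. cmod (f x)) \<le> sqrt (b - a) * l2norm lborel f"
proof -
  have "(LINT x:{a..b}|lborel. cmod (f x)) = (\<integral>x. cmod (complex_of_real (indicator {a..b} x) * f x) \<partial>lborel)"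
    unfolding set_lebesgue_integral_def by (simp add: norm_mult)
  also have "\<dots> \<le> sqrt (b - a) * l2norm lborel f"
    using L2_Cauchy_Schwarz[OF indicator_Icc_L2(1)[of a b] f] unfolding indicator_Icc_L2(2)[OF ab] .
  finally show ?thesis .
qed

lemma L2_set_integrable:
  fixes f :: "real \<Rightarrow> complex"
  shows "f \<in> L2 lborel \<Longrightarrow> set_integrable lborel {a..b} f"
  using L2_integrable_mult[OF indicator_Icc_L2(1), of f a b] by (simp add: set_integrable_def scaleR_conv_of_real)

lemma set_integrable_times_bounded:
  fixes f g :: "real \<Rightarrow> complex"
  assumes f: "set_integrable lborel {a..b} f" and g[measurable]: "g \<in> borel_measurable borel"
    and b: "\<And>x. x \<in> {a..b} \<Longrightarrow> cmod (g x) \<le> C"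
  shows "set_integrable lborel {a..b} (\<lambda>x. g x * f x)"
proof -
  have "integrable lborel (\<lambda>x. (indicator {a..b} x *\<^sub>R f x) * (indicator {a..b} x *\<^sub>R g x))"
  proof (rule integrable_times_bounded[where C="max C 0"])
    show "integrable lborel (\<lambda>x. indicator {a..b} x *\<^sub>R f x)" using f by (simp add: set_integrable_def)
    show "cmod (indicator {a..b} x *\<^sub>R g x) \<le> max C 0" for x using b[of x] by (auto simp: indicator_def)
    have "(\<lambda>x. indicator {a..b} x *\<^sub>R g x) \<in> borel_measurable borel" by measurable
    thus "(\<lambda>x. indicator {a..b} x *\<^sub>R g x) \<in> borel_measurable lborel" by simp
  qed
  moreover have "(indicator {a..b} x *\<^sub>R f x) * (indicator {a..b} x *\<^sub>R g x) = indicator {a..b} x *\<^sub>R (g x * f x)" for x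
    by (simp add: indicator_def)
  ultimately show ?thesis by (simp add: set_integrable_def)
qed

text \<open>The product rule for the weak derivative of \<open>cis(-s m) f(s)\<close>: convergence of the difference quotients of
\<open>f\<close> in \<open>L\<^sup>2\<close> gives convergence of their integrals over the bounded interval, on which the phase \<open>m\<close> is
bounded.\<close>

lemma rotated_integral_derivative:
  fixes f :: "real \<Rightarrow> real \<Rightarrow> complex" and g :: "real \<Rightarrow> complex" and m :: "real \<Rightarrow> real"
  assumes t: "t \<in> S" and f: "\<And>s. s \<in> S \<Longrightarrow> f s \<in> L2 lborel" and g: "g \<in> L2 lborel"
    and lim: "((\<lambda>s. l2norm lborel (\<lambda>\<xi>. (f s \<xi> - f t \<xi>) / of_real (s - t) - g \<xi>)) \<longlongrightarrow> 0) (at t within S)"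
    and m[measurable]: "m \<in> borel_measurable borel" and M: "\<And>\<xi>. \<xi> \<in> {a..b} \<Longrightarrow> \<bar>m \<xi>\<bar> \<le> M" and ab: "a \<le> b"
  shows "((\<lambda>s. LINT \<xi>:{a..b}|lborel. cis (- (s * m \<xi>)) * f s \<xi>) has_vector_derivative
     (LINT \<xi>:{a..b}|lborel. cis (- (t * m \<xi>)) * (g \<xi> - \<i> * of_real (m \<xi>) * f t \<xi>))) (at t within S)"
proof -
  have M0: "M \<ge> 0" using M[of a] ab by auto
  have fm: "s \<in> S \<Longrightarrow> f s \<in> borel_measurable borel" for s using f[of s] L2_measurable by fastforce
  have gm[measurable]: "g \<in> borel_measurable borel" using L2_measurable[OF g] by simp
  have ftm[measurable]: "f t \<in> borel_measurable borel" by (rule fm[OF t])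
  define W where "W = (\<lambda>s. LINT \<xi>:{a..b}|lborel. cis (- (s * m \<xi>)) * f s \<xi>)"
  define D where "D = (LINT \<xi>:{a..b}|lborel. cis (- (t * m \<xi>)) * (g \<xi> - \<i> * of_real (m \<xi>) * f t \<xi>))"
  define E where "E = (\<lambda>s \<xi>. (f s \<xi> - f t \<xi>) / of_real (s - t) - g \<xi>)"
  have EL: "E s \<in> L2 lborel" if "s \<in> S" for s
  proof -
    have "(\<lambda>\<xi>. (1 / of_real (s - t)) * (f s \<xi> - f t \<xi>) - g \<xi>) \<in> L2 lborel"
      by (intro L2_diff L2_cmult f that t g)
    thus ?thesis by (simp add: E_def)
  qed
  have if1: "set_integrable lborel {a..b} (\<lambda>\<xi>. cis (- (s * m \<xi>)) * f s \<xi>)" if "s \<in> S" for s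
    by (rule set_integrable_times_bounded[where C=1]) (auto intro: L2_set_integrable f that)
  have iD: "set_integrable lborel {a..b} (\<lambda>\<xi>. cis (- (t * m \<xi>)) * (g \<xi> - \<i> * of_real (m \<xi>) * f t \<xi>))"
  proof (rule set_integrable_times_bounded[where C=1])
    have "set_integrable lborel {a..b} (\<lambda>\<xi>. (\<i> * of_real (m \<xi>)) * f t \<xi>)"
      by (rule set_integrable_times_bounded[where C=M]) (auto intro: L2_set_integrable f t simp: norm_mult M)
    from set_integral_diff(1)[OF L2_set_integrable[OF g] this]
    show "set_integrable lborel {a..b} (\<lambda>\<xi>. g \<xi> - \<i> * of_real (m \<xi>) * f t \<xi>)" .
  qed auto
  define Cg where "Cg = (LINT \<xi>:{a..b}|lborel. cmod (g \<xi>))"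
  define Cf where "Cf = (LINT \<xi>:{a..b}|lborel. cmod (f t \<xi>))"
  have ig: "set_integrable lborel {a..b} (\<lambda>\<xi>. cmod (g \<xi>))" "set_integrable lborel {a..b} (\<lambda>\<xi>. cmod (f t \<xi>))"
    using L2_set_integrable[OF g] L2_set_integrable[OF f[OF t]] by (auto intro: set_integrable_norm)
  have key: "norm (W s - W t - (s - t) *\<^sub>R D) / norm (s - t) \<le> sqrt (b - a) * l2norm lborel (E s) + \<bar>s - t\<bar> * (M * Cg + M\<^sup>2 * Cf)"
    if s: "s \<in> S" "s \<noteq> t" for s
  proof -
    define \<delta> where "\<delta> = s - t"
    have \<delta>: "\<delta> \<noteq> 0" using s by (simp add: \<delta>_def)
    define R where "R = (\<lambda>\<xi>. cis (- (s * m \<xi>)) * f s \<xi> - cis (- (t * m \<xi>)) * f t \<xi> - \<delta> *\<^sub>R (cis (- (t * m \<xi>)) * (g \<xi> - \<i> * of_real (m \<xi>) * f t \<xi>)))"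
    have iR: "set_integrable lborel {a..b} R" unfolding R_def
      by (intro set_integral_diff(1) if1 s t set_integrable_scaleR_right iD)
    have iE: "set_integrable lborel {a..b} (\<lambda>\<xi>. cmod (E s \<xi>))"
      using L2_set_integrable[OF EL[OF s(1)]] by (rule set_integrable_norm)
    have "W s - W t - (s - t) *\<^sub>R D = (LINT \<xi>:{a..b}|lborel. R \<xi>)"
      unfolding W_def D_def R_def \<delta>_def[symmetric]
      by (simp add: set_integral_diff(2) set_integral_diff(1) if1 s t set_integrable_scaleR_right iD)
    hence "norm (W s - W t - (s - t) *\<^sub>R D) \<le> (LINT \<xi>:{a..b}|lborel. cmod (R \<xi>))"
      using set_integral_norm_bound[OF iR] by simp
    also have "\<dots> \<le> (LINT \<xi>:{a..b}|lborel. \<bar>\<delta>\<bar> * (cmod (E s \<xi>) + \<bar>\<delta>\<bar> * (M * cmod (g \<xi>) + M\<^sup>2 * cmod (f t \<xi>))))"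
    proof (rule set_integral_mono)
      show "set_integrable lborel {a..b} (\<lambda>\<xi>. cmod (R \<xi>))" using iR by (rule set_integrable_norm)
      show "set_integrable lborel {a..b} (\<lambda>\<xi>. \<bar>\<delta>\<bar> * (cmod (E s \<xi>) + \<bar>\<delta>\<bar> * (M * cmod (g \<xi>) + M\<^sup>2 * cmod (f t \<xi>))))"
        using iE ig by (intro set_integrable_mult_right set_integral_add(1)) auto
      fix \<xi> assume \<xi>: "\<xi> \<in> {a..b}"
      define c where "c = cis (- (\<delta> * m \<xi>))"
      define c0 where "c0 = cis (- (t * m \<xi>))"
      have cs: "cis (- (s * m \<xi>)) = c0 * c" by (simp add: c_def c0_def cis_mult \<delta>_def algebra_simps)
      \<comment> \<open>\<open>E s\<close> is the error of the difference quotient, so \<open>R\<close> splits into an error term of size \<open>\<delta> |E s|\<close> and two terms of size \<open>\<delta>\<^sup>2\<close>.\<close>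
      have fs: "f s \<xi> = f t \<xi> + of_real \<delta> * (E s \<xi> + g \<xi>)" using \<delta> by (simp add: E_def \<delta>_def)
      have R: "R \<xi> = c0 * (of_real \<delta> * c * E s \<xi> + of_real \<delta> * (c - 1) * g \<xi> + (c - 1 - \<i> * of_real (- (\<delta> * m \<xi>))) * f t \<xi>)"
        unfolding R_def cs fs c0_def[symmetric] by (simp add: scaleR_conv_of_real algebra_simps)
      have dm: "\<bar>\<delta> * m \<xi>\<bar> \<le> \<bar>\<delta>\<bar> * M" using M[OF \<xi>] by (simp add: abs_mult mult_left_mono)
      have c1: "cmod (c - 1) \<le> \<bar>\<delta>\<bar> * M" using cmod_cis_approx(1)[of "- (\<delta> * m \<xi>)"] dm by (simp add: c_def)
      have c2: "cmod (c - 1 - \<i> * of_real (- (\<delta> * m \<xi>))) \<le> (\<bar>\<delta>\<bar> * M)\<^sup>2"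
      proof -
        have "cmod (c - 1 - \<i> * of_real (- (\<delta> * m \<xi>))) \<le> (- (\<delta> * m \<xi>))\<^sup>2 / 2" unfolding c_def by (rule cmod_cis_approx(2))
        also have "\<dots> \<le> \<bar>\<delta> * m \<xi>\<bar>\<^sup>2" by simp
        also have "\<dots> \<le> (\<bar>\<delta>\<bar> * M)\<^sup>2" using dm by (intro power_mono) auto
        finally show ?thesis .
      qed
      have "cmod (R \<xi>) \<le> cmod (of_real \<delta> * c * E s \<xi>) + cmod (of_real \<delta> * (c - 1) * g \<xi>) + cmod ((c - 1 - \<i> * of_real (- (\<delta> * m \<xi>))) * f t \<xi>)"
        unfolding R norm_mult[of c0] by (simp only: c0_def norm_cis mult_1) (intro norm_triangle_le add_mono order_refl norm_triangle_ineq)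
      also have "\<dots> \<le> \<bar>\<delta>\<bar> * cmod (E s \<xi>) + \<bar>\<delta>\<bar> * (\<bar>\<delta>\<bar> * M) * cmod (g \<xi>) + (\<bar>\<delta>\<bar> * M)\<^sup>2 * cmod (f t \<xi>)"
        unfolding norm_mult norm_of_real by (intro add_mono mult_right_mono mult_left_mono c1 c2) (auto simp: c_def)
      also have "\<dots> = \<bar>\<delta>\<bar> * (cmod (E s \<xi>) + \<bar>\<delta>\<bar> * (M * cmod (g \<xi>) + M\<^sup>2 * cmod (f t \<xi>)))"
        by (simp add: power2_eq_square algebra_simps)
      finally show "cmod (R \<xi>) \<le> \<bar>\<delta>\<bar> * (cmod (E s \<xi>) + \<bar>\<delta>\<bar> * (M * cmod (g \<xi>) + M\<^sup>2 * cmod (f t \<xi>)))" .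
    qed
    also have "\<dots> = \<bar>\<delta>\<bar> * ((LINT \<xi>:{a..b}|lborel. cmod (E s \<xi>)) + \<bar>\<delta>\<bar> * (M * Cg + M\<^sup>2 * Cf))"
      unfolding Cg_def Cf_def using iE ig by (simp add: set_integral_add set_integrable_mult_right)
    also have "\<dots> \<le> \<bar>\<delta>\<bar> * (sqrt (b - a) * l2norm lborel (E s) + \<bar>\<delta>\<bar> * (M * Cg + M\<^sup>2 * Cf))"
      by (intro mult_left_mono add_right_mono set_integral_cmod_le_l2norm EL s ab) simp
    finally have "norm (W s - W t - (s - t) *\<^sub>R D) \<le> (sqrt (b - a) * l2norm lborel (E s) + \<bar>\<delta>\<bar> * (M * Cg + M\<^sup>2 * Cf)) * \<bar>\<delta>\<bar>"
      by (simp only: mult.commute)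
    moreover have "\<bar>\<delta>\<bar> > 0" using \<delta> by simp
    ultimately show ?thesis unfolding \<delta>_def real_norm_def by (simp only: pos_divide_le_eq)
  qed
  have "((\<lambda>s. norm (W s - W t - (s - t) *\<^sub>R D) / norm (s - t)) \<longlongrightarrow> 0) (at t within S)"
  proof (rule tendsto_sandwich[OF _ _ tendsto_const])
    have "((\<lambda>s. sqrt (b - a) * l2norm lborel (E s) + \<bar>s - t\<bar> * (M * Cg + M\<^sup>2 * Cf)) \<longlongrightarrow> sqrt (b - a) * 0 + \<bar>t - t\<bar> * (M * Cg + M\<^sup>2 * Cf)) (at t within S)"
      by (intro tendsto_add tendsto_mult tendsto_const tendsto_rabs tendsto_diff tendsto_ident_at) (unfold E_def, rule lim)
    thus "((\<lambda>s. sqrt (b - a) * l2norm lborel (E s) + \<bar>s - t\<bar> * (M * Cg + M\<^sup>2 * Cf)) \<longlongrightarrow> 0) (at t within S)" by simp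
    show "\<forall>\<^sub>F s in at t within S. 0 \<le> norm (W s - W t - (s - t) *\<^sub>R D) / norm (s - t)" by (rule always_eventually) simp
    show "\<forall>\<^sub>F s in at t within S. norm (W s - W t - (s - t) *\<^sub>R D) / norm (s - t) \<le> sqrt (b - a) * l2norm lborel (E s) + \<bar>s - t\<bar> * (M * Cg + M\<^sup>2 * Cf)"
      unfolding eventually_at_filter by (rule always_eventually) (blast intro: key)
  qed
  hence "(W has_derivative (\<lambda>z. z *\<^sub>R D)) (at t within S)"
    unfolding has_derivative_iff_norm by (simp add: bounded_linear_scaleR_left)
  thus ?thesis unfolding has_vector_derivative_def W_def D_def .
qed

lemma cmod_power_diff_le:
  fixes a b :: complex
  assumes "cmod a \<le> M" "cmod b \<le> M"
  shows "cmod (a ^ (n + 2) - b ^ (n + 2)) \<le> real (n + 2) * M ^ n * ((cmod a + cmod b) * cmod (a - b))"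
proof (induction n)
  case 0
  have "a ^ (0 + 2) - b ^ (0 + 2) = (a + b) * (a - b)" by (simp add: power2_eq_square algebra_simps)
  hence "cmod (a ^ (0 + 2) - b ^ (0 + 2)) \<le> (cmod a + cmod b) * cmod (a - b)"
    by (simp only: norm_mult) (intro mult_right_mono norm_triangle_ineq norm_ge_zero)
  also have "\<dots> \<le> 2 * ((cmod a + cmod b) * cmod (a - b))" by simp
  finally show ?case by simp
next
  case (Suc n)
  have M0: "M \<ge> 0" using assms(1) norm_ge_zero order_trans by blast
  have "a ^ (Suc n + 2) - b ^ (Suc n + 2) = a * (a ^ (n + 2) - b ^ (n + 2)) + b ^ (n + 1) * (b * (a - b))"
    by (simp add: algebra_simps)
  hence "cmod (a ^ (Suc n + 2) - b ^ (Suc n + 2)) \<le> cmod a * cmod (a ^ (n + 2) - b ^ (n + 2)) + cmod b ^ (n + 1) * (cmod b * cmod (a - b))"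
    by (simp only: norm_mult[symmetric] norm_power[symmetric] norm_triangle_ineq)
  also have "\<dots> \<le> M * (real (n + 2) * M ^ n * ((cmod a + cmod b) * cmod (a - b))) + M ^ (n + 1) * ((cmod a + cmod b) * cmod (a - b))"
    using assms M0 Suc by (intro add_mono mult_mono power_mono mult_right_mono) auto
  also have "\<dots> = real (Suc n + 2) * M ^ Suc n * ((cmod a + cmod b) * cmod (a - b))" by (simp add: algebra_simps)
  finally show ?case .
qed

lemma is_mult_diff:
  assumes "is_mult m f g" "is_mult m f' g'"
  shows "is_mult m (\<lambda>p. f p - f' p) (\<lambda>p. g p - g' p)"
proof -
  obtain F F' where F: "is_fourier f F" "is_fourier g (\<lambda>(\<xi>, \<eta>). m \<xi> \<eta> * F (\<xi>, \<eta>))"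
    "is_fourier f' F'" "is_fourier g' (\<lambda>(\<xi>, \<eta>). m \<xi> \<eta> * F' (\<xi>, \<eta>))"
    using assms unfolding is_mult_def by auto
  have "(\<lambda>q. (case q of (\<xi>, \<eta>) \<Rightarrow> m \<xi> \<eta> * F (\<xi>, \<eta>)) - (case q of (\<xi>, \<eta>) \<Rightarrow> m \<xi> \<eta> * F' (\<xi>, \<eta>))) = (\<lambda>(\<xi>, \<eta>). m \<xi> \<eta> * (F (\<xi>, \<eta>) - F' (\<xi>, \<eta>)))"
    by (auto simp: right_diff_distrib)
  thus ?thesis unfolding is_mult_def
    using is_fourier_diff[OF F(1,3)] is_fourier_diff[OF F(2,4)] by (intro exI[of _ "\<lambda>q. F q - F' q"]) simp
qed

lemma sobolev_diff: "f \<in> sobolev s1 s2 \<Longrightarrow> g \<in> sobolev s1 s2 \<Longrightarrow> (\<lambda>p. f p - g p) \<in> sobolev s1 s2"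
  unfolding sobolev_def by (blast intro: is_mult_diff)

lemma fourier_uminus_L1_le:
  assumes "integrable cyl f" "integrable cyl g"
  shows "cmod (fourier f q - fourier g q) \<le> (\<integral>p. cmod (f p - g p) \<partial>cyl)"
  using cmod_fourier_le[of "\<lambda>p. f p - g p" q] fourier_diff[OF assms] assms by simp

section \<open>Solutions of the equation\<close>

text \<open>The symbol of \<open>H\<^sub>x (\<partial>\<^sub>x\<^sup>2 + \<partial>\<^sub>y\<^sup>2)\<close> divided by the imaginary unit.\<close>

definition dispersion :: "int \<Rightarrow> real \<Rightarrow> real" where
  "dispersion \<eta> \<xi> = sgn \<xi> * (\<xi>\<^sup>2 + (of_int \<eta>)\<^sup>2)"

text \<open>The bounds 6 and 3 on the Sobolev exponents follow from the hypotheses of both parts of the theorem.\<close>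

locale regular_solution =
  fixes K :: nat and \<nu> :: "nat \<Rightarrow> real" and T s1 s2 :: real and u :: "real \<Rightarrow> real \<times> real \<Rightarrow> complex"
  assumes s1: "s1 \<ge> 6" and s2: "s2 \<ge> 3"
    and sob: "u \<in> cont_sobolev T s1 s2" and sol: "solves_E K \<nu> T u"
begin

text \<open>One version of the \<open>L\<^sup>2\<close> Fourier transform of \<open>u(t)\<close>, determined almost everywhere.\<close>

definition uhat :: "real \<Rightarrow> real \<times> int \<Rightarrow> complex" where
  "uhat t = (SOME F. is_fourier (u t) F)"

text \<open>The nonlinearity on the Fourier side, without the factor \<xi> that comes from the derivative in \<open>x\<close>.\<close>

definition source :: "int \<Rightarrow> real \<Rightarrow> real \<Rightarrow> complex" where
  "source \<eta> t \<xi> = (\<Sum>k=1..K. \<i> * of_real (\<nu> k) / of_nat (k + 1) * fourier (\<lambda>p. u t p ^ (k + 1)) (\<xi>, \<eta>))"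

lemma u_sobolev: "t \<in> {0..T} \<Longrightarrow> u t \<in> sobolev s1 s2"
  using sob by (simp add: cont_sobolev_def)

lemma is_fourier_uhat:
  assumes t: "t \<in> {0..T}"
  shows "is_fourier (u t) (uhat t)"
proof -
  have "\<exists>F. is_fourier (u t) F" using sobolev_mult(1)[OF u_sobolev[OF t]] unfolding is_mult_def by blast
  thus ?thesis unfolding uhat_def by (rule someI_ex)
qed

lemma u_L2: "t \<in> {0..T} \<Longrightarrow> u t \<in> L2 cyl"
  using is_fourier_uhat is_fourier_L2(1) by blast

lemma uhat_L2: "t \<in> {0..T} \<Longrightarrow> uhat t \<in> L2 freq"
  using is_fourier_uhat is_fourier_L2(2) by blast

lemma uhat_eq_fourier:
  assumes t: "t \<in> {0..T}" and i: "integrable cyl (u t)"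
  shows "AE \<xi> in lborel. uhat t (\<xi>, \<eta>) = fourier (u t) (\<xi>, \<eta>)"
  by (rule AE_freq_section[OF is_fourier_unique[OF is_fourier_uhat[OF t] is_fourier_integrable[OF u_L2[OF t] i]]])

lemma u_power_integrable:
  assumes t: "t \<in> {0..T}" and k: "k \<ge> 1"
  shows "integrable cyl (\<lambda>p. u t p ^ (k + 1))"
proof -
  obtain ux where "is_mult dx_symbol (u t) ux" using sol t unfolding solves_E_def by blast
  then obtain F where F: "is_fourier (u t) F" "is_fourier ux (\<lambda>(\<xi>, \<eta>). dx_symbol \<xi> \<eta> * F (\<xi>, \<eta>))"
    unfolding is_mult_def by auto
  have "(\<lambda>(\<xi>, \<eta>). dx_symbol \<xi> \<eta> * F (\<xi>, \<eta>)) = (\<lambda>q. \<i> * of_real (fst q) * F q)" by (auto simp: dx_symbol_def)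
  with F(2) have "is_fourier ux (\<lambda>q. \<i> * of_real (fst q) * F q)" by simp
  from fourier_power_times_deriv(1)[OF F(1) this _ _ k] sobolev_integrable[OF u_sobolev[OF t] F(1) s1 s2]
  show ?thesis by blast
qed

text \<open>A differentiable curve is continuous.\<close>

lemma u_continuous_L2:
  assumes t: "t \<in> {0..T}"
  shows "((\<lambda>s. l2norm cyl (\<lambda>p. u s p - u t p)) \<longlongrightarrow> 0) (at t within {0..T})"
proof -
  obtain ut where ut: "L2_tendsto cyl (\<lambda>s p. (u s p - u t p) / of_real (s - t)) ut (at t within {0..T})"
    using sol t unfolding solves_E_def by blast
  define q where "q = (\<lambda>s p. (u s p - u t p) / of_real (s - t))"
  have utL: "ut \<in> L2 cyl" and lim: "((\<lambda>s. l2norm cyl (\<lambda>p. q s p - ut p)) \<longlongrightarrow> 0) (at t within {0..T})"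
    using ut unfolding L2_tendsto_def q_def by auto
  have qL: "q s \<in> L2 cyl" if "s \<in> {0..T}" for s
    using L2_cmult[OF L2_diff[OF u_L2[OF that] u_L2[OF t]], of "1 / of_real (s - t)"] by (simp add: q_def)
  have "((\<lambda>s. (l2norm cyl (\<lambda>p. u s p - u t p))\<^sup>2) \<longlongrightarrow> 0) (at t within {0..T})"
  proof (rule tendsto_sandwich[OF _ _ tendsto_const])
    have "((\<lambda>s. \<bar>s - t\<bar>\<^sup>2 * (2 * (l2norm cyl (\<lambda>p. q s p - ut p))\<^sup>2 + 2 * (l2norm cyl ut)\<^sup>2)) \<longlongrightarrow> \<bar>t - t\<bar>\<^sup>2 * (2 * 0\<^sup>2 + 2 * (l2norm cyl ut)\<^sup>2)) (at t within {0..T})"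
      by (intro tendsto_intros lim)
    thus "((\<lambda>s. \<bar>s - t\<bar>\<^sup>2 * (2 * (l2norm cyl (\<lambda>p. q s p - ut p))\<^sup>2 + 2 * (l2norm cyl ut)\<^sup>2)) \<longlongrightarrow> 0) (at t within {0..T})" by simp
    show "\<forall>\<^sub>F s in at t within {0..T}. (l2norm cyl (\<lambda>p. u s p - u t p))\<^sup>2 \<le> \<bar>s - t\<bar>\<^sup>2 * (2 * (l2norm cyl (\<lambda>p. q s p - ut p))\<^sup>2 + 2 * (l2norm cyl ut)\<^sup>2)"
      unfolding eventually_at_filter
    proof (rule always_eventually, intro allI impI)
      fix s assume s: "s \<noteq> t" "s \<in> {0..T}"
      have "(\<lambda>p. u s p - u t p) = (\<lambda>p. of_real (s - t) * ((q s p - ut p) + ut p))" using s by (simp add: q_def)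
      hence "l2norm cyl (\<lambda>p. u s p - u t p) = \<bar>s - t\<bar> * l2norm cyl (\<lambda>p. (q s p - ut p) + ut p)"
        by (simp only: l2norm_cmult norm_of_real)
      hence "(l2norm cyl (\<lambda>p. u s p - u t p))\<^sup>2 = \<bar>s - t\<bar>\<^sup>2 * (l2norm cyl (\<lambda>p. (q s p - ut p) + ut p))\<^sup>2"
        by (simp only: power_mult_distrib)
      also have "\<dots> \<le> \<bar>s - t\<bar>\<^sup>2 * (2 * (l2norm cyl (\<lambda>p. q s p - ut p))\<^sup>2 + 2 * (l2norm cyl ut)\<^sup>2)"
        by (intro mult_left_mono l2norm_add_square_le L2_diff qL s utL) simp
      finally show "(l2norm cyl (\<lambda>p. u s p - u t p))\<^sup>2 \<le> \<dots>" .
    qed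
  qed (rule always_eventually, simp)
  from tendsto_real_sqrt[OF this] show ?thesis by (simp add: l2norm_nonneg)
qed

text \<open>Near \<open>t\<close> the difference \<open>u(s) - u(t)\<close> has Sobolev norm at most 1, hence is bounded uniformly in \<open>s\<close>.\<close>

lemma u_locally_bounded:
  assumes t: "t \<in> {0..T}"
  obtains M where "AE p in cyl. cmod (u t p) \<le> M" "\<forall>\<^sub>F s in at t within {0..T}. AE p in cyl. cmod (u s p) \<le> M"
proof -
  obtain C :: real where C: "C \<ge> 0" "\<And>f s1 s2. f \<in> sobolev s1 s2 \<Longrightarrow> s1 \<ge> 6 \<Longrightarrow> s2 \<ge> 3 \<Longrightarrow>
    AE p in cyl. cmod (f p) \<le> C + 2 * (sobolev_norm s1 s2 f)\<^sup>2" using sobolev_bounded by blast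
  define M0 where "M0 = C + 2 * (sobolev_norm s1 s2 (u t))\<^sup>2"
  have b0: "AE p in cyl. cmod (u t p) \<le> M0" unfolding M0_def by (rule C(2)[OF u_sobolev[OF t] s1 s2])
  have "((\<lambda>s. sobolev_norm s1 s2 (\<lambda>p. u s p - u t p)) \<longlongrightarrow> 0) (at t within {0..T})"
    using sob t by (auto simp: cont_sobolev_def)
  from tendstoD[OF this, of 1]
  have "\<forall>\<^sub>F s in at t within {0..T}. \<bar>sobolev_norm s1 s2 (\<lambda>p. u s p - u t p)\<bar> < 1"
    by (simp add: dist_real_def)
  moreover have "\<forall>\<^sub>F s in at t within {0..T}. s \<in> {0..T}" by (simp add: eventually_at_filter)
  ultimately have "\<forall>\<^sub>F s in at t within {0..T}. AE p in cyl. cmod (u s p) \<le> M0 + C + 2"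
  proof eventually_elim
    case (elim s)
    have sn: "(sobolev_norm s1 s2 (\<lambda>p. u s p - u t p))\<^sup>2 \<le> 1" using elim(1) by (simp add: abs_square_le_1)
    show ?case
      using C(2)[OF sobolev_diff[OF u_sobolev[OF elim(2)] u_sobolev[OF t]] s1 s2] b0
    proof eventually_elim
      case (elim p)
      have "cmod (u s p) \<le> cmod (u s p - u t p) + cmod (u t p)" using norm_triangle_ineq[of "u s p - u t p" "u t p"] by simp
      thus ?case using elim sn by linarith
    qed
  qed
  moreover have "AE p in cyl. cmod (u t p) \<le> M0 + C + 2" using b0 C(1) by (auto elim!: eventually_mono)
  ultimately show thesis by (rule that[rotated])
qed

text \<open>On bounded functions \<open>|a^(k+1) - b^(k+1)|\<close> is at most a constant times \<open>(|a| + |b|) |a - b|\<close>, so the \<open>L\<^sup>1\<close>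
distance is controlled by \<open>L\<^sup>2\<close> norms.\<close>

lemma u_power_continuous_L1:
  assumes t: "t \<in> {0..T}" and k: "k \<ge> 1"
  shows "((\<lambda>s. \<integral>p. cmod (u s p ^ (k + 1) - u t p ^ (k + 1)) \<partial>cyl) \<longlongrightarrow> 0) (at t within {0..T})"
proof -
  obtain n where n: "k + 1 = n + 2" using k by (metis One_nat_def Suc_1 add.commute add_Suc_right le_add_diff_inverse)
  obtain M where M: "AE p in cyl. cmod (u t p) \<le> M" "\<forall>\<^sub>F s in at t within {0..T}. AE p in cyl. cmod (u s p) \<le> M"
    by (rule u_locally_bounded[OF t])
  define c where "c = real (n + 2) * max M 0 ^ n"
  define e where "e = (\<lambda>s. l2norm cyl (\<lambda>p. u s p - u t p))"
  have c0: "c \<ge> 0" by (simp add: c_def)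
  have L: "u t \<in> L2 cyl" by (rule u_L2[OF t])
  show ?thesis
  proof (rule tendsto_sandwich[OF _ _ tendsto_const])
    have "((\<lambda>s. c * (e s * e s + 2 * (l2norm cyl (u t) * e s))) \<longlongrightarrow> c * (0 * 0 + 2 * (l2norm cyl (u t) * 0))) (at t within {0..T})"
      unfolding e_def by (intro tendsto_intros u_continuous_L2 t)
    thus "((\<lambda>s. c * (e s * e s + 2 * (l2norm cyl (u t) * e s))) \<longlongrightarrow> 0) (at t within {0..T})" by simp
    have in_T: "\<forall>\<^sub>F s in at t within {0..T}. s \<in> {0..T}" by (simp add: eventually_at_filter)
    show "\<forall>\<^sub>F s in at t within {0..T}. (\<integral>p. cmod (u s p ^ (k + 1) - u t p ^ (k + 1)) \<partial>cyl) \<le> c * (e s * e s + 2 * (l2norm cyl (u t) * e s))"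
      using M(2) in_T
    proof eventually_elim
      case (elim s)
      define d where "d = (\<lambda>p. u s p - u t p)"
      have dL: "d \<in> L2 cyl" unfolding d_def by (intro L2_diff u_L2 elim t)
      have i1: "integrable cyl (\<lambda>p. cmod (d p * d p))" "integrable cyl (\<lambda>p. cmod (u t p * d p))"
        by (intro integrable_norm L2_integrable_mult dL L)+
      have "(\<integral>p. cmod (u s p ^ (k + 1) - u t p ^ (k + 1)) \<partial>cyl) \<le> (\<integral>p. c * (cmod (d p * d p) + 2 * cmod (u t p * d p)) \<partial>cyl)"
      proof (rule integral_mono_AE)
        show "integrable cyl (\<lambda>p. cmod (u s p ^ (k + 1) - u t p ^ (k + 1)))"
          by (intro integrable_norm Bochner_Integration.integrable_diff u_power_integrable elim t k)
        show "integrable cyl (\<lambda>p. c * (cmod (d p * d p) + 2 * cmod (u t p * d p)))" using i1 by auto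
        show "AE p in cyl. cmod (u s p ^ (k + 1) - u t p ^ (k + 1)) \<le> c * (cmod (d p * d p) + 2 * cmod (u t p * d p))"
          using M(1) elim(1)
        proof eventually_elim
          case (elim p)
          have "cmod (u s p ^ (n + 2) - u t p ^ (n + 2)) \<le> c * ((cmod (u s p) + cmod (u t p)) * cmod (u s p - u t p))"
            unfolding c_def by (rule cmod_power_diff_le) (use elim in auto)
          also have "\<dots> \<le> c * ((cmod (d p) + 2 * cmod (u t p)) * cmod (d p))"
            using norm_triangle_ineq[of "d p" "u t p"] c0
            by (intro mult_left_mono mult_mono) (auto simp: d_def)
          also have "\<dots> = c * (cmod (d p * d p) + 2 * cmod (u t p * d p))" by (simp add: norm_mult algebra_simps)
          finally show ?case unfolding n .
        qed
      qed
      also have "\<dots> = c * ((\<integral>p. cmod (d p * d p) \<partial>cyl) + 2 * (\<integral>p. cmod (u t p * d p) \<partial>cyl))"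
        using i1 by simp
      also have "\<dots> \<le> c * (e s * e s + 2 * (l2norm cyl (u t) * e s))"
        unfolding e_def d_def[symmetric] using L2_Cauchy_Schwarz[OF dL dL] L2_Cauchy_Schwarz[OF L dL] c0
        by (intro mult_left_mono add_mono) auto
      finally show ?case .
    qed
  qed (rule always_eventually, simp)
qed

text \<open>Convergence in \<open>L\<^sup>1\<close> makes the Fourier integrals converge uniformly in \<xi>.\<close>

lemma continuous_on_fourier_power:
  assumes k: "k \<ge> 1"
  shows "continuous_on ({0..T} \<times> UNIV) (\<lambda>(t, \<xi>). fourier (\<lambda>p. u t p ^ (k + 1)) (\<xi>, \<eta>))"
  unfolding continuous_on_sequentially
proof (intro allI ballI impI, elim conjE)
  fix X :: "nat \<Rightarrow> real \<times> real" and z assume z: "z \<in> {0..T} \<times> UNIV" and X: "\<forall>n. X n \<in> {0..T} \<times> UNIV" "X \<longlonglongrightarrow> z"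
  obtain t \<xi> where tx: "z = (t, \<xi>)" by (cases z)
  define g where "g = (\<lambda>t \<xi>. fourier (\<lambda>p. u t p ^ (k + 1)) (\<xi>, \<eta>))"
  define d where "d = (\<lambda>s. \<integral>p. cmod (u s p ^ (k + 1) - u t p ^ (k + 1)) \<partial>cyl)"
  have t: "t \<in> {0..T}" using z tx by auto
  have s: "fst (X n) \<in> {0..T}" for n using X(1) by (metis mem_Times_iff)
  have lims: "(\<lambda>n. fst (X n)) \<longlonglongrightarrow> t" "(\<lambda>n. snd (X n)) \<longlonglongrightarrow> \<xi>" using tendsto_fst[OF X(2)] tendsto_snd[OF X(2)] tx by auto
  have "continuous (at t within {0..T}) d"
    unfolding continuous_within using u_power_continuous_L1[OF t k] by (simp add: d_def)
  from this[unfolded continuous_within_sequentially, rule_format, of "\<lambda>n. fst (X n)"] s lims(1)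
  have "(d \<circ> (\<lambda>n. fst (X n))) \<longlonglongrightarrow> d t" by blast
  hence d0: "(\<lambda>n. d (fst (X n))) \<longlonglongrightarrow> 0" by (simp add: comp_def d_def)
  have "continuous_on UNIV (g t)" unfolding g_def by (rule continuous_on_fourier[OF u_power_integrable[OF t k]])
  hence "isCont (g t) \<xi>" by (simp add: continuous_on_eq_continuous_at)
  hence g0: "(\<lambda>n. g t (snd (X n))) \<longlonglongrightarrow> g t \<xi>" using lims(2) by (rule isCont_tendsto_compose)
  have "(\<lambda>n. g (fst (X n)) (snd (X n)) - g t (snd (X n))) \<longlonglongrightarrow> 0"
  proof (rule Lim_null_comparison[OF _ d0], rule always_eventually, rule allI)
    fix n
    show "norm (g (fst (X n)) (snd (X n)) - g t (snd (X n))) \<le> d (fst (X n))"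
      unfolding g_def d_def by (intro fourier_uminus_L1_le u_power_integrable s t k)
  qed
  from tendsto_add[OF this g0] have "(\<lambda>n. g (fst (X n)) (snd (X n))) \<longlonglongrightarrow> g t \<xi>" by simp
  thus "((\<lambda>(t, \<xi>). fourier (\<lambda>p. u t p ^ (k + 1)) (\<xi>, \<eta>)) \<circ> X) \<longlonglongrightarrow> (case z of (t, \<xi>) \<Rightarrow> fourier (\<lambda>p. u t p ^ (k + 1)) (\<xi>, \<eta>))"
    by (simp add: comp_def split_def tx g_def)
qed

lemma continuous_on_source: "continuous_on ({0..T} \<times> UNIV) (\<lambda>(t, \<xi>). source \<eta> t \<xi>)"
proof -
  have "continuous_on ({0..T} \<times> UNIV) (\<lambda>z. \<Sum>k=1..K. \<i> * of_real (\<nu> k) / of_nat (k + 1) * (\<lambda>(t, \<xi>). fourier (\<lambda>p. u t p ^ (k + 1)) (\<xi>, \<eta>)) z)"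
    by (intro continuous_on_sum continuous_on_mult continuous_on_const continuous_on_fourier_power) auto
  thus ?thesis by (simp add: source_def split_def)
qed

text \<open>Bessel's inequality for the difference quotient of \<open>u\<close> minus its time derivative; the chain rule gives the
Fourier transform of the nonlinear term.\<close>

lemma uhat_time_derivative:
  assumes t: "t \<in> {0..T}"
  obtains G where "G \<in> L2 freq"
    "AE q in freq. G q = \<i> * of_real (dispersion (snd q) (fst q)) * uhat t q - of_real (fst q) * source (snd q) t (fst q)"
    "((\<lambda>s. l2norm freq (\<lambda>q. (uhat s q - uhat t q) / of_real (s - t) - G q)) \<longlongrightarrow> 0) (at t within {0..T})"
proof -
  obtain ut hxx hyy ux where
    ut: "L2_tendsto cyl (\<lambda>s p. (u s p - u t p) / of_real (s - t)) ut (at t within {0..T})"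
    and hxx: "is_mult (\<lambda>\<xi> \<eta>. hilbert_symbol \<xi> \<eta> * (dx_symbol \<xi> \<eta>)\<^sup>2) (u t) hxx"
    and hyy: "is_mult (\<lambda>\<xi> \<eta>. hilbert_symbol \<xi> \<eta> * (dy_symbol \<xi> \<eta>)\<^sup>2) (u t) hyy"
    and ux: "is_mult dx_symbol (u t) ux"
    and eq: "AE p in cyl. ut p - hxx p - hyy p + (\<Sum>k=1..K. of_real (\<nu> k) * u t p ^ k * ux p) = 0"
    using sol t unfolding solves_E_def by blast
  obtain F1 where F1: "is_fourier (u t) F1" "is_fourier hxx (\<lambda>(\<xi>, \<eta>). hilbert_symbol \<xi> \<eta> * (dx_symbol \<xi> \<eta>)\<^sup>2 * F1 (\<xi>, \<eta>))"
    using hxx unfolding is_mult_def by auto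
  obtain F2 where F2: "is_fourier (u t) F2" "is_fourier hyy (\<lambda>(\<xi>, \<eta>). hilbert_symbol \<xi> \<eta> * (dy_symbol \<xi> \<eta>)\<^sup>2 * F2 (\<xi>, \<eta>))"
    using hyy unfolding is_mult_def by auto
  obtain F3 where F3: "is_fourier (u t) F3" "is_fourier ux (\<lambda>(\<xi>, \<eta>). dx_symbol \<xi> \<eta> * F3 (\<xi>, \<eta>))"
    using ux unfolding is_mult_def by auto
  define H1 where "H1 = (\<lambda>q. case q of (\<xi>, \<eta>) \<Rightarrow> hilbert_symbol \<xi> \<eta> * (dx_symbol \<xi> \<eta>)\<^sup>2 * F1 (\<xi>, \<eta>))"
  define H2 where "H2 = (\<lambda>q. case q of (\<xi>, \<eta>) \<Rightarrow> hilbert_symbol \<xi> \<eta> * (dy_symbol \<xi> \<eta>)\<^sup>2 * F2 (\<xi>, \<eta>))"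
  have F3': "is_fourier ux (\<lambda>q. \<i> * of_real (fst q) * F3 q)"
  proof -
    have "(\<lambda>(\<xi>, \<eta>). dx_symbol \<xi> \<eta> * F3 (\<xi>, \<eta>)) = (\<lambda>q. \<i> * of_real (fst q) * F3 q)" by (auto simp: dx_symbol_def)
    with F3(2) show ?thesis by simp
  qed
  note F3i = sobolev_integrable[OF u_sobolev[OF t] F3(1) s1 s2]
  note chain = fourier_power_times_deriv[OF F3(1) F3' F3i]
  have utL: "ut \<in> L2 cyl" using ut by (simp add: L2_tendsto_def)
  have um: "u t \<in> borel_measurable cyl" "ux \<in> borel_measurable cyl" "ut \<in> borel_measurable cyl"
    using u_L2[OF t] is_fourier_L2(1)[OF F3'] utL by (auto dest: L2_measurable)
  define N where "N = (\<lambda>p. \<Sum>k=1..K. of_real (\<nu> k) * (u t p ^ k * ux p))"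
  have Nm: "N \<in> borel_measurable cyl" unfolding N_def using um by measurable
  have Ni: "integrable cyl N" unfolding N_def
    by (intro Bochner_Integration.integrable_sum integrable_mult_right chain(2)) auto
  have hL: "hxx \<in> L2 cyl" "hyy \<in> L2 cyl" using F1(2) F2(2) is_fourier_L2(1) by auto
  have eqN: "AE p in cyl. hxx p + hyy p - ut p = N p"
    using eq
  proof eventually_elim
    case (elim p)
    have "N p = (\<Sum>k=1..K. of_real (\<nu> k) * u t p ^ k * ux p)" unfolding N_def by (simp add: mult.assoc)
    thus ?case using elim by (simp add: algebra_simps eq_neg_iff_add_eq_0)
  qed
  have NL: "N \<in> L2 cyl" by (rule L2_cong_AE[OF L2_diff[OF L2_add[OF hL] utL] Nm eqN])
  have FN: "is_fourier N (fourier N)" by (rule is_fourier_integrable[OF NL Ni])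
  have fN: "fourier N q = of_real (fst q) * source (snd q) t (fst q)" for q
  proof -
    obtain \<xi> \<eta> where q: "q = (\<xi>, \<eta>)" by (cases q)
    have "integrable cyl (\<lambda>p. of_real (\<nu> k) * (u t p ^ k * ux p) * cis (- (fst p * \<xi>) - snd p * of_int \<eta>))" if "k \<in> {1..K}" for k
      by (intro integrable_times_cis integrable_mult_right chain(2)) (use that in auto)
    hence "fourier N (\<xi>, \<eta>) = (\<Sum>k=1..K. fourier (\<lambda>p. of_real (\<nu> k) * (u t p ^ k * ux p)) (\<xi>, \<eta>))"
      unfolding N_def fourier_eq by (simp add: sum_distrib_right)
    also have "\<dots> = (\<Sum>k=1..K. of_real (\<nu> k) * fourier (\<lambda>p. u t p ^ k * ux p) (\<xi>, \<eta>))"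
      by (simp only: fourier_cmult)
    also have "\<dots> = (\<Sum>k=1..K. of_real (\<nu> k) * (\<i> * of_real \<xi> / of_nat (k + 1) * fourier (\<lambda>p. u t p ^ (k + 1)) (\<xi>, \<eta>)))"
      by (intro sum.cong refl) (subst chain(3), auto)
    also have "\<dots> = of_real \<xi> * source \<eta> t \<xi>"
      unfolding source_def sum_distrib_left by (intro sum.cong refl) (simp add: mult_ac)
    finally show ?thesis by (simp add: q)
  qed
  define G where "G = (\<lambda>q. H1 q + H2 q - fourier N q)"
  have FG0: "is_fourier (\<lambda>p. hxx p + hyy p - N p) G" unfolding G_def H1_def H2_def
    by (intro is_fourier_diff is_fourier_add F1(2) F2(2) FN)
  have FG: "is_fourier ut G"
  proof (rule is_fourier_cong_AE[OF FG0])
    show "AE p in cyl. hxx p + hyy p - N p = ut p" using eqN by eventually_elim (auto simp: algebra_simps)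
    show "G \<in> borel_measurable freq" using is_fourier_L2(2)[OF FG0] by (rule L2_measurable)
  qed (use um in auto)
  have GL: "G \<in> L2 freq" by (rule is_fourier_L2(2)[OF FG])
  have GA: "AE q in freq. G q = \<i> * of_real (dispersion (snd q) (fst q)) * uhat t q - of_real (fst q) * source (snd q) t (fst q)"
    using is_fourier_unique[OF F1(1) is_fourier_uhat[OF t]] is_fourier_unique[OF F2(1) is_fourier_uhat[OF t]]
  proof eventually_elim
    case (elim q)
    show ?case using elim unfolding G_def fN
      by (cases q) (simp add: H1_def H2_def hilbert_symbol_def dx_symbol_def dy_symbol_def dispersion_def power_mult_distrib algebra_simps)
  qed
  have lim: "((\<lambda>s. l2norm freq (\<lambda>q. (uhat s q - uhat t q) / of_real (s - t) - G q)) \<longlongrightarrow> 0) (at t within {0..T})"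
  proof (rule tendsto_sandwich[OF _ _ tendsto_const])
    define e where "e = (\<lambda>s. l2norm cyl (\<lambda>p. (u s p - u t p) / of_real (s - t) - ut p))"
    have "(e \<longlongrightarrow> 0) (at t within {0..T})" using ut unfolding L2_tendsto_def e_def by blast
    hence "((\<lambda>s. sqrt (8 * pi\<^sup>2) * e s) \<longlongrightarrow> sqrt (8 * pi\<^sup>2) * 0) (at t within {0..T})" by (intro tendsto_intros)
    thus "((\<lambda>s. sqrt (8 * pi\<^sup>2) * e s) \<longlongrightarrow> 0) (at t within {0..T})" by simp
    show "\<forall>\<^sub>F s in at t within {0..T}. l2norm freq (\<lambda>q. (uhat s q - uhat t q) / of_real (s - t) - G q) \<le> sqrt (8 * pi\<^sup>2) * e s"
      unfolding eventually_at_filter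
    proof (rule always_eventually, intro allI impI)
      fix s assume s: "s \<noteq> t" "s \<in> {0..T}"
      have "is_fourier (\<lambda>p. 1 / of_real (s - t) * (u s p - u t p) - ut p) (\<lambda>q. 1 / of_real (s - t) * (uhat s q - uhat t q) - G q)"
        by (intro is_fourier_diff is_fourier_cmult is_fourier_uhat s t FG)
      hence Fs: "is_fourier (\<lambda>p. (u s p - u t p) / of_real (s - t) - ut p) (\<lambda>q. (uhat s q - uhat t q) / of_real (s - t) - G q)"
        by simp
      have "ennreal ((l2norm freq (\<lambda>q. (uhat s q - uhat t q) / of_real (s - t) - G q))\<^sup>2) \<le> ennreal (8 * pi\<^sup>2) * ennreal ((e s)\<^sup>2)"
        using sqnorm_is_fourier_le[OF Fs] unfolding sqnorm_l2norm[OF is_fourier_L2(1)[OF Fs]] sqnorm_l2norm[OF is_fourier_L2(2)[OF Fs]] e_def .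
      hence "(l2norm freq (\<lambda>q. (uhat s q - uhat t q) / of_real (s - t) - G q))\<^sup>2 \<le> 8 * pi\<^sup>2 * (e s)\<^sup>2"
        by (subst (asm) ennreal_mult[symmetric]) (auto simp: ennreal_le_iff)
      also have "\<dots> = (sqrt (8 * pi\<^sup>2) * e s)\<^sup>2" by (simp add: power_mult_distrib)
      finally show "l2norm freq (\<lambda>q. (uhat s q - uhat t q) / of_real (s - t) - G q) \<le> sqrt (8 * pi\<^sup>2) * e s"
        by (rule power2_le_imp_le) (simp add: e_def l2norm_nonneg)
    qed
  qed (rule always_eventually, simp add: l2norm_nonneg)
  show thesis by (rule that[OF GL GA lim])
qed

end

section \<open>Duhamel's formula\<close>

text \<open>The factor \<xi> hides the jump of the phase at \<open>\<xi> = 0\<close>.\<close>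

lemma continuous_on_rotated_frequency:
  "continuous_on UNIV (\<lambda>(t, \<xi>). of_real \<xi> * cis (- (t * dispersion \<eta> \<xi>)))"
proof -
  define g where "g = (\<lambda>(\<sigma>::real) p. complex_of_real (snd p) * cis (\<sigma> * (fst p * ((snd p)\<^sup>2 + (of_int \<eta>)\<^sup>2))))"
  have c: "continuous_on S (g \<sigma>)" for \<sigma> S unfolding g_def by (intro continuous_intros)
  have "continuous_on UNIV (\<lambda>p. if snd p \<le> 0 then g 1 p else g (-1) p)"
    by (rule continuous_on_cases_le[OF c c]) (auto simp: g_def intro: continuous_intros)
  moreover have "(\<lambda>(t, \<xi>). of_real \<xi> * cis (- (t * dispersion \<eta> \<xi>))) = (\<lambda>p. if snd p \<le> 0 then g 1 p else g (-1) p)"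
    by (auto simp: fun_eq_iff g_def dispersion_def sgn_if right_diff_distrib distrib_left)
  ultimately show ?thesis by simp
qed

lemma borel_measurable_dispersion: "dispersion \<eta> \<in> borel_measurable borel"
  unfolding dispersion_def[abs_def] by measurable

context regular_solution
begin

definition rotated_source :: "int \<Rightarrow> real \<Rightarrow> real \<Rightarrow> complex" where
  "rotated_source \<eta> t \<xi> = of_real \<xi> * cis (- (t * dispersion \<eta> \<xi>)) * source \<eta> t \<xi>"

definition duhamel :: "int \<Rightarrow> real \<Rightarrow> real \<Rightarrow> real \<Rightarrow> complex" where
  "duhamel \<eta> t1 t2 \<xi> = integral {t1..t2} (\<lambda>t. rotated_source \<eta> t \<xi>)"

lemma continuous_on_rotated_source: "continuous_on ({0..T} \<times> UNIV) (\<lambda>(t, \<xi>). rotated_source \<eta> t \<xi>)"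
proof -
  have "continuous_on ({0..T} \<times> UNIV) (\<lambda>z. (\<lambda>(t, \<xi>). of_real \<xi> * cis (- (t * dispersion \<eta> \<xi>))) z * (\<lambda>(t, \<xi>). source \<eta> t \<xi>) z)"
    by (intro continuous_on_mult continuous_on_source continuous_on_subset[OF continuous_on_rotated_frequency]) simp
  thus ?thesis by (simp add: rotated_source_def split_def)
qed

lemma continuous_on_duhamel:
  assumes t: "t1 \<in> {0..T}" "t2 \<in> {0..T}"
  shows "continuous_on UNIV (duhamel \<eta> t1 t2)"
proof -
  have "continuous_on (UNIV \<times> cbox t1 t2) (\<lambda>(\<xi>, t). (\<lambda>(t, \<xi>). rotated_source \<eta> t \<xi>) (t, \<xi>))"
    unfolding split_def
    by (rule continuous_on_compose2[OF continuous_on_rotated_source[unfolded split_def]]) (use t in \<open>auto intro!: continuous_intros\<close>)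
  hence "continuous_on (UNIV \<times> cbox t1 t2) (\<lambda>(\<xi>, t). rotated_source \<eta> t \<xi>)" by simp
  from integral_continuous_on_param[OF this] show ?thesis unfolding duhamel_def[abs_def] by simp
qed

lemma duhamel_zero: "duhamel \<eta> t1 t2 0 = 0"
  by (simp add: duhamel_def rotated_source_def)

text \<open>Rotation by \<open>cis (- (s * dispersion \<eta> \<xi>))\<close> removes the linear part of the equation.\<close>

lemma rotated_uhat_integral_derivative:
  assumes t: "t \<in> {0..T}" and ab: "a \<le> b"
  shows "((\<lambda>s. LINT \<xi>:{a..b}|lborel. cis (- (s * dispersion \<eta> \<xi>)) * uhat s (\<xi>, \<eta>)) has_vector_derivative
    - integral {a..b} (rotated_source \<eta> t)) (at t within {0..T})"
proof -
  obtain G where GL: "G \<in> L2 freq"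
    and GA: "AE q in freq. G q = \<i> * of_real (dispersion (snd q) (fst q)) * uhat t q - of_real (fst q) * source (snd q) t (fst q)"
    and lim: "((\<lambda>s. l2norm freq (\<lambda>q. (uhat s q - uhat t q) / of_real (s - t) - G q)) \<longlongrightarrow> 0) (at t within {0..T})"
    by (rule uhat_time_derivative[OF t])
  have EL: "(\<lambda>q. (uhat s q - uhat t q) / of_real (s - t) - G q) \<in> L2 freq" if "s \<in> {0..T}" for s
    using L2_diff[OF L2_cmult[OF L2_diff[OF uhat_L2[OF that] uhat_L2[OF t]], of "1 / of_real (s - t)"] GL] by simp
  define M where "M = (max \<bar>a\<bar> \<bar>b\<bar>)\<^sup>2 + (real_of_int \<eta>)\<^sup>2"
  have M: "\<bar>dispersion \<eta> \<xi>\<bar> \<le> M" if "\<xi> \<in> {a..b}" for \<xi>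
  proof -
    have "\<bar>\<xi>\<bar> \<le> max \<bar>a\<bar> \<bar>b\<bar>" using that by auto
    hence "\<bar>\<xi>\<bar>\<^sup>2 \<le> (max \<bar>a\<bar> \<bar>b\<bar>)\<^sup>2" by (intro power_mono) auto
    hence "\<xi>\<^sup>2 + (real_of_int \<eta>)\<^sup>2 \<le> M" by (simp add: M_def)
    moreover have "\<bar>dispersion \<eta> \<xi>\<bar> \<le> \<xi>\<^sup>2 + (real_of_int \<eta>)\<^sup>2"
      by (simp add: dispersion_def abs_mult sgn_if)
    ultimately show ?thesis by linarith
  qed
  have d: "((\<lambda>s. LINT \<xi>:{a..b}|lborel. cis (- (s * dispersion \<eta> \<xi>)) * uhat s (\<xi>, \<eta>)) has_vector_derivative
     (LINT \<xi>:{a..b}|lborel. cis (- (t * dispersion \<eta> \<xi>)) * (G (\<xi>, \<eta>) - \<i> * of_real (dispersion \<eta> \<xi>) * uhat t (\<xi>, \<eta>)))) (at t within {0..T})"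
  proof (rule rotated_integral_derivative[OF t _ _ _ borel_measurable_dispersion M ab])
    show "(\<lambda>\<xi>. uhat s (\<xi>, \<eta>)) \<in> L2 lborel" if "s \<in> {0..T}" for s by (rule L2_section(1)[OF uhat_L2[OF that]])
    show "(\<lambda>\<xi>. G (\<xi>, \<eta>)) \<in> L2 lborel" by (rule L2_section(1)[OF GL])
    show "((\<lambda>s. l2norm lborel (\<lambda>\<xi>. (uhat s (\<xi>, \<eta>) - uhat t (\<xi>, \<eta>)) / complex_of_real (s - t) - G (\<xi>, \<eta>))) \<longlongrightarrow> 0) (at t within {0..T})"
    proof (rule tendsto_sandwich[OF _ _ tendsto_const lim])
      show "\<forall>\<^sub>F s in at t within {0..T}. 0 \<le> l2norm lborel (\<lambda>\<xi>. (uhat s (\<xi>, \<eta>) - uhat t (\<xi>, \<eta>)) / complex_of_real (s - t) - G (\<xi>, \<eta>))"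
        by (rule always_eventually) (simp add: l2norm_nonneg)
      show "\<forall>\<^sub>F s in at t within {0..T}. l2norm lborel (\<lambda>\<xi>. (uhat s (\<xi>, \<eta>) - uhat t (\<xi>, \<eta>)) / complex_of_real (s - t) - G (\<xi>, \<eta>))
          \<le> l2norm freq (\<lambda>q. (uhat s q - uhat t q) / complex_of_real (s - t) - G q)"
        unfolding eventually_at_filter by (rule always_eventually) (blast intro: L2_section(2)[OF EL])
    qed
  qed
  have cQ: "continuous_on UNIV (rotated_source \<eta> t)"
    using continuous_on_compose2[OF continuous_on_rotated_source[of \<eta>, unfolded split_def], of UNIV "\<lambda>\<xi>. (t, \<xi>)"] t
    by (simp add: continuous_on_Pair image_subset_iff eta_contract_eq)
  have "(LINT \<xi>:{a..b}|lborel. cis (- (t * dispersion \<eta> \<xi>)) * (G (\<xi>, \<eta>) - \<i> * of_real (dispersion \<eta> \<xi>) * uhat t (\<xi>, \<eta>)))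
      = (LINT \<xi>:{a..b}|lborel. - rotated_source \<eta> t \<xi>)"
  proof (rule set_lebesgue_integral_cong_AE)
    have "(\<lambda>\<xi>. G (\<xi>, \<eta>)) \<in> borel_measurable borel" "(\<lambda>\<xi>. uhat t (\<xi>, \<eta>)) \<in> borel_measurable borel"
      by (intro measurable_section_freq L2_measurable GL uhat_L2 t)+
    thus "(\<lambda>\<xi>. cis (- (t * dispersion \<eta> \<xi>)) * (G (\<xi>, \<eta>) - \<i> * of_real (dispersion \<eta> \<xi>) * uhat t (\<xi>, \<eta>))) \<in> borel_measurable lborel"
      using borel_measurable_dispersion[of \<eta>] by simp
    show "(\<lambda>\<xi>. - rotated_source \<eta> t \<xi>) \<in> borel_measurable lborel"
      using borel_measurable_continuous_onI[OF cQ] by simp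
    show "AE \<xi>\<in>{a..b} in lborel. cis (- (t * dispersion \<eta> \<xi>)) * (G (\<xi>, \<eta>) - \<i> * of_real (dispersion \<eta> \<xi>) * uhat t (\<xi>, \<eta>)) = - rotated_source \<eta> t \<xi>"
      using AE_freq_section[OF GA, of \<eta>] by eventually_elim (simp add: rotated_source_def)
  qed simp
  also have "\<dots> = - (LINT \<xi>:{a..b}|lborel. rotated_source \<eta> t \<xi>)" by (simp add: set_lebesgue_integral_def)
  also have "(LINT \<xi>:{a..b}|lborel. rotated_source \<eta> t \<xi>) = integral {a..b} (rotated_source \<eta> t)"
    by (intro set_borel_integral_eq_integral(2) borel_integrable_atLeastAtMost' continuous_on_subset[OF cQ]) simp
  finally show ?thesis using d by simp
qed

text \<open>Integrate \<open>cis(-s m) uhat(s)\<close> over an interval in \<xi>. The result is differentiable in \<open>s\<close>, and the fundamental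
theorem of calculus together with an exchange of integrals identifies the integral over that interval of
both sides. The interval being arbitrary, the sides agree almost everywhere.\<close>

theorem duhamel_formula:
  assumes t1: "t1 \<in> {0..T}" and t2: "t2 \<in> {0..T}" and le: "t1 \<le> t2"
  shows "AE \<xi> in lborel. cis (- (t2 * dispersion \<eta> \<xi>)) * uhat t2 (\<xi>, \<eta>)
    = cis (- (t1 * dispersion \<eta> \<xi>)) * uhat t1 (\<xi>, \<eta>) - duhamel \<eta> t1 t2 \<xi>"
proof -
  define V where "V = (\<lambda>s \<xi>. cis (- (s * dispersion \<eta> \<xi>)) * uhat s (\<xi>, \<eta>))"
  have Vi: "set_integrable lborel {a..b} (V s)" if "s \<in> {0..T}" for s a b
    unfolding V_def
    by (rule set_integrable_times_bounded[where C=1])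
       (use borel_measurable_dispersion[of \<eta>] in \<open>auto intro: L2_set_integrable L2_section(1) uhat_L2 that\<close>)
  have Ji: "set_integrable lborel {a..b} (duhamel \<eta> t1 t2)" for a b
    by (intro borel_integrable_atLeastAtMost' continuous_on_subset[OF continuous_on_duhamel[OF t1 t2]]) simp
  have "AE \<xi> in lborel. V t2 \<xi> - V t1 \<xi> + duhamel \<eta> t1 t2 \<xi> = 0"
  proof (rule AE_zero_if_interval_integrals_zero)
    fix a b :: real
    show "set_integrable lborel {a..b} (\<lambda>\<xi>. V t2 \<xi> - V t1 \<xi> + duhamel \<eta> t1 t2 \<xi>)"
      by (intro set_integral_add(1) set_integral_diff(1) Vi Ji t1 t2)
    assume ab: "a \<le> b"
    define W where "W = (\<lambda>s. LINT \<xi>:{a..b}|lborel. V s \<xi>)"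
    have "((\<lambda>s. - integral {a..b} (rotated_source \<eta> s)) has_integral (W t2 - W t1)) {t1..t2}"
    proof (rule fundamental_theorem_of_calculus[OF le])
      fix s assume "s \<in> {t1..t2}"
      hence s: "s \<in> {0..T}" using t1 t2 by auto
      have "{t1..t2} \<subseteq> {0..T}" using t1 t2 by auto
      thus "(W has_vector_derivative - integral {a..b} (rotated_source \<eta> s)) (at s within {t1..t2})"
        using rotated_uhat_integral_derivative[OF s ab, of \<eta>] unfolding W_def V_def
        by (blast intro: has_vector_derivative_within_subset)
    qed
    hence "integral {t1..t2} (\<lambda>s. - integral {a..b} (rotated_source \<eta> s)) = W t2 - W t1" by (rule integral_unique)
    hence e1: "integral {t1..t2} (\<lambda>s. integral {a..b} (rotated_source \<eta> s)) = W t1 - W t2"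
      by (simp add: minus_equation_iff[of _ "W t2 - W t1"])
    have "continuous_on (cbox (t1, a) (t2, b)) (\<lambda>(s, \<xi>). rotated_source \<eta> s \<xi>)"
      by (rule continuous_on_subset[OF continuous_on_rotated_source]) (use t1 t2 in \<open>auto simp: cbox_Pair_eq\<close>)
    from integral_swap_continuous[OF this]
    have "integral {a..b} (duhamel \<eta> t1 t2) = W t1 - W t2"
      unfolding duhamel_def[abs_def] using e1 by simp
    hence "(LINT \<xi>:{a..b}|lborel. duhamel \<eta> t1 t2 \<xi>) = W t1 - W t2"
      using set_borel_integral_eq_integral(2)[OF Ji] by simp
    moreover have "(LINT \<xi>:{a..b}|lborel. V t2 \<xi> - V t1 \<xi>) = W t2 - W t1"
      unfolding W_def by (rule set_integral_diff(2)[OF Vi[OF t2] Vi[OF t1]])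
    ultimately show "(LINT \<xi>:{a..b}|lborel. V t2 \<xi> - V t1 \<xi> + duhamel \<eta> t1 t2 \<xi>) = 0"
      using set_integral_add(2)[OF set_integral_diff(1)[OF Vi[OF t2] Vi[OF t1]] Ji] by simp
  qed
  thus ?thesis unfolding V_def by eventually_elim (simp add: algebra_simps)
qed

end

section \<open>Decay in space and regularity of the Fourier transform\<close>

lemma AE_lborel_exists:
  fixes a b :: real
  assumes "AE x in lborel. Q x" "a < b"
  obtains x where "x \<in> {a<..<b}" "Q x"
proof -
  have "\<exists>x\<in>{a<..<b}. Q x"
  proof (rule ccontr)
    assume "\<not> ?thesis"
    with assms(1) have "AE x in lborel. x \<notin> {a<..<b}" by (auto elim!: eventually_mono)
    moreover have "{a<..<b} \<in> sets lborel" by simp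
    ultimately have "{a<..<b} \<in> null_sets lborel" using AE_iff_null_sets by blast
    hence "emeasure lborel {a<..<b} = 0" by (rule null_setsD1)
    thus False using assms(2) by simp
  qed
  thus thesis using that by blast
qed

lemma continuous_AE_zero:
  fixes f :: "real \<Rightarrow> complex"
  assumes c: "continuous_on S f" and S: "open S" and ae: "AE x in lborel. f x = 0" and x: "x \<in> S"
  shows "f x = 0"
proof (rule ccontr)
  assume nz: "f x \<noteq> 0"
  have "open (S \<inter> f -` (- {0}))" by (rule continuous_open_preimage[OF c S]) (simp add: open_Compl)
  moreover have "x \<in> S \<inter> f -` (- {0})" using nz x by simp
  ultimately obtain e where e: "e > 0" "ball x e \<subseteq> S \<inter> f -` (- {0})" by (rule openE)
  have "x < x + e" using e(1) by simp
  from AE_lborel_exists[OF ae this] obtain y where y: "y \<in> {x<..<x+e}" "f y = 0" by blast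
  hence "y \<in> ball x e" by (simp add: dist_real_def)
  hence "f y \<noteq> 0" using e(2) by blast
  thus False using y(2) by simp
qed

text \<open>The square of the weight that the Cauchy-Schwarz inequality leaves when \<open>|x|^j f\<close> is compared with
\<open>f\<close> in \<open>L\<^sup>2(1 + |x|^a)\<close>.\<close>

lemma integrable_power_decay:
  assumes a: "a > 2 * real j + 1"
  shows "integrable lborel (\<lambda>x::real. \<bar>x\<bar> ^ (2 * j) / (1 + \<bar>x\<bar> powr a))"
proof -
  define h where "h = (\<lambda>x::real. \<bar>x\<bar> ^ (2 * j) / (1 + \<bar>x\<bar> powr a))"
  define g where "g = (\<lambda>x::real. indicator {1..} x * x powr (2 * real j - a))"
  have e: "2 * real j - a < -1" using a by simp
  have "((\<lambda>x. x powr (2 * real j - a)) has_integral -(1 powr (2 * real j - a + 1)) / (2 * real j - a + 1)) {1..}"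
    by (rule has_integral_powr_to_inf) (use e in auto)
  hence "(\<lambda>x. x powr (2 * real j - a)) absolutely_integrable_on {1..}"
    by (intro nonnegative_absolutely_integrable_1) (auto simp: integrable_on_def)
  hence "integrable lebesgue g" by (simp add: set_integrable_def g_def)
  moreover have "g \<in> borel_measurable borel" unfolding g_def by measurable
  ultimately have g: "integrable lborel g" by (simp add: integrable_completion)
  have g': "integrable lborel (\<lambda>x. g (- x))" using lborel_integrable_real_affine[OF g, of "-1" 0] by simp
  have i: "integrable lborel (indicator {-1..1} :: real \<Rightarrow> real)" by (intro integrable_real_indicator) auto
  show ?thesis unfolding h_def[symmetric]
  proof (rule Bochner_Integration.integrable_bound)
    show "integrable lborel (\<lambda>x. indicator {-1..1} x + g x + g (- x))" using i g g' by auto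
    have "h \<in> borel_measurable borel" unfolding h_def by measurable
    thus "h \<in> borel_measurable lborel" by simp
    show "AE x in lborel. norm (h x) \<le> norm (indicator {-1..1} x + g x + g (- x))"
    proof (rule AE_I2)
      fix x :: real
      have g0: "g y \<ge> 0" for y by (simp add: g_def)
      have h0: "h x \<ge> 0" unfolding h_def by (intro divide_nonneg_nonneg add_nonneg_nonneg) auto
      have "h x \<le> indicator {-1..1} x + g x + g (- x)"
      proof (cases "\<bar>x\<bar> \<le> 1")
        case True
        have "h x \<le> 1 / 1" unfolding h_def using True by (intro frac_le) (auto simp: power_le_one)
        moreover have "indicator {-1..1} x = (1::real)" using True by (auto simp: indicator_def)
        ultimately show ?thesis using g0[of x] g0[of "-x"] by simp
      next
        case False
        hence x: "\<bar>x\<bar> > 1" by simp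
        have "h x \<le> \<bar>x\<bar> ^ (2 * j) / (\<bar>x\<bar> powr a)" unfolding h_def using x by (intro divide_left_mono mult_pos_pos add_pos_nonneg) auto
        also have "\<bar>x\<bar> ^ (2 * j) = \<bar>x\<bar> powr (2 * real j)" using x by (simp add: powr_realpow[symmetric])
        also have "\<bar>x\<bar> powr (2 * real j) / (\<bar>x\<bar> powr a) = \<bar>x\<bar> powr (2 * real j - a)" by (simp add: powr_diff)
        also have "\<dots> \<le> g x + g (- x)" using x by (auto simp: g_def indicator_def)
        finally show ?thesis using False by (simp add: indicator_def)
      qed
      thus "norm (h x) \<le> norm (indicator {-1..1} x + g x + g (- x))" using h0 by simp
    qed
  qed
qed

text \<open>The Cauchy-Schwarz inequality with the weight \<open>1 + |x|^a\<close>; beyond the exponent \<open>2 j + 1\<close> the function of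
the previous lemma is integrable.\<close>

lemma weighted_L2_integrable:
  assumes f: "f \<in> L2 cyl" and fw: "f \<in> L2 (wcyl a)" and a: "a > 2 * real j + 1"
  shows "integrable cyl (\<lambda>p. f p * of_real (fst p) ^ j)"
proof -
  have fm[measurable]: "f \<in> borel_measurable cyl" using f by (rule L2_measurable)
  have w: "integrable cyl (\<lambda>p. (\<bar>fst p\<bar> powr a) * (cmod (f p))\<^sup>2)"
  proof -
    have [measurable]: "(\<lambda>p. \<bar>fst p\<bar> powr a) \<in> borel_measurable cyl" by measurable
    have "integrable (density cyl (\<lambda>p. ennreal (\<bar>fst p\<bar> powr a))) (\<lambda>p. (cmod (f p))\<^sup>2)"
      using fw by (simp add: L2_def wcyl_def)
    thus ?thesis by (subst (asm) integrable_density) auto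
  qed
  have h: "integrable cyl (\<lambda>p. \<bar>fst p\<bar> ^ (2 * j) / (1 + \<bar>fst p\<bar> powr a))"
  proof -
    have "integrable (lborel \<Otimes>\<^sub>M tor) (\<lambda>p. complex_of_real (\<bar>fst p\<bar> ^ (2 * j) / (1 + \<bar>fst p\<bar> powr a)) * (\<lambda>_. 1) (snd p))"
      by (rule torus_pair.integrable_fst_times_snd[OF integrable_of_real[OF integrable_power_decay[OF a]]]) simp
    hence "integrable cyl (\<lambda>p. complex_of_real (\<bar>fst p\<bar> ^ (2 * j) / (1 + \<bar>fst p\<bar> powr a)))" by (simp add: cyl_eq)
    thus ?thesis by (simp only: complex_of_real_integrable_eq)
  qed
  show ?thesis
  proof (rule Bochner_Integration.integrable_bound)
    show "integrable cyl (\<lambda>p. ((cmod (f p))\<^sup>2 + (\<bar>fst p\<bar> powr a) * (cmod (f p))\<^sup>2) + \<bar>fst p\<bar> ^ (2 * j) / (1 + \<bar>fst p\<bar> powr a))"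
      by (intro Bochner_Integration.integrable_add L2_integrable[OF f] w h)
    show "(\<lambda>p. f p * of_real (fst p) ^ j) \<in> borel_measurable cyl" by measurable
    show "AE p in cyl. norm (f p * of_real (fst p) ^ j) \<le> norm (((cmod (f p))\<^sup>2 + (\<bar>fst p\<bar> powr a) * (cmod (f p))\<^sup>2) + \<bar>fst p\<bar> ^ (2 * j) / (1 + \<bar>fst p\<bar> powr a))"
    proof (rule AE_I2)
      fix p :: "real \<times> real"
      define r where "r = 1 + \<bar>fst p\<bar> powr a"
      have r: "r > 0" by (simp add: r_def add_pos_nonneg)
      have "norm (f p * of_real (fst p) ^ j) = (cmod (f p) * sqrt r) * (\<bar>fst p\<bar> ^ j / sqrt r)"
        using r by (simp add: norm_mult norm_power)
      also have "\<dots> \<le> 2 * (cmod (f p) * sqrt r) * (\<bar>fst p\<bar> ^ j / sqrt r)" using r by simp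
      also have "\<dots> \<le> (cmod (f p) * sqrt r)\<^sup>2 + (\<bar>fst p\<bar> ^ j / sqrt r)\<^sup>2" by (rule sum_squares_bound)
      also have "\<dots> = (cmod (f p))\<^sup>2 * r + \<bar>fst p\<bar> ^ (2 * j) / r" using r by (simp add: power_mult_distrib power_divide power_mult mult.commute[of 2 j])
      also have "\<dots> = ((cmod (f p))\<^sup>2 + (\<bar>fst p\<bar> powr a) * (cmod (f p))\<^sup>2) + \<bar>fst p\<bar> ^ (2 * j) / r"
        by (simp add: r_def algebra_simps)
      also have "\<dots> \<le> norm \<dots>" by simp
      finally show "norm (f p * of_real (fst p) ^ j) \<le> norm (((cmod (f p))\<^sup>2 + (\<bar>fst p\<bar> powr a) * (cmod (f p))\<^sup>2) + \<bar>fst p\<bar> ^ (2 * j) / (1 + \<bar>fst p\<bar> powr a))"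
        unfolding r_def .
    qed
  qed
qed

text \<open>The exponents 1 and 3 are the thresholds for the moments of order 0 and 1.\<close>

lemma L2_plus_integrable:
  assumes f: "f \<in> L2 cyl"
  shows "f \<in> L2_plus 1 \<Longrightarrow> integrable cyl f"
    "f \<in> L2_plus 3 \<Longrightarrow> integrable cyl f"
    "f \<in> L2_plus 3 \<Longrightarrow> integrable cyl (\<lambda>p. f p * of_real (fst p))"
proof -
  show "integrable cyl f" if "f \<in> L2_plus 1"
    using that weighted_L2_integrable[OF f, of _ 0] by (auto simp: L2_plus_def)
  show "integrable cyl f" if "f \<in> L2_plus 3"
    using that weighted_L2_integrable[OF f, of _ 0] by (auto simp: L2_plus_def)
  show "integrable cyl (\<lambda>p. f p * of_real (fst p))" if "f \<in> L2_plus 3"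
    using that weighted_L2_integrable[OF f, of _ 1] by (auto simp: L2_plus_def)
qed

lemma fourier_has_vector_derivative:
  assumes f: "integrable cyl f" and xf: "integrable cyl (\<lambda>p. f p * of_real (fst p))"
  shows "((\<lambda>\<xi>. fourier f (\<xi>, \<eta>)) has_vector_derivative
    - \<i> * (\<integral>p. f p * of_real (fst p) * cis (- (fst p * \<xi>) - snd p * of_int \<eta>) \<partial>cyl)) (at \<xi>)"
proof -
  have xf': "integrable cyl (\<lambda>p. f p * of_real (- fst p))" using xf by simp
  have d: "((\<lambda>\<xi>. \<integral>p. f p * cis (\<xi> * (- fst p) + (- (snd p * of_int \<eta>))) \<partial>cyl) has_vector_derivative
      (\<integral>p. (f p * of_real (- fst p)) * (\<i> * cis (\<xi> * (- fst p) + (- (snd p * of_int \<eta>)))) \<partial>cyl)) (at \<xi>)"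
    by (rule has_vector_derivative_integral_cis[OF f xf']) measurable
  have e: "(\<lambda>\<xi>. \<integral>p. f p * cis (\<xi> * (- fst p) + (- (snd p * of_int \<eta>))) \<partial>cyl) = (\<lambda>\<xi>. fourier f (\<xi>, \<eta>))"
    by (rule ext) (simp add: fourier_eq mult.commute)
  have "(\<integral>p. (f p * of_real (- fst p)) * (\<i> * cis (\<xi> * (- fst p) + (- (snd p * of_int \<eta>)))) \<partial>cyl)
     = (\<integral>p. - \<i> * (f p * of_real (fst p) * cis (- (fst p * \<xi>) - snd p * of_int \<eta>)) \<partial>cyl)"
    by (rule Bochner_Integration.integral_cong) (simp_all add: mult_ac)
  also have "\<dots> = - \<i> * (\<integral>p. f p * of_real (fst p) * cis (- (fst p * \<xi>) - snd p * of_int \<eta>) \<partial>cyl)"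
    by (rule integral_mult_right_zero)
  finally show ?thesis using d unfolding e by (simp only:)
qed

section \<open>Two times of decay\<close>

context regular_solution
begin

lemma continuous_on_source_section: "continuous_on {0..T} (\<lambda>t. source \<eta> t 0)"
  by (rule continuous_on_compose2[OF continuous_on_source[of \<eta>, unfolded split_def], of _ "\<lambda>t. (t, 0)", simplified])
     (auto intro!: continuous_intros)

lemma source_bounded: "\<exists>C. \<forall>t\<in>{0..T}. cmod (source \<eta> t 0) \<le> C"
proof -
  have "compact ((\<lambda>t. source \<eta> t 0) ` {0..T})" by (intro compact_continuous_image continuous_on_source_section) auto
  hence "bounded ((\<lambda>t. source \<eta> t 0) ` {0..T})" by (rule compact_imp_bounded)
  thus ?thesis unfolding bounded_iff by auto
qed

text \<open>For integrable data both sides are continuous in \<xi> away from the jump of the phase at 0.\<close>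

lemma duhamel_formula_pointwise:
  assumes t: "t1 \<in> {0..T}" "t2 \<in> {0..T}" "t1 \<le> t2"
    and i: "integrable cyl (u t1)" "integrable cyl (u t2)" and nz: "\<xi> \<noteq> 0"
  shows "cis (- (t2 * dispersion \<eta> \<xi>)) * fourier (u t2) (\<xi>, \<eta>)
    = cis (- (t1 * dispersion \<eta> \<xi>)) * fourier (u t1) (\<xi>, \<eta>) - duhamel \<eta> t1 t2 \<xi>"
proof -
  define Z where "Z = (\<lambda>\<xi>. cis (- (t2 * dispersion \<eta> \<xi>)) * fourier (u t2) (\<xi>, \<eta>)
    - (cis (- (t1 * dispersion \<eta> \<xi>)) * fourier (u t1) (\<xi>, \<eta>) - duhamel \<eta> t1 t2 \<xi>))"
  have "continuous_on (- {0::real}) (\<lambda>x. sgn x)"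
    by (intro continuous_at_imp_continuous_on ballI) (simp add: isCont_sgn)
  hence "continuous_on (- {0}) (dispersion \<eta>)" unfolding dispersion_def[abs_def] by (intro continuous_intros) auto
  hence Zc: "continuous_on (- {0}) Z" unfolding Z_def
    by (intro continuous_intros continuous_on_subset[OF continuous_on_fourier[OF i(1)]]
        continuous_on_subset[OF continuous_on_fourier[OF i(2)]] continuous_on_subset[OF continuous_on_duhamel[OF t(1,2)]]) auto
  have Zae: "AE \<xi> in lborel. Z \<xi> = 0"
    using duhamel_formula[OF t, of \<eta>] uhat_eq_fourier[OF t(1) i(1), of \<eta>] uhat_eq_fourier[OF t(2) i(2), of \<eta>]
    by eventually_elim (simp add: Z_def)
  have "Z \<xi> = 0" by (rule continuous_AE_zero[OF Zc _ Zae]) (use nz in auto)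
  thus ?thesis by (simp add: Z_def)
qed

end

text \<open>The hypotheses are the limits of Duhamel's formula at \<open>\<xi> = 0\<close> from the right and from the left, with
\<open>A\<close> and \<open>B\<close> the Fourier transforms, or their derivatives, at the two times; \<open>B\<close> is eliminated.\<close>

lemma cis_opposite_phases_eq:
  fixes A B :: complex
  assumes "cis (- b) * B = cis (- a) * A - P" "cis b * B = cis a * A - Q"
  shows "of_real (2 * sin (b - a)) * \<i> * A = cis b * P - cis (- b) * Q"
proof -
  have 1: "B = cis (b - a) * A - cis b * P"
  proof -
    have "B = cis b * (cis (- b) * B)" by (simp add: cis_mult mult.assoc[symmetric])
    thus ?thesis unfolding assms(1) by (simp add: right_diff_distrib cis_mult mult.assoc[symmetric])
  qed
  have 2: "B = cis (- (b - a)) * A - cis (- b) * Q"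
  proof -
    have "B = cis (- b) * (cis b * B)" by (simp add: cis_mult mult.assoc[symmetric])
    thus ?thesis unfolding assms(2) by (simp add: right_diff_distrib cis_mult mult.assoc[symmetric])
  qed
  have "cis d - cis (- d) = of_real (2 * sin d) * \<i>" for d by (simp add: complex_eq_iff)
  from this[of "b - a"] have c: "cis (b - a) - cis (- (b - a)) = of_real (2 * sin (b - a)) * \<i>" .
  have "(cis (b - a) - cis (- (b - a))) * A = cis b * P - cis (- b) * Q" using 1 2 by (simp add: algebra_simps)
  thus ?thesis unfolding c by simp
qed

lemma continuous_on_UNIV_tendsto:
  fixes f :: "real \<Rightarrow> 'a::topological_space"
  shows "continuous_on UNIV f \<Longrightarrow> (f \<longlongrightarrow> f a) (at a)"
  by (simp add: continuous_on_eq_continuous_at isContD)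

text \<open>The sign \<open>\<sigma>\<close> of \<open>\<xi>\<close> selects the side from which 0 is approached, so that one argument covers both limits.\<close>

lemma tendsto_one_sided:
  fixes f :: "real \<Rightarrow> complex"
  assumes "continuous_on UNIV g" "\<And>\<xi>. 0 < \<sigma> * \<xi> \<Longrightarrow> f \<xi> = g \<xi>" "(f \<longlongrightarrow> L) (at 0 within {\<xi>. 0 < \<sigma> * \<xi>})" "\<sigma> \<noteq> 0"
  shows "L = g 0"
proof (rule tendsto_unique)
  have "at 0 within {\<xi>. 0 < \<sigma> * \<xi>} \<noteq> bot"
  proof (cases "\<sigma> > 0")
    case True
    hence "{\<xi>. 0 < \<sigma> * \<xi>} = {0<..}" by (auto simp: zero_less_mult_iff)
    thus ?thesis by simp
  next
    case False
    hence "{\<xi>. 0 < \<sigma> * \<xi>} = {..<0}" using assms(4) by (auto simp: zero_less_mult_iff)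
    thus ?thesis by simp
  qed
  thus "\<not> trivial_limit (at (0::real) within {\<xi>. 0 < \<sigma> * \<xi>})" .
  show "(f \<longlongrightarrow> L) (at 0 within {\<xi>. 0 < \<sigma> * \<xi>})" by fact
  have "(g \<longlongrightarrow> g 0) (at 0)" using assms(1) by (simp add: continuous_on_eq_continuous_at isContD)
  hence "(g \<longlongrightarrow> g 0) (at 0 within {\<xi>. 0 < \<sigma> * \<xi>})" by (rule tendsto_within_subset[OF _ subset_UNIV])
  moreover have "\<forall>\<^sub>F \<xi> in at 0 within {\<xi>. 0 < \<sigma> * \<xi>}. g \<xi> = f \<xi>"
    unfolding eventually_at_filter using assms(2) by (intro always_eventually) auto
  ultimately show "(f \<longlongrightarrow> g 0) (at 0 within {\<xi>. 0 < \<sigma> * \<xi>})" by (rule Lim_transform_eventually)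
qed

context regular_solution
begin

text \<open>The phase of Duhamel's formula jumps at \<open>\<xi> = 0\<close> while the Fourier transforms and the Duhamel term are
continuous there, and the Duhamel term vanishes at 0.\<close>

lemma sin_times_mean:
  assumes t: "t1 \<in> {0..T}" "t2 \<in> {0..T}" "t1 \<le> t2" and i: "integrable cyl (u t1)" "integrable cyl (u t2)"
  shows "of_real (sin ((t2 - t1) * (of_int \<eta>)\<^sup>2)) * fourier (u t1) (0, \<eta>) = 0"
proof -
  define n where "n = (real_of_int \<eta>)\<^sup>2"
  define c1 where "c1 = (\<lambda>\<xi>. fourier (u t1) (\<xi>, \<eta>))"
  define c2 where "c2 = (\<lambda>\<xi>. fourier (u t2) (\<xi>, \<eta>))"
  have cc: "continuous_on UNIV c1" "continuous_on UNIV c2" unfolding c1_def c2_def by (intro continuous_on_fourier i)+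
  have cJ: "continuous_on UNIV (duhamel \<eta> t1 t2)" by (rule continuous_on_duhamel[OF t(1,2)])
  have eq: "cis (- (t2 * (\<sigma> * n))) * c2 0 = cis (- (t1 * (\<sigma> * n))) * c1 0 - 0" if \<sigma>: "\<sigma> = 1 \<or> \<sigma> = -1" for \<sigma> :: real
  proof -
    let ?f = "\<lambda>\<xi>. cis (- (t2 * (\<sigma> * (\<xi>\<^sup>2 + n)))) * c2 \<xi>"
    let ?g = "\<lambda>\<xi>. cis (- (t1 * (\<sigma> * (\<xi>\<^sup>2 + n)))) * c1 \<xi> - duhamel \<eta> t1 t2 \<xi>"
    have "?f 0 = ?g 0"
    proof (rule tendsto_one_sided[of ?g \<sigma> ?f])
      show "continuous_on UNIV ?g" by (intro continuous_intros cc cJ)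
      show "?f \<xi> = ?g \<xi>" if "0 < \<sigma> * \<xi>" for \<xi>
      proof -
        have "dispersion \<eta> \<xi> = \<sigma> * (\<xi>\<^sup>2 + n)" "\<xi> \<noteq> 0" using that \<sigma> by (auto simp: dispersion_def n_def sgn_if)
        thus ?thesis using duhamel_formula_pointwise[OF t i, of \<xi> \<eta>] by (simp add: c1_def c2_def)
      qed
      have "continuous_on UNIV ?f" by (intro continuous_intros cc)
      hence "(?f \<longlongrightarrow> ?f 0) (at 0)" by (rule continuous_on_UNIV_tendsto)
      thus "(?f \<longlongrightarrow> ?f 0) (at 0 within {\<xi>. 0 < \<sigma> * \<xi>})" by (rule tendsto_within_subset) simp
    qed (use \<sigma> in auto)
    thus ?thesis by (simp add: duhamel_zero)
  qed
  have "of_real (2 * sin (t2 * n - t1 * n)) * \<i> * c1 0 = cis (t2 * n) * 0 - cis (- (t2 * n)) * 0"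
    by (rule cis_opposite_phases_eq[of _ "c2 0"]) (use eq[of 1] eq[of "-1"] in simp_all)
  hence "of_real (sin (t2 * n - t1 * n)) * c1 0 = 0" by simp
  thus ?thesis by (simp add: c1_def n_def left_diff_distrib)
qed

text \<open>By Duhamel's formula \<open>uhat(t2)\<close> is bounded, for almost every \<xi>, by the sum of two continuous functions that
vanish at \<open>\<xi> = 0\<close>. Redefining it on the line of frequency \<eta> gives the version that is continuous at 0.\<close>

lemma mean_stays_zero:
  assumes t: "t1 \<in> {0..T}" "t2 \<in> {0..T}" "t1 \<le> t2" and i: "integrable cyl (u t1)"
    and z: "fourier (u t1) (0, \<eta>) = 0"
  shows "has_fourier_value (u t2) 0 \<eta> 0" "integrable cyl (u t2) \<Longrightarrow> fourier (u t2) (0, \<eta>) = 0"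
proof -
  define Z where "Z = (\<lambda>\<xi>. cis (t2 * dispersion \<eta> \<xi>) * (cis (- (t1 * dispersion \<eta> \<xi>)) * fourier (u t1) (\<xi>, \<eta>) - duhamel \<eta> t1 t2 \<xi>))"
  define B where "B = (\<lambda>\<xi>. cmod (fourier (u t1) (\<xi>, \<eta>)) + cmod (duhamel \<eta> t1 t2 \<xi>))"
  have cc: "continuous_on UNIV (\<lambda>\<xi>. fourier (u t1) (\<xi>, \<eta>))" "continuous_on UNIV (duhamel \<eta> t1 t2)"
    by (intro continuous_on_fourier i continuous_on_duhamel t)+
  have Bc: "continuous_on UNIV B" unfolding B_def by (intro continuous_intros cc)
  have B0: "B 0 = 0" by (simp add: B_def z duhamel_zero)
  have ZB: "cmod (Z \<xi>) \<le> B \<xi>" for \<xi>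
    unfolding Z_def B_def norm_mult by (simp, rule order_trans[OF norm_triangle_ineq4]) (simp add: norm_mult)
  have Zae: "AE \<xi> in lborel. uhat t2 (\<xi>, \<eta>) = Z \<xi>"
    using duhamel_formula[OF t, of \<eta>] uhat_eq_fourier[OF t(1) i, of \<eta>]
  proof eventually_elim
    case (elim \<xi>)
    have "cis (t2 * dispersion \<eta> \<xi>) * (cis (- (t2 * dispersion \<eta> \<xi>)) * uhat t2 (\<xi>, \<eta>)) = Z \<xi>"
      unfolding elim(1) unfolding elim(2) Z_def ..
    thus ?case by (simp add: mult.assoc[symmetric] cis_mult)
  qed
  have Zm: "Z \<in> borel_measurable borel" unfolding Z_def
    using borel_measurable_dispersion[of \<eta>] cc[THEN borel_measurable_continuous_onI] by measurable
  define F where "F = (\<lambda>q. if snd q = \<eta> then Z (fst q) else uhat t2 q)"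
  have uF: "is_fourier (u t2) F"
  proof (rule is_fourier_cong_AE[OF is_fourier_uhat[OF t(2)]])
    have um: "uhat t2 \<in> borel_measurable freq" by (rule L2_measurable[OF uhat_L2[OF t(2)]])
    have "{q \<in> space freq. snd q = \<eta>} \<in> sets freq" using measurable_snd_freq by measurable
    thus Fm: "F \<in> borel_measurable freq" unfolding F_def
      by (intro measurable_If measurable_compose[OF measurable_fst_freq Zm] um)
    show "AE q in freq. uhat t2 q = F q" unfolding freq_def
    proof (rule freq_pair.AE_pair_measure)
      show "{q \<in> space (lborel \<Otimes>\<^sub>M count_space UNIV). uhat t2 q = F q} \<in> sets (lborel \<Otimes>\<^sub>M count_space UNIV)"
      proof -
        have "(\<lambda>q. uhat t2 q - F q) \<in> borel_measurable freq" using um Fm by measurable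
        from measurable_sets[OF this, of "{0}"]
        have "(\<lambda>q. uhat t2 q - F q) -` {0} \<inter> space freq \<in> sets freq" by simp
        also have "(\<lambda>q. uhat t2 q - F q) -` {0} \<inter> space freq = {q \<in> space freq. uhat t2 q = F q}" by auto
        finally show ?thesis by (simp add: freq_def)
      qed
      show "AE \<xi> in lborel. AE k in count_space UNIV. uhat t2 (\<xi>, k) = F (\<xi>, k)"
        using Zae by eventually_elim (auto simp: F_def AE_count_space)
    qed
    show "u t2 \<in> borel_measurable cyl" by (rule L2_measurable[OF u_L2[OF t(2)]])
  qed simp
  have "(Z \<longlongrightarrow> 0) (at 0)"
  proof (rule Lim_null_comparison)
    have "(B \<longlongrightarrow> B 0) (at 0)" using Bc by (simp add: continuous_on_eq_continuous_at isContD)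
    thus "(B \<longlongrightarrow> 0) (at 0)" by (simp add: B0)
  qed (rule always_eventually, rule allI, rule ZB)
  moreover have Z0: "Z 0 = 0" using ZB[of 0] by (simp add: B0)
  ultimately have "isCont Z 0" by (simp add: isCont_def)
  thus "has_fourier_value (u t2) 0 \<eta> 0"
    unfolding has_fourier_value_def using uF Z0 by (intro exI[of _ F]) (simp add: F_def)
  assume i2: "integrable cyl (u t2)"
  \<comment> \<open>The excess of the Fourier integral over the bound \<open>B\<close>: continuous, zero almost everywhere, hence zero at \<open>\<xi> = 0\<close>.\<close>
  define X where "X = (\<lambda>\<xi>. complex_of_real (max 0 (cmod (fourier (u t2) (\<xi>, \<eta>)) - B \<xi>)))"
  have Xc: "continuous_on UNIV X" unfolding X_def by (intro continuous_intros continuous_on_fourier i2 Bc)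
  have Xae: "AE \<xi> in lborel. X \<xi> = 0"
    using Zae uhat_eq_fourier[OF t(2) i2, of \<eta>]
  proof eventually_elim
    case (elim \<xi>)
    hence "cmod (fourier (u t2) (\<xi>, \<eta>)) \<le> B \<xi>" using ZB[of \<xi>] by simp
    thus ?case by (simp add: X_def)
  qed
  have "X 0 = 0" by (rule continuous_AE_zero[OF Xc _ Xae]) auto
  thus "fourier (u t2) (0, \<eta>) = 0" by (simp add: X_def B0 max_def split: if_splits)
qed

text \<open>Duhamel's formula divided by \<xi>. The quotients of the Fourier transforms tend to their derivatives at 0, and
the integral that remains is, on either side of 0, a continuous function of \<xi>.\<close>

lemma first_moment_identity:
  assumes t: "t1 \<in> {0..T}" "t2 \<in> {0..T}" "t1 \<le> t2" and i: "integrable cyl (u t1)" "integrable cyl (u t2)"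
    and z: "fourier (u t1) (0, \<eta>) = 0" "fourier (u t2) (0, \<eta>) = 0"
    and D1: "((\<lambda>\<xi>. fourier (u t1) (\<xi>, \<eta>)) has_vector_derivative D1) (at 0)"
    and D2: "((\<lambda>\<xi>. fourier (u t2) (\<xi>, \<eta>)) has_vector_derivative D2) (at 0)"
  shows "of_real (sin ((t2 - t1) * (of_int \<eta>)\<^sup>2)) * D1
    = (LINT \<tau>:{0..t2 - t1}|lborel. of_real (sin ((t2 - t1 - \<tau>) * (of_int \<eta>)\<^sup>2)) * source \<eta> (t1 + \<tau>) 0)"
proof -
  define n where "n = (real_of_int \<eta>)\<^sup>2"
  define c1 where "c1 = (\<lambda>\<xi>. fourier (u t1) (\<xi>, \<eta>))"
  define c2 where "c2 = (\<lambda>\<xi>. fourier (u t2) (\<xi>, \<eta>))"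
  have sub: "{t1..t2} \<subseteq> {0..T}" using t by auto
  define P where "P = (\<lambda>\<sigma> \<xi>. integral {t1..t2} (\<lambda>t. cis (- (t * (\<sigma> * (\<xi>\<^sup>2 + n)))) * source \<eta> t \<xi>))"
  have cP: "continuous_on UNIV (P \<sigma>)" for \<sigma>
  proof -
    have "continuous_on (UNIV \<times> cbox t1 t2) (\<lambda>z. cis (- (snd z * (\<sigma> * ((fst z)\<^sup>2 + n)))) * (\<lambda>(t, \<xi>). source \<eta> t \<xi>) (snd z, fst z))"
      by (intro continuous_intros continuous_on_compose2[OF continuous_on_source[of \<eta>]]) (use sub in auto)
    hence "continuous_on (UNIV \<times> cbox t1 t2) (\<lambda>(\<xi>, t). cis (- (t * (\<sigma> * (\<xi>\<^sup>2 + n)))) * source \<eta> t \<xi>)"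
      by (simp add: split_def)
    from integral_continuous_on_param[OF this] show ?thesis by (simp add: P_def)
  qed
  have slope: "((\<lambda>\<xi>. c \<xi> / of_real \<xi>) \<longlongrightarrow> D) (at 0)"
    if "(c has_vector_derivative D) (at 0)" "c 0 = 0" for c :: "real \<Rightarrow> complex" and D
  proof -
    have "((\<lambda>h. norm (c (0 + h) - c 0 - h *\<^sub>R D) / norm h) \<longlongrightarrow> 0) (at 0)"
      using that(1) unfolding has_vector_derivative_def has_derivative_at by blast
    hence "((\<lambda>h. norm (c h / of_real h - D)) \<longlongrightarrow> 0) (at 0)"
    proof (rule Lim_transform_eventually)
      show "\<forall>\<^sub>F h in at 0. norm (c (0 + h) - c 0 - h *\<^sub>R D) / norm h = norm (c h / of_real h - D)"
        unfolding eventually_at_filter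
      proof (rule always_eventually, intro allI impI)
        fix h :: real assume "h \<noteq> 0"
        hence "c h / of_real h - D = (c h - h *\<^sub>R D) / of_real h" by (simp add: scaleR_conv_of_real field_simps)
        thus "norm (c (0 + h) - c 0 - h *\<^sub>R D) / norm h = norm (c h / of_real h - D)"
          by (simp add: that(2) norm_divide)
      qed
    qed
    thus ?thesis by (simp add: tendsto_norm_zero_iff LIM_zero_iff)
  qed
  have eq: "cis (- (t2 * (\<sigma> * n))) * D2 = cis (- (t1 * (\<sigma> * n))) * D1 - P \<sigma> 0" if \<sigma>: "\<sigma> = 1 \<or> \<sigma> = -1" for \<sigma> :: real
  proof -
    let ?f = "\<lambda>\<xi>. cis (- (t1 * (\<sigma> * (\<xi>\<^sup>2 + n)))) * (c1 \<xi> / of_real \<xi>) - cis (- (t2 * (\<sigma> * (\<xi>\<^sup>2 + n)))) * (c2 \<xi> / of_real \<xi>)"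
    have "cis (- (t1 * (\<sigma> * n))) * D1 - cis (- (t2 * (\<sigma> * n))) * D2 = P \<sigma> 0"
    proof (rule tendsto_one_sided[of "P \<sigma>" \<sigma> ?f])
      show "continuous_on UNIV (P \<sigma>)" by (rule cP)
      have ph: "((\<lambda>\<xi>. cis (- (t * (\<sigma> * (\<xi>\<^sup>2 + n))))) \<longlongrightarrow> cis (- (t * (\<sigma> * n)))) (at 0)" for t
      proof -
        have "continuous_on UNIV (\<lambda>\<xi>. cis (- (t * (\<sigma> * (\<xi>\<^sup>2 + n)))))" by (intro continuous_intros)
        from continuous_on_UNIV_tendsto[OF this, of 0] show ?thesis by simp
      qed
      have "(?f \<longlongrightarrow> cis (- (t1 * (\<sigma> * n))) * D1 - cis (- (t2 * (\<sigma> * n))) * D2) (at 0)"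
        by (intro tendsto_diff tendsto_mult ph slope) (use D1 D2 z in \<open>auto simp: c1_def c2_def\<close>)
      thus "(?f \<longlongrightarrow> cis (- (t1 * (\<sigma> * n))) * D1 - cis (- (t2 * (\<sigma> * n))) * D2) (at 0 within {\<xi>. 0 < \<sigma> * \<xi>})"
        by (rule tendsto_within_subset) simp
      show "?f \<xi> = P \<sigma> \<xi>" if "0 < \<sigma> * \<xi>" for \<xi>
      proof -
        have d: "dispersion \<eta> \<xi> = \<sigma> * (\<xi>\<^sup>2 + n)" and nz: "\<xi> \<noteq> 0" using that \<sigma> by (auto simp: dispersion_def n_def sgn_if)
        have "duhamel \<eta> t1 t2 \<xi> = integral {t1..t2} (\<lambda>t. of_real \<xi> * (cis (- (t * (\<sigma> * (\<xi>\<^sup>2 + n)))) * source \<eta> t \<xi>))"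
          by (simp add: duhamel_def rotated_source_def d mult.assoc)
        also have "\<dots> = of_real \<xi> * P \<sigma> \<xi>" by (simp add: P_def)
        finally have "cis (- (t1 * (\<sigma> * (\<xi>\<^sup>2 + n)))) * c1 \<xi> - cis (- (t2 * (\<sigma> * (\<xi>\<^sup>2 + n)))) * c2 \<xi> = of_real \<xi> * P \<sigma> \<xi>"
          using duhamel_formula_pointwise[OF t i nz, of \<eta>] by (simp add: c1_def c2_def d)
        hence "(cis (- (t1 * (\<sigma> * (\<xi>\<^sup>2 + n)))) * c1 \<xi> - cis (- (t2 * (\<sigma> * (\<xi>\<^sup>2 + n)))) * c2 \<xi>) / of_real \<xi> = P \<sigma> \<xi>"
          using nz by simp
        thus ?thesis by (simp add: diff_divide_distrib)
      qed
    qed (use \<sigma> in auto)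
    thus ?thesis by (simp add: algebra_simps)
  qed
  have "of_real (2 * sin (t2 * n - t1 * n)) * \<i> * D1 = cis (t2 * n) * P 1 0 - cis (- (t2 * n)) * P (-1) 0"
    by (rule cis_opposite_phases_eq[of _ D2]) (use eq[of 1] eq[of "-1"] in simp_all)
  also have "\<dots> = integral {t1..t2} (\<lambda>t. cis (t2 * n) * (cis (- (t * n)) * source \<eta> t 0)) - integral {t1..t2} (\<lambda>t. cis (- (t2 * n)) * (cis (t * n) * source \<eta> t 0))"
    by (simp add: P_def)
  also have "\<dots> = integral {t1..t2} (\<lambda>t. cis (t2 * n) * (cis (- (t * n)) * source \<eta> t 0) - cis (- (t2 * n)) * (cis (t * n) * source \<eta> t 0))"
    by (rule Henstock_Kurzweil_Integration.integral_diff[symmetric]; rule integrable_continuous_interval;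
        intro continuous_intros continuous_on_subset[OF continuous_on_source_section sub])
  also have "\<dots> = integral {t1..t2} (\<lambda>t. (2 * \<i>) * (of_real (sin ((t2 - t) * n)) * source \<eta> t 0))"
  proof (rule Henstock_Kurzweil_Integration.integral_cong)
    fix t
    have "cis (t2 * n) * cis (- (t * n)) - cis (- (t2 * n)) * cis (t * n) = 2 * \<i> * of_real (sin ((t2 - t) * n))"
    proof -
      have "t2 * n + - (t * n) = (t2 - t) * n" "- (t2 * n) + t * n = - ((t2 - t) * n)" by (simp_all add: algebra_simps)
      thus ?thesis unfolding cis_mult by (simp only:) (simp add: complex_eq_iff)
    qed
    thus "cis (t2 * n) * (cis (- (t * n)) * source \<eta> t 0) - cis (- (t2 * n)) * (cis (t * n) * source \<eta> t 0) = (2 * \<i>) * (of_real (sin ((t2 - t) * n)) * source \<eta> t 0)"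
      by (simp only: mult.assoc[symmetric] left_diff_distrib[symmetric])
  qed
  also have "\<dots> = (2 * \<i>) * integral {t1..t2} (\<lambda>t. of_real (sin ((t2 - t) * n)) * source \<eta> t 0)" by simp
  finally have e: "of_real (sin ((t2 - t1) * n)) * D1 = integral {t1..t2} (\<lambda>t. of_real (sin ((t2 - t) * n)) * source \<eta> t 0)"
    by (simp add: left_diff_distrib)
  define h where "h = (\<lambda>\<tau>. of_real (sin ((t2 - t1 - \<tau>) * n)) * source \<eta> (t1 + \<tau>) 0)"
  have hc: "continuous_on {0..t2 - t1} h" unfolding h_def
    by (intro continuous_intros continuous_on_compose2[OF continuous_on_source_section]) (use t in auto)
  have "integral {t1..t2} (\<lambda>t. of_real (sin ((t2 - t) * n)) * source \<eta> t 0) = integral {0..t2 - t1} h"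
  proof -
    have "continuous_on {0 + t1..(t2 - t1) + t1} (\<lambda>t. of_real (sin ((t2 - t) * n)) * source \<eta> t 0)"
      by (intro continuous_intros continuous_on_subset[OF continuous_on_source_section]) (use sub in auto)
    from integral_shift[OF this] show ?thesis by (simp add: h_def comp_def algebra_simps)
  qed
  also have "\<dots> = (LINT \<tau>:{0..t2 - t1}|lborel. h \<tau>)"
    by (intro set_borel_integral_eq_integral(2)[symmetric] borel_integrable_atLeastAtMost' hc)
  finally show ?thesis using e by (simp add: h_def n_def)
qed

end

text \<open>This holds for every \<open>f\<close>, since the two integrands coincide.\<close>

lemma integral_exp_eq_fourier:
  "(\<integral>(x, y). exp (- \<i> * of_int \<eta> * of_real y) * f (x, y) \<partial>cyl) = fourier f (0, \<eta>)"
  "(\<integral>(x, y). exp (- \<i> * of_real y * of_int \<eta>) * f (x, y) \<partial>cyl) = fourier f (0, \<eta>)"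
  by (simp_all add: fourier_def split_def mult_ac)

text \<open>The Bochner integral has the value 0 on functions that are not integrable.\<close>

lemma fourier_not_integrable:
  assumes [measurable]: "f \<in> borel_measurable cyl" and n: "\<not> integrable cyl f"
  shows "fourier f (\<xi>, \<eta>) = 0"
proof -
  have "\<not> integrable cyl (\<lambda>p. f p * cis (- (fst p * \<xi>) - snd p * of_int \<eta>))"
  proof
    assume "integrable cyl (\<lambda>p. f p * cis (- (fst p * \<xi>) - snd p * of_int \<eta>))"
    hence "integrable cyl (\<lambda>p. f p * cis (- (fst p * \<xi>) - snd p * of_int \<eta>) * cis (fst p * \<xi> + snd p * of_int \<eta>))"
      by (rule integrable_times_cis) measurable
    thus False using n by (simp add: mult.assoc cis_mult)
  qed
  thus ?thesis unfolding fourier_eq by (rule not_integrable_integral_eq)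
qed

lemma sin_zero_imp_multiple:
  assumes "sin x = 0" "x \<ge> 0"
  obtains l :: nat where "x = pi * of_nat l"
proof -
  obtain i :: int where i: "x = of_int i * pi" using assms(1) unfolding sin_zero_iff_int2 by auto
  have "i \<ge> 0"
  proof (rule ccontr)
    assume "\<not> i \<ge> 0"
    hence "of_int i * pi < 0" by (simp add: mult_neg_pos)
    thus False using i assms(2) by simp
  qed
  thus thesis using that[of "nat i"] i by (simp add: mult.commute)
qed

lemma regularity_thresholds:
  fixes \<theta> :: real
  shows "1 / 4 < \<theta> \<Longrightarrow> \<theta> < 1 / 2 \<Longrightarrow> 6 \<le> (8 * \<theta> + 2) / (4 * \<theta> - 1) \<and> 3 \<le> 6 * \<theta> / (4 * \<theta> - 1)"
    and "1 < \<theta> \<Longrightarrow> \<theta> < 3 / 2 \<Longrightarrow> 6 \<le> (8 * \<theta> + 6) / (4 * \<theta> - 3) \<and> 3 \<le> 6 * \<theta> / (4 * \<theta> - 3)"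
  by (simp_all add: pos_le_divide_eq)

context regular_solution
begin

lemma two_times_mean_zero:
  assumes t: "t1 \<in> {0..T}" "t2 \<in> {0..T}" "t1 < t2" and d: "u t1 \<in> L2_plus 1" "u t2 \<in> L2_plus 1"
    and s: "t \<in> {t1..T}" and nr: "\<forall>l::nat. \<bar>t2 - t1\<bar> * (of_int \<eta>)\<^sup>2 \<noteq> pi * of_nat l"
  shows "has_fourier_value (u t) 0 \<eta> 0" "fourier (u t) (0, \<eta>) = 0"
proof -
  have i: "integrable cyl (u t1)" "integrable cyl (u t2)"
    using L2_plus_integrable(1)[OF u_L2] t d by auto
  have sT: "t \<in> {0..T}" "t1 \<le> t" using s t by auto
  have "sin ((t2 - t1) * (of_int \<eta>)\<^sup>2) \<noteq> 0"
  proof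
    assume "sin ((t2 - t1) * (of_int \<eta>)\<^sup>2) = 0"
    moreover have "(t2 - t1) * (of_int \<eta>)\<^sup>2 \<ge> 0" using t by simp
    ultimately obtain l :: nat where "(t2 - t1) * (of_int \<eta>)\<^sup>2 = pi * of_nat l" by (rule sin_zero_imp_multiple)
    thus False using nr t by simp
  qed
  moreover have "of_real (sin ((t2 - t1) * (of_int \<eta>)\<^sup>2)) * fourier (u t1) (0, \<eta>) = 0"
    by (rule sin_times_mean) (use t i in auto)
  ultimately have z: "fourier (u t1) (0, \<eta>) = 0" by simp
  show "has_fourier_value (u t) 0 \<eta> 0" by (rule mean_stays_zero(1)[OF t(1) sT i(1) z])
  show "fourier (u t) (0, \<eta>) = 0"
  proof (cases "integrable cyl (u t)")
    case True
    thus ?thesis by (rule mean_stays_zero(2)[OF t(1) sT i(1) z])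
  next
    case False
    thus ?thesis by (intro fourier_not_integrable L2_measurable u_L2 sT)
  qed
qed

lemma two_times_first_moment:
  assumes t: "t1 \<in> {0..T}" "t2 \<in> {0..T}" "t1 < t2" and d: "u t1 \<in> L2_plus 3" "u t2 \<in> L2_plus 3"
    and z: "\<And>t. t \<in> {0..T} \<Longrightarrow> fourier (u t) (0, \<eta>) = 0"
    and D: "((\<lambda>\<xi>. fourier (u t1) (\<xi>, \<eta>)) has_vector_derivative D) (at 0)"
  shows "of_real (sin ((t2 - t1) * (of_int \<eta>)\<^sup>2)) * D
    = (LINT \<tau>:{0..t2 - t1}|lborel. of_real (sin ((t2 - t1 - \<tau>) * (of_int \<eta>)\<^sup>2)) * source \<eta> (t1 + \<tau>) 0)"
  by (rule first_moment_identity[OF t(1,2) _ _ _ z[OF t(1)] z[OF t(2)] D fourier_has_vector_derivative])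
     (use t d L2_plus_integrable(2,3)[OF u_L2] in auto)

text \<open>For almost every small \<open>t\<close> the first moment identity for the times 0 and \<open>t\<close> is available. Its right-hand side
is at most \<open>n C t\<^sup>2\<close> with \<open>n = \<eta>\<^sup>2\<close>, while the sine is at least \<open>n t / 2\<close>, so that \<open>|D| \<le> 2 C t\<close>.\<close>

lemma first_moment_zero:
  assumes z: "\<And>t. t \<in> {0..T} \<Longrightarrow> fourier (u t) (0, \<eta>) = 0" and T1: "0 < T1" "T1 \<le> T"
    and decay: "u \<in> Linf_L2_plus T1 3" "u 0 \<in> L2_plus 3" and \<eta>: "\<eta> \<noteq> 0"
    and D: "((\<lambda>\<xi>. fourier (u 0) (\<xi>, \<eta>)) has_vector_derivative D) (at 0)"
  shows "D = 0"
proof -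
  define n where "n = (real_of_int \<eta>)\<^sup>2"
  have n: "n > 0" using \<eta> by (simp add: n_def)
  obtain C where C: "\<forall>t\<in>{0..T}. cmod (source \<eta> t 0) \<le> C" using source_bounded by blast
  have C0: "C \<ge> 0" using C T1 norm_ge_zero[of "source \<eta> 0 0"] by (meson atLeastAtMost_iff less_eq_real_def less_le_trans order_refl order_trans)
  have ae: "AE t in lborel. t \<in> {0..T1} \<longrightarrow> u t \<in> L2_plus 3"
  proof -
    obtain \<epsilon> C where "\<epsilon> > 0" and ae: "AE t in lborel. t \<in> {0..T1} \<longrightarrow> u t \<in> L2 (wcyl (3 + \<epsilon>)) \<and> l2norm (wcyl (3 + \<epsilon>)) (u t) \<le> C"
      using decay(1) unfolding Linf_L2_plus_def by auto
    show ?thesis using ae \<open>\<epsilon> > 0\<close> by (auto elim!: eventually_mono simp: L2_plus_def)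
  qed
  have bound: "\<bar>sin (t * n)\<bar> * cmod D \<le> t * (t * n * C)" if t: "0 < t" "t \<le> T1" "u t \<in> L2_plus 3" for t
  proof -
    let ?h = "\<lambda>\<tau>. of_real (sin ((t - 0 - \<tau>) * n)) * source \<eta> (0 + \<tau>) 0"
    have tT: "0 \<in> {0..T}" "t \<in> {0..T}" using t T1 by auto
    have hc: "continuous_on {0..t} ?h"
      by (intro continuous_intros continuous_on_compose2[OF continuous_on_source_section]) (use t T1 in auto)
    have "of_real (sin ((t - 0) * n)) * D = (LINT \<tau>:{0..t - 0}|lborel. ?h \<tau>)"
      unfolding n_def by (rule two_times_first_moment[OF tT _ decay(2) t(3) z D]) (use t in auto)
    also have "\<dots> = integral {0..t} ?h"
      using set_borel_integral_eq_integral(2)[OF borel_integrable_atLeastAtMost'[OF hc]] by simp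
    finally have e: "of_real (sin ((t - 0) * n)) * D = integral {0..t} ?h" .
    have "\<bar>sin (t * n)\<bar> * cmod D = cmod (of_real (sin ((t - 0) * n)) * D)" by (simp add: norm_mult)
    also have "\<dots> = cmod (integral {0..t} ?h)" by (simp only: e)
    also have "\<dots> \<le> t * n * C * (t - 0)"
    proof (rule integral_bound[OF _ hc])
      fix \<tau> assume \<tau>: "\<tau> \<in> {0..t}"
      have "\<bar>sin ((t - 0 - \<tau>) * n)\<bar> \<le> \<bar>(t - 0 - \<tau>) * n\<bar>" by (rule abs_sin_x_le_abs_x)
      also have "\<dots> \<le> t * n" using \<tau> n by (simp add: abs_mult mult_right_mono)
      finally show "norm (?h \<tau>) \<le> t * n * C"
        unfolding norm_mult norm_of_real using C \<tau> t T1 n by (intro mult_mono) auto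
    qed (use t in auto)
    finally show ?thesis by (simp add: mult_ac)
  qed
  have "((\<lambda>h. sin h / h) \<longlongrightarrow> 1) (at (0::real))"
    using DERIV_sin[of "0::real"] by (simp add: DERIV_def)
  hence "\<forall>\<^sub>F h in at (0::real). 1 / 2 < sin h / h" by (rule order_tendstoD(1)) simp
  then obtain \<delta> :: real where \<delta>: "\<delta> > 0" "\<And>h. h \<noteq> 0 \<Longrightarrow> \<bar>h\<bar> < \<delta> \<Longrightarrow> 1 / 2 < sin h / h"
    unfolding eventually_at by (auto simp only: dist_real_def diff_0_right UNIV_I)
  have small: "cmod D \<le> e" if e: "e > 0" for e
  proof -
    \<comment> \<open>Below \<open>\<delta> / n\<close> the sine exceeds half its argument; below \<open>e / (2 C + 1)\<close> the resulting bound \<open>2 C t\<close> is at most \<open>e\<close>.\<close>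
    define m where "m = min T1 (min (\<delta> / n) (e / (2 * C + 1)))"
    have "m > 0" using T1 \<delta>(1) n C0 e by (simp add: m_def add_nonneg_pos)
    from AE_lborel_exists[OF ae this] obtain t where t: "t \<in> {0<..<m}" "t \<in> {0..T1} \<longrightarrow> u t \<in> L2_plus 3" by blast
    have t': "0 < t" "t \<le> T1" "t < \<delta> / n" "t < e / (2 * C + 1)" using t(1) by (auto simp: m_def)
    hence ut: "u t \<in> L2_plus 3" using t(2) by simp
    have tn: "0 < t * n" "t * n < \<delta>" using t' n by (auto simp: pos_less_divide_eq)
    have "t * n \<noteq> 0" "\<bar>t * n\<bar> < \<delta>" using tn by linarith+
    from \<delta>(2)[OF this] have "1 / 2 * (t * n) < sin (t * n)" using tn(1) by (simp only: pos_less_divide_eq)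
    hence "t * n / 2 < sin (t * n)" by simp
    hence "t * n / 2 * cmod D \<le> \<bar>sin (t * n)\<bar> * cmod D" by (intro mult_right_mono) auto
    also have "\<dots> \<le> t * (t * n * C)" by (rule bound[OF t'(1,2) ut])
    finally have "(t * n) * cmod D \<le> (t * n) * (2 * C * t)" by (simp add: mult_ac)
    hence "cmod D \<le> 2 * C * t" using tn(1) by (rule mult_left_le_imp_le)
    also have "\<dots> \<le> (2 * C + 1) * t" using t' by (simp add: algebra_simps)
    also have "\<dots> \<le> e" using t'(4) C0 by (simp add: pos_less_divide_eq mult.commute)
    finally show ?thesis .
  qed
  have "cmod D \<le> 0" by (rule field_le_epsilon) (simp add: small)
  thus ?thesis by simp
qed

end

theorem theorem1p8:
  fixes K :: nat and \<nu> :: "nat \<Rightarrow> real"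
  assumes "K \<ge> 1" and "\<exists>k\<in>{1..K}. \<nu> k \<noteq> 0"
  shows
    "(\<forall>(\<theta>::real) (s1::real) (s2::real) (T::real) (u :: real \<Rightarrow> real \<times> real \<Rightarrow> complex)
        (t1::real) (t2::real).
        1 / 4 < \<theta> \<and> \<theta> < 1 / 2 \<and>
        s1 \<ge> (8 * \<theta> + 2) / (4 * \<theta> - 1) \<and> s2 > 6 * \<theta> / (4 * \<theta> - 1) \<and>
        u \<in> cont_sobolev T s1 s2 \<inter> cont_L2 T (wcyl (2 * \<theta>)) \<and> solves_E K \<nu> T u \<and>
        t1 \<in> {0..T} \<and> t2 \<in> {0..T} \<and> t1 < t2 \<and>
        u t1 \<in> L2_plus 1 \<and> u t2 \<in> L2_plus 1 \<longrightarrow>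
        (\<forall>t\<in>{t1..T}. \<forall>\<eta>::int. (\<forall>l::nat. \<bar>t2 - t1\<bar> * (of_int \<eta>)\<^sup>2 \<noteq> pi * of_nat l) \<longrightarrow>
           has_fourier_value (u t) 0 \<eta> 0 \<and>
           (\<integral>(x, y). exp (- \<i> * of_int \<eta> * of_real y) * u t (x, y) \<partial>cyl) = 0)) \<and>
     (\<forall>(\<theta>::real) (s1::real) (s2::real) (T::real) (u :: real \<Rightarrow> real \<times> real \<Rightarrow> complex).
        1 < \<theta> \<and> \<theta> < 3 / 2 \<and>
        s1 \<ge> (8 * \<theta> + 6) / (4 * \<theta> - 3) \<and> s2 > 6 * \<theta> / (4 * \<theta> - 3) \<and>
        u \<in> cont_sobolev T s1 s2 \<inter> cont_L2 T (wcyl (2 * \<theta>)) \<and> solves_E K \<nu> T u \<and>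
        (\<forall>\<eta>::int. \<forall>t\<in>{0..T}.
           (\<integral>(x, y). exp (- \<i> * of_real y * of_int \<eta>) * u t (x, y) \<partial>cyl) = 0) \<longrightarrow>
        (\<forall>(t1::real) (t2::real).
           t1 \<in> {0..T} \<and> t2 \<in> {0..T} \<and> t1 < t2 \<and> u t1 \<in> L2_plus 3 \<and> u t2 \<in> L2_plus 3 \<longrightarrow>
           (\<forall>\<eta>::int. \<exists>D. ((\<lambda>\<xi>. fourier (u t1) (\<xi>, \<eta>)) has_vector_derivative D) (at 0) \<and>
              of_real (sin ((t2 - t1) * (of_int \<eta>)\<^sup>2)) * D =
              (LINT \<tau>:{0..t2 - t1}|lborel. of_real (sin ((t2 - t1 - \<tau>) * (of_int \<eta>)\<^sup>2)) *
                 (\<Sum>k=1..K. \<i> * of_real (\<nu> k) / of_nat (k + 1) *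
                    fourier (\<lambda>p. u (t1 + \<tau>) p ^ (k + 1)) (0, \<eta>))))) \<and>
        (\<forall>T1::real. 0 < T1 \<and> T1 \<le> T \<and> u \<in> Linf_L2_plus T1 3 \<and> u 0 \<in> L2_plus 3 \<longrightarrow>
           (\<forall>\<eta>::int. \<eta> \<noteq> 0 \<longrightarrow>
              (\<integral>(x, y). exp (- \<i> * of_int \<eta> * of_real y) * of_real x * u 0 (x, y) \<partial>cyl) = 0)))"
proof (intro conjI allI impI ballI; (elim conjE)?)
  fix \<theta> s1 s2 T :: real and u :: "real \<Rightarrow> real \<times> real \<Rightarrow> complex" and t1 t2 t :: real and \<eta> :: int
  assume th: "1 / 4 < \<theta>" "\<theta> < 1 / 2" "(8 * \<theta> + 2) / (4 * \<theta> - 1) \<le> s1" "6 * \<theta> / (4 * \<theta> - 1) < s2"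
    and u: "u \<in> cont_sobolev T s1 s2 \<inter> cont_L2 T (wcyl (2 * \<theta>))" "solves_E K \<nu> T u"
    and t: "t1 \<in> {0..T}" "t2 \<in> {0..T}" "t1 < t2" "u t1 \<in> L2_plus 1" "u t2 \<in> L2_plus 1"
    and s: "t \<in> {t1..T}" and nr: "\<forall>l::nat. \<bar>t2 - t1\<bar> * (of_int \<eta>)\<^sup>2 \<noteq> pi * of_nat l"
  interpret regular_solution K \<nu> T s1 s2 u
    by unfold_locales (use regularity_thresholds(1)[OF th(1,2)] th u in auto)
  show "has_fourier_value (u t) 0 \<eta> 0" by (rule two_times_mean_zero(1)[OF t s nr])
  show "(\<integral>(x, y). exp (- \<i> * of_int \<eta> * of_real y) * u t (x, y) \<partial>cyl) = 0"
    unfolding integral_exp_eq_fourier(1) by (rule two_times_mean_zero(2)[OF t s nr])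
next
  fix \<theta> s1 s2 T :: real and u :: "real \<Rightarrow> real \<times> real \<Rightarrow> complex"
  assume th: "1 < \<theta>" "\<theta> < 3 / 2" "(8 * \<theta> + 6) / (4 * \<theta> - 3) \<le> s1" "6 * \<theta> / (4 * \<theta> - 3) < s2"
    and u: "u \<in> cont_sobolev T s1 s2 \<inter> cont_L2 T (wcyl (2 * \<theta>))" "solves_E K \<nu> T u"
    and zero: "\<forall>\<eta>::int. \<forall>t\<in>{0..T}. (\<integral>(x, y). exp (- \<i> * of_real y * of_int \<eta>) * u t (x, y) \<partial>cyl) = 0"
  interpret regular_solution K \<nu> T s1 s2 u
    by unfold_locales (use regularity_thresholds(2)[OF th(1,2)] th u in auto)
  have z: "fourier (u t) (0, \<eta>) = 0" if "t \<in> {0..T}" for t \<eta>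
    using zero that unfolding integral_exp_eq_fourier(2) by blast
  {
    fix t1 t2 :: real and \<eta> :: int
    assume t: "t1 \<in> {0..T}" "t2 \<in> {0..T}" "t1 < t2" "u t1 \<in> L2_plus 3" "u t2 \<in> L2_plus 3"
    from two_times_first_moment[OF t z fourier_has_vector_derivative[OF L2_plus_integrable(2,3)[OF u_L2[OF t(1)] t(4)]]]
      fourier_has_vector_derivative[OF L2_plus_integrable(2,3)[OF u_L2[OF t(1)] t(4)], of \<eta> 0]
    show "\<exists>D. ((\<lambda>\<xi>. fourier (u t1) (\<xi>, \<eta>)) has_vector_derivative D) (at 0) \<and>
              of_real (sin ((t2 - t1) * (of_int \<eta>)\<^sup>2)) * D =
              (LINT \<tau>:{0..t2 - t1}|lborel. of_real (sin ((t2 - t1 - \<tau>) * (of_int \<eta>)\<^sup>2)) *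
                 (\<Sum>k=1..K. \<i> * of_real (\<nu> k) / of_nat (k + 1) *
                    fourier (\<lambda>p. u (t1 + \<tau>) p ^ (k + 1)) (0, \<eta>)))"
      unfolding source_def by blast
  }
  fix T1 :: real and \<eta> :: int
  assume T1: "0 < T1" "T1 \<le> T" and decay: "u \<in> Linf_L2_plus T1 3" "u 0 \<in> L2_plus 3" and \<eta>: "\<eta> \<noteq> 0"
  have "0 \<in> {0..T}" using T1 by simp
  note D = fourier_has_vector_derivative[OF L2_plus_integrable(2,3)[OF u_L2[OF this] decay(2)], of \<eta> 0]
  have "- \<i> * (\<integral>p. u 0 p * of_real (fst p) * cis (- (fst p * 0) - snd p * of_int \<eta>) \<partial>cyl) = 0"
    by (rule first_moment_zero[OF z T1 decay \<eta> D])
  moreover have "(\<integral>(x, y). exp (- \<i> * of_int \<eta> * of_real y) * of_real x * u 0 (x, y) \<partial>cyl)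
      = (\<integral>p. u 0 p * of_real (fst p) * cis (- (fst p * 0) - snd p * of_int \<eta>) \<partial>cyl)"
    by (simp add: split_def cis_conv_exp mult_ac)
  ultimately show "(\<integral>(x, y). exp (- \<i> * of_int \<eta> * of_real y) * of_real x * u 0 (x, y) \<partial>cyl) = 0" by simp
qed

end
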